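(* Let $G$ be a locally compact unimodular group, let $\Omega\in \mathcal{Z}_{bs}^2(G,\mathbb{C}^* )$, and let $\sigma$ be a symmetric weight associated to $|\Omega|$. Suppose that there exist a symmetric weakly subadditive weight $\omega$ on $G$ with $1/\omega\in L^\Psi(G)$ and $M>0$ such that $$\frac{\sigma(st)}{\sigma(s)\sigma(t)}\leq \frac{M\,\omega(st)}{\omega(s)\omega(t)}\qquad (s,t\in G).$$ Then $\rho:=\sigma/\omega$ defines a symmetric weight on $G$, and $(L^\Phi_\sigma(G),\circledast_{\mathbb{T}},\|\cdot\|_{\Phi,\sigma})$ is a differential $*$-subalgebra of $(L^1_\rho(G),\circledast_{\mathbb{T}},\|\cdot\|_{1,\rho})$, where $\circledast_{\mathbb{T}}$ is the twisted convolution coming from $\Omega_{\mathbb{T}}$. In particular, $(L^\Phi_\sigma(G),\circledast_{\mathbb{T}},\|\cdot\|_{\Phi,\sigma})$ is symmetric whenever $(L^1_\rho(G),\circledast_{\mathbb{T}},\|\cdot\|_{1,\rho})$ is symmetric.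
   Context: $G$ carries a fixed left Haar measure $ds$. A Young function is a nonzero convex function $\Phi:[0,\infty)\to[0,\infty]$ with $\Phi(0)=0$ and $\lim_{x\to\infty}\Phi(x)=\infty$; its complementary Young function is $\Psi(y)=\sup\{xy-\Phi(x):x\ge 0\}$. Standing assumption: $(\Phi,\Psi)$ is a complementary pair of Young functions with $\Phi$ real-valued and continuous on $[0,\infty)$ and positive on $(0,\infty)$. $L^\Phi(G)$ is the space of measurable $f:G\to\mathbb{C}$ (modulo a.e. equality) with $\int_G\Phi(\alpha|f(s)|)\,ds<\infty$ for some $\alpha>0$, with norm $\|f\|_\Phi=\sup\{\int_G|f v|\,ds:\int_G\Psi(|v(s)|)\,ds\le 1\}$; $L^\Psi(G)$ is defined in the same way with $\Phi,\Psi$ exchanged. A normalized 2-cocycle on $G$ with values in $\mathbb{C}^*=\mathbb{C}\setminus\{0\}$ is a Borel measurable map $\Omega:G\times G\to\mathbb{C}^*$ with $\Omega(r,s)\Omega(rs,t)=\Omega(s,t)\Omega(r,st)$ and $\Omega(r,e)=\Omega(e,r)=1$. Write $|\Omega|(s,t)=|\Omega(s,t)|$ and $\Omega_{\mathbb{T}}=\Omega/|\Omega|$. $\mathcal{Z}_b^2(G,\mathbb{C}^* )$ is the group of such $\Omega$ with $\Omega\in L^\infty(G\times G)$ and $\Omega_{\mathbb{T}}$ continuous. $\mathcal{Z}_{bw}^2(G,\mathbb{C}^* )$ consists of those $\Omega\in\mathcal{Z}_b^2(G,\mathbb{C}^* )$ for which $|\Omega|(s,t)=\frac{\omega(st)}{\omega(s)\omega(t)}$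 for all $s,t$, where $\omega:G\to(0,\infty)$ is a locally integrable measurable function with $\omega(e)=1$ and $1/\omega\in L^\infty(G)$; such an $\omega$ is called a weight on $G$ and is said to be associated to $|\Omega|$. (So a weight is a locally integrable measurable $\omega:G\to(0,\infty)$ with $\omega(e)=1$, $1/\omega$ bounded and $\omega(st)/(\omega(s)\omega(t))$ bounded.) A weight is symmetric if $\omega(s)=\omega(s^{-1})$ for all $s$; $\mathcal{Z}_{bs}^2(G,\mathbb{C}^* )$ consists of those $\Omega\in\mathcal{Z}_{bw}^2(G,\mathbb{C}^* )$ for which $|\Omega|$ has an associated symmetric weight. A function $\mathcal{L}:G\to(0,\infty)$ is weakly subadditive if there is $C>0$ with $\mathcal{L}(st)\le C(\mathcal{L}(s)+\mathcal{L}(t))$ for all $s,t\in G$. For a weight $\sigma$, $L^\Phi_\sigma(G)=\{f: f\sigma\in L^\Phi(G)\}$ with norm $\|f\|_{\Phi,\sigma}=\|f\sigma\|_\Phi$; for a weight $\rho$, $L^1_\rho(G)=\{f: f\rho\in L^1(G)\}$ with norm $\|f\|_{1,\rho}=\|f\rho\|_1$. The twisted convolution coming from $\Omega_{\mathbb{T}}$ is $(f\circledast_{\mathbb{T}}g)(t)=\int_G f(s)g(s^{-1}t)\Omega_{\mathbb{T}}(s,s^{-1}t)\,ds$, and the involution is $f^*(s)=\overline{f(s^{-1})}\,\Delta(s^{-1})\,\overline{\Omega_{\mathbb{T}}(s,s^{-1})}$ with $\Delta$ the modular function ($\Delta\equiv1$ for unimodular $G$). Banach algebras are understood with bounded multiplication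 ($\|ab\|\le C\|a\|\|b\|$ for some constant $C$). A Banach $*$-algebra $A$ is symmetric if $\sigma_A(a^*a)\subseteq[0,\infty)$ for every $a\in A$, where $\sigma_A(b)$ denotes the spectrum of $b$ in $A$ (spectra in non-unital algebras are taken in the unitization). For Banach algebras $A\subseteq B$, $A$ is a differential subalgebra of $B$ if there is $C>0$ with $\|ab\|_A\le C(\|a\|_A\|b\|_B+\|a\|_B\|b\|_A)$ for all $a,b\in A$; it is a differential $*$-subalgebra if in addition $B$ is a Banach $*$-algebra and $A$ is a Banach $*$-algebra that is a $*$-subalgebra of $B$. *)

theory Defs
  imports "HOL-Analysis.Analysis"
begin

(* Groups are types of class topological_group_add. This class does not assume commutativity;
   it is merely written additively: s + t, - s and 0 stand for the product, the inverse and the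
   identity element. *)

section \<open>Haar measure\<close>

definition left_haar_measure :: "'g::{group_add,topological_space} measure \<Rightarrow> bool" where
  "left_haar_measure \<mu> \<longleftrightarrow>
     sets \<mu> = sets borel \<and>
     emeasure \<mu> UNIV \<noteq> 0 \<and>
     (\<forall>K. compact K \<longrightarrow> emeasure \<mu> K < \<infinity>) \<and>
     (\<forall>A\<in>sets borel. emeasure \<mu> A = (INF U\<in>{U. open U \<and> A \<subseteq> U}. emeasure \<mu> U)) \<and>
     (\<forall>U. open U \<longrightarrow> emeasure \<mu> U = (SUP K\<in>{K. compact K \<and> K \<subseteq> U}. emeasure \<mu> K)) \<and>
     (\<forall>g. \<forall>A\<in>sets borel. emeasure \<mu> ((\<lambda>x. g + x) ` A) = emeasure \<mu> A)"

definition modular_function :: "'g::group_add measure \<Rightarrow> 'g \<Rightarrow> real" where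
  "modular_function \<mu> g =
     (THE c. 0 < c \<and> (\<forall>A\<in>sets \<mu>. emeasure \<mu> ((\<lambda>x. x + g) ` A) = ennreal c * emeasure \<mu> A))"

definition unimodular :: "'g::group_add measure \<Rightarrow> bool" where
  "unimodular \<mu> \<longleftrightarrow> (\<forall>g. \<forall>A\<in>sets \<mu>. emeasure \<mu> ((\<lambda>x. x + g) ` A) = emeasure \<mu> A)"

section \<open>Young functions and Orlicz spaces\<close>

(* Only the values of a Young function on [0,\<infinity>) matter. *)

definition young_function :: "(real \<Rightarrow> ennreal) \<Rightarrow> bool" where
  "young_function \<Phi> \<longleftrightarrow>
     \<Phi> 0 = 0 \<and>
     (\<exists>x\<ge>0. \<Phi> x \<noteq> 0) \<and>
     (\<forall>x\<ge>0. \<forall>y\<ge>0. \<forall>t\<in>{0..1}.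
        \<Phi> ((1 - t) * x + t * y) \<le> ennreal (1 - t) * \<Phi> x + ennreal t * \<Phi> y) \<and>
     (\<Phi> \<longlongrightarrow> \<infinity>) at_top"

(* Subtraction on ennreal is truncated at 0; this does not affect the supremum, since the term
   for x = 0 is 0 anyway. *)

definition complementary_young_pair :: "(real \<Rightarrow> ennreal) \<Rightarrow> (real \<Rightarrow> ennreal) \<Rightarrow> bool" where
  "complementary_young_pair \<Phi> \<Psi> \<longleftrightarrow>
     young_function \<Phi> \<and> young_function \<Psi> \<and>
     (\<forall>y\<ge>0. \<Psi> y = (SUP x\<in>{0..}. ennreal (x * y) - \<Phi> x))"

definition orlicz_space :: "'g measure \<Rightarrow> (real \<Rightarrow> ennreal) \<Rightarrow> ('g \<Rightarrow> complex) set" where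
  "orlicz_space \<mu> \<Phi> =
     {f \<in> borel_measurable \<mu>. \<exists>\<alpha>>0. (\<integral>\<^sup>+ s. \<Phi> (\<alpha> * cmod (f s)) \<partial>\<mu>) < \<infinity>}"

(* The Young function passed here is the complementary one: the norm of L^\<Phi> is
   orlicz_norm \<mu> \<Psi>. *)

definition orlicz_norm :: "'g measure \<Rightarrow> (real \<Rightarrow> ennreal) \<Rightarrow> ('g \<Rightarrow> complex) \<Rightarrow> real" where
  "orlicz_norm \<mu> \<Psi> f =
     enn2real (SUP v\<in>{v \<in> borel_measurable \<mu>. (\<integral>\<^sup>+ s. \<Psi> (cmod (v s)) \<partial>\<mu>) \<le> 1}.
                 \<integral>\<^sup>+ s. ennreal (cmod (f s * v s)) \<partial>\<mu>)"

section \<open>Weights and 2-cocycles\<close>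

definition weight :: "'g::{group_add,topological_space} measure \<Rightarrow> ('g \<Rightarrow> real) \<Rightarrow> bool" where
  "weight \<mu> \<omega> \<longleftrightarrow>
     (\<forall>s. 0 < \<omega> s) \<and>
     \<omega> \<in> borel_measurable \<mu> \<and>
     (\<forall>K. compact K \<longrightarrow> set_integrable \<mu> K \<omega>) \<and>
     \<omega> 0 = 1 \<and>
     bounded (range (\<lambda>s. 1 / \<omega> s)) \<and>
     bounded (range (\<lambda>(s, t). \<omega> (s + t) / (\<omega> s * \<omega> t)))"

definition symmetric_weight :: "'g::{group_add,topological_space} measure \<Rightarrow> ('g \<Rightarrow> real) \<Rightarrow> bool" where
  "symmetric_weight \<mu> \<omega> \<longleftrightarrow> weight \<mu> \<omega> \<and> (\<forall>s. \<omega> (- s) = \<omega> s)"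

definition weakly_subadditive :: "('g::plus \<Rightarrow> real) \<Rightarrow> bool" where
  "weakly_subadditive L \<longleftrightarrow>
     (\<forall>s. 0 < L s) \<and> (\<exists>C>0. \<forall>s t. L (s + t) \<le> C * (L s + L t))"

definition cocycle :: "('g::{group_add,topological_space} \<times> 'g \<Rightarrow> complex) \<Rightarrow> bool" where
  "cocycle \<Omega> \<longleftrightarrow>
     \<Omega> \<in> borel_measurable borel \<and>
     (\<forall>p. \<Omega> p \<noteq> 0) \<and>
     (\<forall>r s t. \<Omega> (r, s) * \<Omega> (r + s, t) = \<Omega> (s, t) * \<Omega> (r, s + t)) \<and>
     (\<forall>r. \<Omega> (r, 0) = 1 \<and> \<Omega> (0, r) = 1)"

definition unimodular_part :: "('g \<times> 'g \<Rightarrow> complex) \<Rightarrow> 'g \<times> 'g \<Rightarrow> complex" where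
  "unimodular_part \<Omega> p = \<Omega> p / of_real (cmod (\<Omega> p))"

(* Membership in L^\<infinity>(G \<times> G) refers to a Haar measure of the product group. *)

definition Z2b :: "('g::{group_add,topological_space} \<times> 'g \<Rightarrow> complex) set" where
  "Z2b = {\<Omega>. cocycle \<Omega> \<and>
              (\<exists>\<nu> K. left_haar_measure \<nu> \<and> (AE p in \<nu>. cmod (\<Omega> p) \<le> K)) \<and>
              continuous_on UNIV (unimodular_part \<Omega>)}"

definition associated_weight ::
  "'g::{group_add,topological_space} measure \<Rightarrow> ('g \<times> 'g \<Rightarrow> complex) \<Rightarrow> ('g \<Rightarrow> real) \<Rightarrow> bool" where
  "associated_weight \<mu> \<Omega> \<omega> \<longleftrightarrow>
     weight \<mu> \<omega> \<and> (\<forall>s t. cmod (\<Omega> (s, t)) = \<omega> (s + t) / (\<omega> s * \<omega> t))"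

definition Z2bw :: "'g::{group_add,topological_space} measure \<Rightarrow> ('g \<times> 'g \<Rightarrow> complex) set" where
  "Z2bw \<mu> = {\<Omega> \<in> Z2b. \<exists>\<omega>. associated_weight \<mu> \<Omega> \<omega>}"

definition Z2bs :: "'g::{group_add,topological_space} measure \<Rightarrow> ('g \<times> 'g \<Rightarrow> complex) set" where
  "Z2bs \<mu> = {\<Omega> \<in> Z2bw \<mu>. \<exists>\<omega>. associated_weight \<mu> \<Omega> \<omega> \<and> symmetric_weight \<mu> \<omega>}"

section \<open>Banach \<open>*\<close>-algebras\<close>

record 'v complex_algebra =
  acarrier :: "'v set"
  azero :: 'v
  aadd :: "'v \<Rightarrow> 'v \<Rightarrow> 'v"
  ascale :: "complex \<Rightarrow> 'v \<Rightarrow> 'v"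
  amult :: "'v \<Rightarrow> 'v \<Rightarrow> 'v"

record 'v normed_algebra = "'v complex_algebra" +
  anorm :: "'v \<Rightarrow> real"

record 'v normed_star_algebra = "'v normed_algebra" +
  astar :: "'v \<Rightarrow> 'v"

definition asub :: "('v, 'm) complex_algebra_scheme \<Rightarrow> 'v \<Rightarrow> 'v \<Rightarrow> 'v" where
  "asub A a b = aadd A a (ascale A (- 1) b)"

definition is_complex_algebra :: "('v, 'm) complex_algebra_scheme \<Rightarrow> bool" where
  "is_complex_algebra A \<longleftrightarrow>
     azero A \<in> acarrier A \<and>
     (\<forall>a\<in>acarrier A. \<forall>b\<in>acarrier A. aadd A a b \<in> acarrier A \<and> amult A a b \<in> acarrier A) \<and>
     (\<forall>z. \<forall>a\<in>acarrier A. ascale A z a \<in> acarrier A) \<and>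
     (\<forall>a\<in>acarrier A. \<forall>b\<in>acarrier A. \<forall>c\<in>acarrier A.
        aadd A (aadd A a b) c = aadd A a (aadd A b c) \<and>
        amult A (amult A a b) c = amult A a (amult A b c) \<and>
        amult A (aadd A a b) c = aadd A (amult A a c) (amult A b c) \<and>
        amult A a (aadd A b c) = aadd A (amult A a b) (amult A a c)) \<and>
     (\<forall>a\<in>acarrier A. \<forall>b\<in>acarrier A. aadd A a b = aadd A b a) \<and>
     (\<forall>a\<in>acarrier A.
        aadd A (azero A) a = a \<and> asub A a a = azero A \<and> ascale A 1 a = a) \<and>
     (\<forall>z w. \<forall>a\<in>acarrier A.
        ascale A (z * w) a = ascale A z (ascale A w a) \<and>
        ascale A (z + w) a = aadd A (ascale A z a) (ascale A w a)) \<and>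
     (\<forall>z. \<forall>a\<in>acarrier A. \<forall>b\<in>acarrier A.
        ascale A z (aadd A a b) = aadd A (ascale A z a) (ascale A z b) \<and>
        amult A (ascale A z a) b = ascale A z (amult A a b) \<and>
        amult A a (ascale A z b) = ascale A z (amult A a b))"

definition banach_algebra :: "('v, 'm) normed_algebra_scheme \<Rightarrow> bool" where
  "banach_algebra A \<longleftrightarrow>
     is_complex_algebra A \<and>
     (\<forall>a\<in>acarrier A. 0 \<le> anorm A a \<and> (anorm A a = 0 \<longleftrightarrow> a = azero A)) \<and>
     (\<forall>z. \<forall>a\<in>acarrier A. anorm A (ascale A z a) = cmod z * anorm A a) \<and>
     (\<forall>a\<in>acarrier A. \<forall>b\<in>acarrier A. anorm A (aadd A a b) \<le> anorm A a + anorm A b) \<and>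
     (\<exists>C>0. \<forall>a\<in>acarrier A. \<forall>b\<in>acarrier A. anorm A (amult A a b) \<le> C * anorm A a * anorm A b) \<and>
     (\<forall>X :: nat \<Rightarrow> 'v. range X \<subseteq> acarrier A \<longrightarrow>
        (\<forall>e>0. \<exists>N. \<forall>m\<ge>N. \<forall>n\<ge>N. anorm A (asub A (X m) (X n)) < e) \<longrightarrow>
        (\<exists>x\<in>acarrier A. (\<lambda>n. anorm A (asub A (X n) x)) \<longlonglongrightarrow> 0))"

definition banach_star_algebra :: "('v, 'm) normed_star_algebra_scheme \<Rightarrow> bool" where
  "banach_star_algebra A \<longleftrightarrow>
     banach_algebra A \<and>
     (\<forall>a\<in>acarrier A.
        astar A a \<in> acarrier A \<and> astar A (astar A a) = a \<and> anorm A (astar A a) = anorm A a) \<and>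
     (\<forall>z. \<forall>a\<in>acarrier A. astar A (ascale A z a) = ascale A (cnj z) (astar A a)) \<and>
     (\<forall>a\<in>acarrier A. \<forall>b\<in>acarrier A.
        astar A (aadd A a b) = aadd A (astar A a) (astar A b) \<and>
        astar A (amult A a b) = amult A (astar A b) (astar A a))"

definition subalgebra :: "('v, 'm) complex_algebra_scheme \<Rightarrow> ('v, 'n) complex_algebra_scheme \<Rightarrow> bool" where
  "subalgebra A B \<longleftrightarrow>
     acarrier A \<subseteq> acarrier B \<and>
     azero A = azero B \<and>
     (\<forall>a\<in>acarrier A. \<forall>b\<in>acarrier A. aadd A a b = aadd B a b \<and> amult A a b = amult B a b) \<and>
     (\<forall>z. \<forall>a\<in>acarrier A. ascale A z a = ascale B z a)"

definition differential_subalgebra ::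
  "('v, 'm) normed_algebra_scheme \<Rightarrow> ('v, 'n) normed_algebra_scheme \<Rightarrow> bool" where
  "differential_subalgebra A B \<longleftrightarrow>
     banach_algebra A \<and> banach_algebra B \<and> subalgebra A B \<and>
     (\<exists>C>0. \<forall>a\<in>acarrier A. \<forall>b\<in>acarrier A.
        anorm A (amult A a b) \<le> C * (anorm A a * anorm B b + anorm B a * anorm A b))"

definition differential_star_subalgebra ::
  "('v, 'm) normed_star_algebra_scheme \<Rightarrow> ('v, 'n) normed_star_algebra_scheme \<Rightarrow> bool" where
  "differential_star_subalgebra A B \<longleftrightarrow>
     differential_subalgebra A B \<and> banach_star_algebra A \<and> banach_star_algebra B \<and>
     (\<forall>a\<in>acarrier A. astar A a = astar B a)"

definition is_unit_element :: "('v, 'm) complex_algebra_scheme \<Rightarrow> 'v \<Rightarrow> bool" where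
  "is_unit_element A e \<longleftrightarrow>
     e \<in> acarrier A \<and> (\<forall>a\<in>acarrier A. amult A e a = a \<and> amult A a e = a)"

definition ainvertible :: "('v, 'm) complex_algebra_scheme \<Rightarrow> 'v \<Rightarrow> bool" where
  "ainvertible A a \<longleftrightarrow>
     (\<exists>b\<in>acarrier A. is_unit_element A (amult A a b) \<and> is_unit_element A (amult A b a))"

(* The pair (a, z) is a + z1, with 1 the adjoined unit. *)

definition unitization :: "('v, 'm) complex_algebra_scheme \<Rightarrow> ('v \<times> complex) complex_algebra" where
  "unitization A =
     \<lparr> acarrier = acarrier A \<times> UNIV,
       azero = (azero A, 0),
       aadd = (\<lambda>(a, z) (b, w). (aadd A a b, z + w)),
       ascale = (\<lambda>c (a, z). (ascale A c a, c * z)),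
       amult = (\<lambda>(a, z) (b, w).
                  (aadd A (amult A a b) (aadd A (ascale A z b) (ascale A w a)), z * w)) \<rparr>"

definition unital_spectrum :: "('v, 'm) complex_algebra_scheme \<Rightarrow> 'v \<Rightarrow> 'v \<Rightarrow> complex set" where
  "unital_spectrum A e a = {z. \<not> ainvertible A (asub A a (ascale A z e))}"

definition spectrum :: "('v, 'm) complex_algebra_scheme \<Rightarrow> 'v \<Rightarrow> complex set" where
  "spectrum A a =
     (if \<exists>e. is_unit_element A e
      then unital_spectrum A (THE e. is_unit_element A e) a
      else unital_spectrum (unitization A) (azero A, 1) (a, 0))"

definition symmetric_algebra :: "('v, 'm) normed_star_algebra_scheme \<Rightarrow> bool" where
  "symmetric_algebra A \<longleftrightarrow>
     banach_star_algebra A \<and>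
     (\<forall>a\<in>acarrier A. spectrum A (amult A (astar A a) a) \<subseteq> complex_of_real ` {0..})"

section \<open>Twisted convolution algebras\<close>

definition ae_class :: "'g measure \<Rightarrow> ('g \<Rightarrow> complex) \<Rightarrow> ('g \<Rightarrow> complex) set" where
  "ae_class \<mu> f = {g \<in> borel_measurable \<mu>. AE s in \<mu>. g s = f s}"

(* The common value of F on all representatives of the given classes. *)

definition lift1 :: "('f \<Rightarrow> 'r) \<Rightarrow> 'f set \<Rightarrow> 'r" where
  "lift1 F X = the_elem (F ` X)"

definition lift2 :: "('f \<Rightarrow> 'f \<Rightarrow> 'r) \<Rightarrow> 'f set \<Rightarrow> 'f set \<Rightarrow> 'r" where
  "lift2 F X Y = the_elem ((\<lambda>(f, g). F f g) ` (X \<times> Y))"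

definition twisted_convolution ::
  "'g::group_add measure \<Rightarrow> ('g \<times> 'g \<Rightarrow> complex) \<Rightarrow> ('g \<Rightarrow> complex) \<Rightarrow> ('g \<Rightarrow> complex) \<Rightarrow> 'g \<Rightarrow> complex" where
  "twisted_convolution \<mu> \<Omega> f g t =
     (\<integral>s. f s * g (- s + t) * unimodular_part \<Omega> (s, - s + t) \<partial>\<mu>)"

definition twisted_involution ::
  "'g::group_add measure \<Rightarrow> ('g \<times> 'g \<Rightarrow> complex) \<Rightarrow> ('g \<Rightarrow> complex) \<Rightarrow> 'g \<Rightarrow> complex" where
  "twisted_involution \<mu> \<Omega> f s =
     cnj (f (- s)) * of_real (modular_function \<mu> (- s)) * cnj (unimodular_part \<Omega> (s, - s))"

definition twisted_algebra ::
  "'g::group_add measure \<Rightarrow> ('g \<times> 'g \<Rightarrow> complex) \<Rightarrow> ('g \<Rightarrow> complex) set \<Rightarrow> (('g \<Rightarrow> complex) \<Rightarrow> real)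
     \<Rightarrow> ('g \<Rightarrow> complex) set normed_star_algebra" where
  "twisted_algebra \<mu> \<Omega> X N =
     \<lparr> acarrier = ae_class \<mu> ` X,
       azero = ae_class \<mu> (\<lambda>_. 0),
       aadd = lift2 (\<lambda>f g. ae_class \<mu> (\<lambda>s. f s + g s)),
       ascale = (\<lambda>z. lift1 (\<lambda>f. ae_class \<mu> (\<lambda>s. z * f s))),
       amult = lift2 (\<lambda>f g. ae_class \<mu> (twisted_convolution \<mu> \<Omega> f g)),
       anorm = lift1 N,
       astar = lift1 (\<lambda>f. ae_class \<mu> (twisted_involution \<mu> \<Omega> f)) \<rparr>"

definition orlicz_algebra ::
  "'g::group_add measure \<Rightarrow> ('g \<times> 'g \<Rightarrow> complex) \<Rightarrow> (real \<Rightarrow> ennreal) \<Rightarrow> (real \<Rightarrow> ennreal)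
     \<Rightarrow> ('g \<Rightarrow> real) \<Rightarrow> ('g \<Rightarrow> complex) set normed_star_algebra" where
  "orlicz_algebra \<mu> \<Omega> \<Phi> \<Psi> \<sigma> =
     twisted_algebra \<mu> \<Omega>
       {f \<in> borel_measurable \<mu>. (\<lambda>s. f s * of_real (\<sigma> s)) \<in> orlicz_space \<mu> \<Phi>}
       (\<lambda>f. orlicz_norm \<mu> \<Psi> (\<lambda>s. f s * of_real (\<sigma> s)))"

definition L1_algebra ::
  "'g::group_add measure \<Rightarrow> ('g \<times> 'g \<Rightarrow> complex) \<Rightarrow> ('g \<Rightarrow> real)
     \<Rightarrow> ('g \<Rightarrow> complex) set normed_star_algebra" where
  "L1_algebra \<mu> \<Omega> \<rho> =
     twisted_algebra \<mu> \<Omega>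
       {f \<in> borel_measurable \<mu>. integrable \<mu> (\<lambda>s. f s * of_real (\<rho> s))}
       (\<lambda>f. \<integral>s. cmod (f s * of_real (\<rho> s)) \<partial>\<mu>)"

end

theory Submission
  imports Defs
begin

text \<open>
  Write the group additively, as below. The hypothesis on \<open>\<sigma>\<close> together with weak subadditivity of \<open>\<omega>\<close> gives
  \<open>\<sigma>(s + t) \<le> M C (\<sigma>(s) \<rho>(t) + \<rho>(s) \<sigma>(t))\<close>. Hence \<open>|f \<circledast> g| \<sigma>\<close> is at most \<open>M C\<close> times the sum of the ordinary
  convolutions of \<open>|f| \<sigma>\<close> with \<open>|g| \<rho>\<close> and of \<open>|f| \<rho>\<close> with \<open>|g| \<sigma>\<close> (\<open>test_norm_conv_le\<close>). As the norm of
  \<open>L\<^sup>\<Phi>\<close> is invariant under translations and, the group being unimodular, under inversion, convolving with an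
  \<open>L\<^sup>1\<close> function on either side multiplies this norm by at most the \<open>L\<^sup>1\<close> norm (\<open>test_norm_nnconv\<close>,
  \<open>test_norm_nnconv_right\<close>), and this is the differential inequality. Hoelder's inequality against
  \<open>1 / \<omega> \<in> L\<^sup>\<Psi>\<close> embeds the weighted \<open>L\<^sup>\<Phi>\<close> into the weighted \<open>L\<^sup>1\<close>, so the differential inequality contains the
  boundedness of the multiplication of \<open>L\<^sup>\<Phi>\<close>. Both norms are suprema of integrals against a set of test
  functions, which allows one to prove the axioms of a Banach \<open>*\<close>-algebra for both spaces at once
  (\<open>weighted_space\<close>).

  Symmetry passes from an algebra \<open>B\<close> to a differential \<open>*\<close>-subalgebra \<open>A\<close>
  (\<open>symmetric_algebra_differential_subalgebra\<close>). By the differential inequality, a Neumann series converges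
  in \<open>A\<close> under a smallness condition on the norm of \<open>B\<close> only. If the spectrum of \<open>a\<^sup>* a\<close> in \<open>B\<close> lies in \<open>[0, \<infinity>)\<close>
  and \<open>z\<close> does not, then \<open>1 - t z\<inverse> a\<^sup>* a\<close> is invertible over \<open>B\<close> for \<open>0 \<le> t \<le> 1\<close>, with locally bounded inverses;
  so its invertibility over \<open>A\<close> propagates from \<open>t = 0\<close> to \<open>t = 1\<close>.

  The group is an arbitrary locally compact one, so its Haar measure need not be \<sigma>-finite, and the kernel
  \<open>f(s) g(- s + t)\<close> of two Borel functions need not be measurable for the product \<sigma>-algebra. Integrable
  functions vanish almost everywhere outside a \<sigma>-compact set and agree almost everywhere with Baire
  functions, for which the kernel is measurable (\<open>convolution_kernel\<close>); and a convolution does not see the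
  change of representatives, because a unimodular Haar measure is invariant under inversion
  (\<open>distr_uminus\<close>). From there on, Fubini's theorem is available for all convolutions.
\<close>

section \<open>Invertibility in differential subalgebras\<close>

locale complex_algebra =
  fixes A :: "('v, 'm) complex_algebra_scheme" (structure)
  assumes is_algebra: "is_complex_algebra A"
begin

notation aadd (infixl "\<oplus>\<index>" 65)
notation amult (infixl "\<odot>\<index>" 70)
notation ascale (infixr "\<cdot>\<index>" 75)

lemma zero_closed [simp]: "azero A \<in> acarrier A"
  and add_closed [simp]: "a \<in> acarrier A \<Longrightarrow> b \<in> acarrier A \<Longrightarrow> a \<oplus> b \<in> acarrier A"
  and mult_closed [simp]: "a \<in> acarrier A \<Longrightarrow> b \<in> acarrier A \<Longrightarrow> a \<odot> b \<in> acarrier A"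
  and scale_closed [simp]: "a \<in> acarrier A \<Longrightarrow> z \<cdot> a \<in> acarrier A"
  using is_algebra by (auto simp: is_complex_algebra_def)

lemma add_assoc: "a \<in> acarrier A \<Longrightarrow> b \<in> acarrier A \<Longrightarrow> c \<in> acarrier A \<Longrightarrow> a \<oplus> b \<oplus> c = a \<oplus> (b \<oplus> c)"
  and add_comm: "a \<in> acarrier A \<Longrightarrow> b \<in> acarrier A \<Longrightarrow> a \<oplus> b = b \<oplus> a"
  and mult_assoc: "a \<in> acarrier A \<Longrightarrow> b \<in> acarrier A \<Longrightarrow> c \<in> acarrier A \<Longrightarrow> a \<odot> b \<odot> c = a \<odot> (b \<odot> c)"
  and distrib_right: "a \<in> acarrier A \<Longrightarrow> b \<in> acarrier A \<Longrightarrow> c \<in> acarrier A \<Longrightarrow> (a \<oplus> b) \<odot> c = a \<odot> c \<oplus> b \<odot> c"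
  and distrib_left: "a \<in> acarrier A \<Longrightarrow> b \<in> acarrier A \<Longrightarrow> c \<in> acarrier A \<Longrightarrow> a \<odot> (b \<oplus> c) = a \<odot> b \<oplus> a \<odot> c"
  and add_zero_left [simp]: "a \<in> acarrier A \<Longrightarrow> azero A \<oplus> a = a"
  and scale_one [simp]: "a \<in> acarrier A \<Longrightarrow> 1 \<cdot> a = a"
  and scale_add_left: "a \<in> acarrier A \<Longrightarrow> (z + w) \<cdot> a = z \<cdot> a \<oplus> w \<cdot> a"
  and scale_add_right: "a \<in> acarrier A \<Longrightarrow> b \<in> acarrier A \<Longrightarrow> z \<cdot> (a \<oplus> b) = z \<cdot> a \<oplus> z \<cdot> b"
  and scale_scale: "a \<in> acarrier A \<Longrightarrow> z \<cdot> w \<cdot> a = (z * w) \<cdot> a"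
  and scale_mult_left: "a \<in> acarrier A \<Longrightarrow> b \<in> acarrier A \<Longrightarrow> (z \<cdot> a) \<odot> b = z \<cdot> (a \<odot> b)"
  and scale_mult_right: "a \<in> acarrier A \<Longrightarrow> b \<in> acarrier A \<Longrightarrow> a \<odot> (z \<cdot> b) = z \<cdot> (a \<odot> b)"
  using is_algebra by (auto simp: is_complex_algebra_def)

lemma add_left_comm:
  assumes "a \<in> acarrier A" "b \<in> acarrier A" "c \<in> acarrier A"
  shows "a \<oplus> (b \<oplus> c) = b \<oplus> (a \<oplus> c)"
  using assms by (metis add_assoc add_comm)

lemmas add_ac = add_assoc add_comm add_left_comm

lemma add_zero_right [simp]: "a \<in> acarrier A \<Longrightarrow> a \<oplus> azero A = a"
  by (metis add_comm add_zero_left zero_closed)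

lemma add_minus [simp]: "a \<in> acarrier A \<Longrightarrow> a \<oplus> (- 1) \<cdot> a = azero A"
  using is_algebra by (auto simp: is_complex_algebra_def asub_def)

lemma scale_zero [simp]: "a \<in> acarrier A \<Longrightarrow> 0 \<cdot> a = azero A"
  using scale_add_left[of a 1 "- 1"] by simp

lemma scale_add_minus:
  assumes "a \<in> acarrier A" shows "z \<cdot> a \<oplus> (- z) \<cdot> a = azero A"
  using assms scale_add_left[of a z "- z"] by simp

lemma add_left_cancel:
  assumes "a \<in> acarrier A" "b \<in> acarrier A" "c \<in> acarrier A" "a \<oplus> b = a \<oplus> c"
  shows "b = c"
proof -
  have "(- 1) \<cdot> a \<oplus> (a \<oplus> x) = x" if "x \<in> acarrier A" for x
    using that assms(1) by (metis add_assoc add_comm add_minus add_zero_left scale_closed)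
  then show ?thesis using assms by metis
qed

lemma scale_zero_right [simp]: "z \<cdot> azero A = azero A"
  using scale_scale[of "azero A" z 0] by simp

lemma sub_closed [simp]: "a \<in> acarrier A \<Longrightarrow> b \<in> acarrier A \<Longrightarrow> asub A a b \<in> acarrier A"
  by (simp add: asub_def)

lemma sub_eq_zero_iff:
  assumes "a \<in> acarrier A" "b \<in> acarrier A"
  shows "asub A a b = azero A \<longleftrightarrow> a = b"
proof
  assume "asub A a b = azero A"
  then have "(- 1) \<cdot> b \<oplus> a = (- 1) \<cdot> b \<oplus> b"
    using assms by (simp add: asub_def add_comm)
  then show "a = b" using add_left_cancel assms by (metis scale_closed)
qed (use assms in \<open>simp add: asub_def\<close>)

end

text \<open>
  With an adjoined unit, \<open>c\<close> is the element \<open>(1 - t h)\<inverse> h\<close>. Phrasing invertibility of \<open>1 - t h\<close>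
  through this element keeps all computations inside an algebra that may have no unit, and it gives
  the same notion whether or not there is one.
\<close>

definition is_resolvent :: "('v, 'm) complex_algebra_scheme \<Rightarrow> 'v \<Rightarrow> complex \<Rightarrow> 'v \<Rightarrow> bool" where
  "is_resolvent A h t c \<longleftrightarrow> c \<in> acarrier A \<and>
     c = aadd A h (ascale A t (amult A h c)) \<and> c = aadd A h (ascale A t (amult A c h))"

context complex_algebra
begin

lemma resolvent_identity:
  assumes h: "h \<in> acarrier A" and p: "is_resolvent A h s p" and q: "is_resolvent A h t q"
  shows "q = p \<oplus> (t - s) \<cdot> (p \<odot> q)"
proof -
  have [simp]: "p \<in> acarrier A" "q \<in> acarrier A" "h \<in> acarrier A"
    using p q h by (auto simp: is_resolvent_def)
  let ?P = "p \<odot> h" and ?Q = "h \<odot> q" and ?R = "p \<odot> (h \<odot> q)"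
  have 1: "p \<odot> q = ?P \<oplus> t \<cdot> ?R"
  proof -
    have "q = h \<oplus> t \<cdot> ?Q" using q by (simp add: is_resolvent_def)
    then have "p \<odot> q = p \<odot> (h \<oplus> t \<cdot> ?Q)" by simp
    then show ?thesis by (simp add: distrib_left scale_mult_right)
  qed
  have 2: "p \<odot> q = ?Q \<oplus> s \<cdot> ?R"
  proof -
    have "p = h \<oplus> s \<cdot> ?P" using p by (simp add: is_resolvent_def)
    then have "p \<odot> q = (h \<oplus> s \<cdot> ?P) \<odot> q" by simp
    then show ?thesis by (simp add: distrib_right scale_mult_left mult_assoc)
  qed
  have "(t - s) \<cdot> (p \<odot> q) = t \<cdot> (p \<odot> q) \<oplus> (- s) \<cdot> (p \<odot> q)"
    using scale_add_left[of "p \<odot> q" t "- s"] by simp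
  also have "\<dots> = t \<cdot> (?Q \<oplus> s \<cdot> ?R) \<oplus> (- s) \<cdot> (?P \<oplus> t \<cdot> ?R)"
    using 1 2 by simp
  finally have eq: "(t - s) \<cdot> (p \<odot> q) = (t \<cdot> ?Q \<oplus> (t * s) \<cdot> ?R) \<oplus> ((- s) \<cdot> ?P \<oplus> (- (t * s)) \<cdot> ?R)"
    by (simp add: scale_add_right scale_scale mult.commute)
  have "p \<oplus> (t - s) \<cdot> (p \<odot> q)
      = (h \<oplus> s \<cdot> ?P) \<oplus> ((t \<cdot> ?Q \<oplus> (t * s) \<cdot> ?R) \<oplus> ((- s) \<cdot> ?P \<oplus> (- (t * s)) \<cdot> ?R))"
    unfolding eq using p by (simp add: is_resolvent_def)
  also have "\<dots> = (h \<oplus> t \<cdot> ?Q) \<oplus> ((s \<cdot> ?P \<oplus> (- s) \<cdot> ?P) \<oplus> ((t * s) \<cdot> ?R \<oplus> (- (t * s)) \<cdot> ?R))"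
    by (simp add: add_ac)
  also have "\<dots> = h \<oplus> t \<cdot> ?Q"
    by (simp add: scale_add_minus)
  also have "\<dots> = q" using q by (simp add: is_resolvent_def)
  finally show ?thesis by simp
qed

text \<open>
  This is the factorization \<open>1 - (t + u) h = (1 - t h) (1 - u c)\<close> for \<open>c = (1 - t h)\<inverse> h\<close>: to move
  from \<open>t\<close> to \<open>t + u\<close>, only \<open>1 - u c\<close> has to be inverted.
\<close>

lemma resolvent_shift:
  assumes h: "h \<in> acarrier A" and c: "is_resolvent A h t c" and e: "is_resolvent A c u e"
  shows "is_resolvent A h (t + u) e"
proof -
  have [simp]: "c \<in> acarrier A" "e \<in> acarrier A" "h \<in> acarrier A"
    using c e h by (auto simp: is_resolvent_def)
  have c1: "c = h \<oplus> t \<cdot> (h \<odot> c)" and c2: "c = h \<oplus> t \<cdot> (c \<odot> h)"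
    and e1: "e = c \<oplus> u \<cdot> (c \<odot> e)" and e2: "e = c \<oplus> u \<cdot> (e \<odot> c)"
    using c e by (auto simp: is_resolvent_def)
  have ce: "c \<odot> e = h \<odot> e \<oplus> t \<cdot> (h \<odot> (c \<odot> e))"
  proof -
    have "c \<odot> e = (h \<oplus> t \<cdot> (h \<odot> c)) \<odot> e" using c1 by simp
    then show ?thesis by (simp add: distrib_right scale_mult_left mult_assoc)
  qed
  have he: "h \<odot> e = h \<odot> c \<oplus> u \<cdot> (h \<odot> (c \<odot> e))"
  proof -
    have "h \<odot> e = h \<odot> (c \<oplus> u \<cdot> (c \<odot> e))" using e1 by simp
    then show ?thesis by (simp add: distrib_left scale_mult_right)
  qed
  have ec: "e \<odot> c = e \<odot> h \<oplus> t \<cdot> (e \<odot> c \<odot> h)"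
  proof -
    have "e \<odot> c = e \<odot> (h \<oplus> t \<cdot> (c \<odot> h))" using c2 by simp
    also have "\<dots> = e \<odot> h \<oplus> t \<cdot> (e \<odot> c \<odot> h)"
      by (simp add: distrib_left scale_mult_right mult_assoc)
    finally show ?thesis .
  qed
  have eh: "e \<odot> h = c \<odot> h \<oplus> u \<cdot> (e \<odot> c \<odot> h)"
  proof -
    have "e \<odot> h = (c \<oplus> u \<cdot> (e \<odot> c)) \<odot> h" using e2 by simp
    then show ?thesis by (simp add: distrib_right scale_mult_left)
  qed
  have "e = (h \<oplus> t \<cdot> (h \<odot> c)) \<oplus> u \<cdot> (h \<odot> e \<oplus> t \<cdot> (h \<odot> (c \<odot> e)))"
    using e1 c1 ce by simp
  also have "\<dots> = h \<oplus> (t \<cdot> (h \<odot> c \<oplus> u \<cdot> (h \<odot> (c \<odot> e))) \<oplus> u \<cdot> (h \<odot> e))"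
    by (simp add: scale_add_right scale_scale add_ac mult.commute)
  also have "\<dots> = h \<oplus> (t + u) \<cdot> (h \<odot> e)"
    unfolding he[symmetric] by (simp add: scale_add_left)
  finally have 1: "e = h \<oplus> (t + u) \<cdot> (h \<odot> e)" .
  have "e = (h \<oplus> t \<cdot> (c \<odot> h)) \<oplus> u \<cdot> (e \<odot> h \<oplus> t \<cdot> (e \<odot> c \<odot> h))"
    using e2 c2 ec by simp
  also have "\<dots> = h \<oplus> (t \<cdot> (c \<odot> h \<oplus> u \<cdot> (e \<odot> c \<odot> h)) \<oplus> u \<cdot> (e \<odot> h))"
    by (simp add: scale_add_right scale_scale add_ac mult.commute)
  also have "\<dots> = h \<oplus> (t + u) \<cdot> (e \<odot> h)"
    unfolding eh[symmetric] by (simp add: scale_add_left)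
  finally show ?thesis using 1 by (simp add: is_resolvent_def)
qed

lemma unit_element_unique: "is_unit_element A e \<Longrightarrow> is_unit_element A e' \<Longrightarrow> e = e'"
  unfolding is_unit_element_def by metis

text \<open>
  Indeed \<open>a - z = - z (1 - z\<inverse> a)\<close>, and \<open>1 - t a\<close> is invertible iff it has a resolvent element \<open>c\<close>, its inverse
  then being \<open>1 + t c\<close>.
\<close>

lemma unital_spectrum_iff_resolvent:
  assumes e: "is_unit_element A e" and a: "a \<in> acarrier A" and z: "z \<noteq> 0"
  shows "z \<notin> unital_spectrum A e a \<longleftrightarrow> (\<exists>c. is_resolvent A a (1 / z) c)"
proof -
  have [simp]: "e \<in> acarrier A" "a \<in> acarrier A" and
    unit [simp]: "\<And>x. x \<in> acarrier A \<Longrightarrow> e \<odot> x = x" "\<And>x. x \<in> acarrier A \<Longrightarrow> x \<odot> e = x"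
    using e a by (auto simp: is_unit_element_def)
  have is_e: "is_unit_element A x \<longleftrightarrow> x = e" for x
    using e unit_element_unique by blast
  let ?d = "asub A a (z \<cdot> e)"
  have d_left: "?d \<odot> x = a \<odot> x \<oplus> (- z) \<cdot> x" if "x \<in> acarrier A" for x
    using that by (simp add: asub_def distrib_right scale_mult_left scale_scale)
  have d_right: "x \<odot> ?d = x \<odot> a \<oplus> (- z) \<cdot> x" if "x \<in> acarrier A" for x
    using that by (simp add: asub_def distrib_left scale_mult_right scale_scale)
  have eq_iff: "c = a \<oplus> (1 / z) \<cdot> y \<longleftrightarrow> z \<cdot> c = z \<cdot> a \<oplus> y"
    if [simp]: "c \<in> acarrier A" "y \<in> acarrier A" for c y
  proof
    assume c: "c = a \<oplus> (1 / z) \<cdot> y"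
    show "z \<cdot> c = z \<cdot> a \<oplus> y"
      by (subst c) (use z in \<open>simp add: scale_add_right scale_scale\<close>)
  next
    assume "z \<cdot> c = z \<cdot> a \<oplus> y"
    then have "(1 / z) \<cdot> z \<cdot> c = (1 / z) \<cdot> (z \<cdot> a \<oplus> y)" by simp
    then show "c = a \<oplus> (1 / z) \<cdot> y"
      using z by (simp add: scale_add_right scale_scale)
  qed
  have res_iff: "is_resolvent A a (1 / z) c \<longleftrightarrow>
      c \<in> acarrier A \<and> z \<cdot> c = z \<cdot> a \<oplus> a \<odot> c \<and> z \<cdot> c = z \<cdot> a \<oplus> c \<odot> a" for c
    using eq_iff[of c "a \<odot> c"] eq_iff[of c "c \<odot> a"] by (auto simp: is_resolvent_def)
  show ?thesis
  proof
    assume "z \<notin> unital_spectrum A e a"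
    then obtain b where b [simp]: "b \<in> acarrier A" and b1: "?d \<odot> b = e" and b2: "b \<odot> ?d = e"
      by (auto simp: unital_spectrum_def ainvertible_def is_e)
    have ab: "a \<odot> b = e \<oplus> z \<cdot> b"
    proof -
      have "e \<oplus> z \<cdot> b = a \<odot> b \<oplus> ((- z) \<cdot> b \<oplus> z \<cdot> b)"
        using b1 by (simp add: d_left[symmetric] add_assoc[symmetric])
      then show ?thesis using scale_add_minus[of b "- z"] by simp
    qed
    have ba: "b \<odot> a = e \<oplus> z \<cdot> b"
    proof -
      have "e \<oplus> z \<cdot> b = b \<odot> a \<oplus> ((- z) \<cdot> b \<oplus> z \<cdot> b)"
        using b2 by (simp add: d_right[symmetric] add_assoc[symmetric])
      then show ?thesis using scale_add_minus[of b "- z"] by simp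
    qed
    \<comment> \<open>The resolvent element is \<open>- z a (a - z)\<inverse>\<close>.\<close>
    have "(z * z) \<cdot> (a \<odot> b) = z \<cdot> (a \<odot> (a \<odot> b)) \<oplus> (- z) \<cdot> a"
    proof -
      have "a \<odot> (a \<odot> b) = a \<oplus> z \<cdot> (a \<odot> b)"
        using arg_cong[OF ab, of "\<lambda>x. a \<odot> x"] by (simp add: distrib_left scale_mult_right)
      then have "z \<cdot> (a \<odot> (a \<odot> b)) \<oplus> (- z) \<cdot> a = (z \<cdot> a \<oplus> (- z) \<cdot> a) \<oplus> (z * z) \<cdot> (a \<odot> b)"
        by (simp add: scale_add_right scale_scale add_ac)
      then show ?thesis by (simp add: scale_add_minus)
    qed
    then have "(- 1) \<cdot> ((z * z) \<cdot> (a \<odot> b)) = (- 1) \<cdot> (z \<cdot> (a \<odot> (a \<odot> b)) \<oplus> (- z) \<cdot> a)" by simp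
    then have "(- (z * z)) \<cdot> (a \<odot> b) = z \<cdot> a \<oplus> (- z) \<cdot> (a \<odot> (a \<odot> b))"
      by (simp add: scale_add_right scale_scale add_comm)
    moreover have "a \<odot> b \<odot> a = a \<odot> (a \<odot> b)"
      using ab ba mult_assoc[of a b a] by simp
    ultimately have "is_resolvent A a (1 / z) ((- z) \<cdot> (a \<odot> b))"
      by (simp add: res_iff scale_scale scale_mult_left scale_mult_right)
    then show "\<exists>c. is_resolvent A a (1 / z) c" ..
  next
    assume "\<exists>c. is_resolvent A a (1 / z) c"
    then obtain c where c [simp]: "c \<in> acarrier A"
      and c1: "z \<cdot> c = z \<cdot> a \<oplus> a \<odot> c" and c2: "z \<cdot> c = z \<cdot> a \<oplus> c \<odot> a"
      by (auto simp: res_iff)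
    define b where "b = (- 1 / (z * z)) \<cdot> (z \<cdot> e \<oplus> c)"
    have [simp]: "b \<in> acarrier A" by (simp add: b_def)
    have cancel: "(- 1 / (z * z)) \<cdot> ((z \<cdot> a \<oplus> y) \<oplus> (- z) \<cdot> (z \<cdot> e \<oplus> c)) = e"
      if [simp]: "y \<in> acarrier A" and "z \<cdot> c = z \<cdot> a \<oplus> y" for y
    proof -
      have "(z \<cdot> a \<oplus> y) \<oplus> (- z) \<cdot> (z \<cdot> e \<oplus> c) = z \<cdot> c \<oplus> (- z) \<cdot> c \<oplus> (- (z * z)) \<cdot> e"
        unfolding that(2)[symmetric] by (simp add: scale_add_right scale_scale add_ac)
      then show ?thesis using z by (simp add: scale_add_minus scale_scale)
    qed
    have db: "?d \<odot> b = (- 1 / (z * z)) \<cdot> ((z \<cdot> a \<oplus> a \<odot> c) \<oplus> (- z) \<cdot> (z \<cdot> e \<oplus> c))"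
    proof -
      have "?d \<odot> (z \<cdot> e \<oplus> c) = (z \<cdot> a \<oplus> a \<odot> c) \<oplus> (- z) \<cdot> (z \<cdot> e \<oplus> c)"
        using d_left[of "z \<cdot> e \<oplus> c"] distrib_left[of a "z \<cdot> e" c] by (simp add: scale_mult_right)
      then show ?thesis unfolding b_def by (simp add: scale_mult_right)
    qed
    have bd: "b \<odot> ?d = (- 1 / (z * z)) \<cdot> ((z \<cdot> a \<oplus> c \<odot> a) \<oplus> (- z) \<cdot> (z \<cdot> e \<oplus> c))"
    proof -
      have "(z \<cdot> e \<oplus> c) \<odot> ?d = (z \<cdot> a \<oplus> c \<odot> a) \<oplus> (- z) \<cdot> (z \<cdot> e \<oplus> c)"
        using d_right[of "z \<cdot> e \<oplus> c"] distrib_right[of "z \<cdot> e" c a] by (simp add: scale_mult_left)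
      then show ?thesis unfolding b_def by (simp add: scale_mult_left)
    qed
    show "z \<notin> unital_spectrum A e a"
      using db bd cancel[OF _ c1] cancel[OF _ c2] \<open>b \<in> acarrier A\<close>
      by (auto simp: unital_spectrum_def ainvertible_def is_e intro!: bexI[of _ b])
  qed
qed

lemma complex_algebra_unitization: "complex_algebra (unitization A)"
proof
  show "is_complex_algebra (unitization A)"
    unfolding is_complex_algebra_def
    by (auto simp: unitization_def asub_def add_ac mult_assoc distrib_left distrib_right
        scale_add_left scale_add_right scale_scale scale_mult_left scale_mult_right algebra_simps)
qed

lemma is_unit_element_unitization: "is_unit_element (unitization A) (azero A, 1)"
proof -
  have "azero A \<odot> a = azero A" "a \<odot> azero A = azero A" if "a \<in> acarrier A" for a
    using that scale_mult_left[of a a 0] scale_mult_right[of a a 0] by simp_all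
  then show ?thesis by (auto simp: is_unit_element_def unitization_def)
qed

text \<open>
  If a unit has to be adjoined, the equations for a resolvent element \<open>(c, w)\<close> of \<open>(a, 0)\<close> force \<open>w = 0\<close>, so
  the case distinction in the definition of the spectrum disappears.
\<close>

lemma spectrum_iff_resolvent:
  assumes a: "a \<in> acarrier A" and z: "z \<noteq> 0"
  shows "z \<notin> spectrum A a \<longleftrightarrow> (\<exists>c. is_resolvent A a (1 / z) c)"
proof (cases "\<exists>e. is_unit_element A e")
  case True
  then have "is_unit_element A (THE e. is_unit_element A e)"
    using unit_element_unique by (metis theI)
  then show ?thesis
    using unital_spectrum_iff_resolvent[OF _ a z] True by (simp add: spectrum_def)
next
  case False
  interpret U: complex_algebra "unitization A" by (rule complex_algebra_unitization)
  have a': "(a, 0) \<in> acarrier (unitization A)" using a by (simp add: unitization_def)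
  have "is_resolvent (unitization A) (a, 0) (1 / z) (c, w) \<longleftrightarrow> w = 0 \<and> is_resolvent A a (1 / z) c" for c w
    using a by (auto simp: is_resolvent_def unitization_def)
  then show ?thesis
    using U.unital_spectrum_iff_resolvent[OF is_unit_element_unitization a' z] False
    by (auto simp: spectrum_def)
qed

end


locale differential_pair = A: complex_algebra A + B: complex_algebra B
  for A :: "('v, 'm) normed_algebra_scheme" and B :: "('v, 'n) normed_algebra_scheme" +
  assumes differential: "differential_subalgebra A B"
begin

lemma banach_A: "banach_algebra A" and banach_B: "banach_algebra B" and sub: "subalgebra A B"
  using differential by (auto simp: differential_subalgebra_def)

lemma in_B [simp]: "a \<in> acarrier A \<Longrightarrow> a \<in> acarrier B"
  and add_B: "a \<in> acarrier A \<Longrightarrow> b \<in> acarrier A \<Longrightarrow> aadd B a b = aadd A a b"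
  and mult_B: "a \<in> acarrier A \<Longrightarrow> b \<in> acarrier A \<Longrightarrow> amult B a b = amult A a b"
  and scale_B: "a \<in> acarrier A \<Longrightarrow> ascale B z a = ascale A z a"
  using sub by (auto simp: subalgebra_def)

lemma norm_nonneg [simp]: "a \<in> acarrier A \<Longrightarrow> 0 \<le> anorm A a"
  and norm_eq_zero: "a \<in> acarrier A \<Longrightarrow> anorm A a = 0 \<Longrightarrow> a = azero A"
  and norm_scale: "a \<in> acarrier A \<Longrightarrow> anorm A (ascale A z a) = cmod z * anorm A a"
  and norm_triangle: "a \<in> acarrier A \<Longrightarrow> b \<in> acarrier A \<Longrightarrow> anorm A (aadd A a b) \<le> anorm A a + anorm A b"
  using banach_A by (auto simp: banach_algebra_def)

lemma norm_B_nonneg [simp]: "a \<in> acarrier B \<Longrightarrow> 0 \<le> anorm B a"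
  and norm_B_scale: "a \<in> acarrier B \<Longrightarrow> anorm B (ascale B z a) = cmod z * anorm B a"
  and norm_B_triangle: "a \<in> acarrier B \<Longrightarrow> b \<in> acarrier B \<Longrightarrow> anorm B (aadd B a b) \<le> anorm B a + anorm B b"
  using banach_B by (auto simp: banach_algebra_def)

lemma is_resolvent_B: "h \<in> acarrier A \<Longrightarrow> is_resolvent A h t c \<Longrightarrow> is_resolvent B h t c"
  by (simp add: is_resolvent_def add_B mult_B scale_B)

text \<open>
  The Neumann series of \<open>x\<close> converges in the norm of \<open>A\<close> as soon as \<open>u x\<close> is small in the norm of
  \<open>B\<close>. Indeed the powers of \<open>y = u x\<close> decay geometrically in \<open>B\<close>, and by the differential
  inequality \<open>\<parallel>y\<^sup>n\<^sup>+\<^sup>1\<parallel>\<^sub>A\<close> is at most a small multiple of \<open>\<parallel>y\<^sup>n\<parallel>\<^sub>A\<close> plus such a decaying term.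
\<close>

lemma neumann_series:
  "\<exists>\<kappa>>0. \<forall>x\<in>acarrier A. \<forall>u. \<kappa> * (cmod u * anorm B x) \<le> 1 \<longrightarrow> (\<exists>e. is_resolvent A x u e)"
proof -
  obtain C where C: "C > 0" and diff: "\<And>a b. a \<in> acarrier A \<Longrightarrow> b \<in> acarrier A \<Longrightarrow>
      anorm A (amult A a b) \<le> C * (anorm A a * anorm B b + anorm B a * anorm A b)"
    using differential unfolding differential_subalgebra_def by blast
  obtain K where K: "K > 0" and multB: "\<And>a b. a \<in> acarrier B \<Longrightarrow> b \<in> acarrier B \<Longrightarrow>
      anorm B (amult B a b) \<le> K * anorm B a * anorm B b"
    using banach_B unfolding banach_algebra_def by blast
  obtain L where L: "L > 0" and multA: "\<And>a b. a \<in> acarrier A \<Longrightarrow> b \<in> acarrier A \<Longrightarrow>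
      anorm A (amult A a b) \<le> L * anorm A a * anorm A b"
    using banach_A unfolding banach_algebra_def by blast
  have complete: "\<exists>x\<in>acarrier A. (\<lambda>n. anorm A (asub A (X n) x)) \<longlonglongrightarrow> 0"
    if "range X \<subseteq> acarrier A" "\<forall>e>0. \<exists>N. \<forall>m\<ge>N. \<forall>n\<ge>N. anorm A (asub A (X m) (X n)) < e" for X :: "nat \<Rightarrow> 'v"
    using banach_A that unfolding banach_algebra_def by blast
  define \<kappa> where "\<kappa> = 4 * (C + K)"
  have "\<exists>e. is_resolvent A x u e" if x [simp]: "x \<in> acarrier A" and small: "\<kappa> * (cmod u * anorm B x) \<le> 1" for x u
  proof -
    define y where "y = ascale A u x"
    have [simp]: "y \<in> acarrier A" by (simp add: y_def)
    have "anorm B y = cmod u * anorm B x"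
      unfolding y_def by (simp add: scale_B[symmetric] norm_B_scale)
    then have "4 * C * anorm B y + 4 * K * anorm B y \<le> 1"
      using small by (simp add: \<kappa>_def algebra_simps)
    moreover have "0 \<le> 4 * C * anorm B y" "0 \<le> 4 * K * anorm B y"
      using C K by simp_all
    ultimately have yC: "C * anorm B y \<le> 1 / 4" and yK: "K * anorm B y \<le> 1 / 4"
      by linarith+
    \<comment> \<open>\<open>D n\<close> is \<open>u\<^sup>n\<^sup>+\<^sup>1 x\<^sup>n\<^sup>+\<^sup>2\<close>, and \<open>T n\<close> is the sum of \<open>u\<^sup>k x\<^sup>k\<^sup>+\<^sup>1\<close> over \<open>k \<le> n\<close>.\<close>
    define D where "D = rec_nat (amult A y x) (\<lambda>_ d. amult A y d)"
    have D0: "D 0 = amult A y x" and DS: "D (Suc n) = amult A y (D n)" for n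
      by (simp_all add: D_def)
    have [simp]: "D n \<in> acarrier A" for n by (induction n) (simp_all add: D0 DS)
    define T where "T = rec_nat x (\<lambda>n t. aadd A t (D n))"
    have T0: "T 0 = x" and TS: "T (Suc n) = aadd A (T n) (D n)" for n
      by (simp_all add: T_def)
    have T [simp]: "T n \<in> acarrier A" for n by (induction n) (simp_all add: T0 TS)
    have D_comm: "amult A (D n) y = D (Suc n)" for n
    proof (induction n)
      case 0 then show ?case by (simp add: D0 DS y_def A.scale_mult_left A.scale_mult_right A.mult_assoc)
    next
      case (Suc n)
      have "amult A (D (Suc n)) y = amult A y (amult A (D n) y)"
        by (simp add: DS A.mult_assoc)
      then show ?case using Suc by (simp add: DS)
    qed
    have T_left: "T (Suc n) = aadd A x (amult A y (T n))" for n
    proof (induction n)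
      case 0 then show ?case by (simp add: T0 TS D0)
    next
      case (Suc n)
      have "T (Suc (Suc n)) = aadd A (aadd A x (amult A y (T n))) (D (Suc n))"
        using Suc by (simp add: TS[of "Suc n"])
      then show ?case by (simp add: TS[of n] DS A.distrib_left A.add_assoc)
    qed
    have T_right: "T (Suc n) = aadd A x (amult A (T n) y)" for n
    proof (induction n)
      case 0 then show ?case by (simp add: T0 TS D0 y_def A.scale_mult_left A.scale_mult_right)
    next
      case (Suc n)
      have "T (Suc (Suc n)) = aadd A (aadd A x (amult A (T n) y)) (D (Suc n))"
        using Suc by (simp add: TS[of "Suc n"])
      then show ?case by (simp add: TS[of n] D_comm[symmetric] A.distrib_right A.add_assoc)
    qed
    let ?\<beta> = "anorm B (D 0)"
    have DB: "anorm B (D n) \<le> ?\<beta> * (1 / 4) ^ n" for n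
    proof (induction n)
      case (Suc n)
      have "anorm B (D (Suc n)) \<le> (K * anorm B y) * anorm B (D n)"
        using multB[of y "D n"] by (simp add: DS mult_B)
      also have "\<dots> \<le> (1 / 4) * (?\<beta> * (1 / 4) ^ n)"
        using yK Suc K by (intro mult_mono) auto
      finally show ?case by simp
    qed simp
    define R where "R = anorm A (D 0) + 4 * C * anorm A y * ?\<beta>"
    have R: "R \<ge> 0" using C by (simp add: R_def)
    have DA: "anorm A (D n) \<le> R * (1 / 2) ^ n" for n
    proof (induction n)
      case 0 then show ?case using C by (simp add: R_def)
    next
      case (Suc n)
      have "anorm A (D (Suc n)) \<le> (C * anorm A y) * anorm B (D n) + (C * anorm B y) * anorm A (D n)"
        using diff[of y "D n"] by (simp add: DS algebra_simps)
      also have "\<dots> \<le> (C * anorm A y) * (?\<beta> * (1 / 4) ^ n) + (1 / 4) * (R * (1 / 2) ^ n)"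
        using C yC DB[of n] Suc by (intro add_mono mult_mono) auto
      also have "(C * anorm A y) * (?\<beta> * (1 / 4) ^ n) \<le> (R / 4) * (1 / 2) ^ n"
      proof -
        have "(C * anorm A y * ?\<beta>) * (1 / 4) ^ n \<le> (R / 4) * (1 / 2) ^ n"
          using C R by (intro mult_mono power_mono) (simp_all add: R_def)
        then show ?thesis by (simp add: algebra_simps)
      qed
      finally show ?case by simp
    qed
    have asubT: "anorm A (asub A (T (n + p)) (T n)) \<le> R * 2 * (1 / 2) ^ n * (1 - (1 / 2) ^ p)" for n p
    proof (induction p)
      case 0
      have "anorm A (azero A) = 0"
        using norm_scale[of "azero A" 0] by simp
      then show ?case by (simp add: asub_def)
    next
      case (Suc p)
      have "asub A (T (n + Suc p)) (T n) = aadd A (asub A (T (n + p)) (T n)) (D (n + p))"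
        by (simp add: asub_def TS A.add_ac)
      then have "anorm A (asub A (T (n + Suc p)) (T n))
          \<le> anorm A (asub A (T (n + p)) (T n)) + anorm A (D (n + p))"
        by (simp add: norm_triangle)
      also have "\<dots> \<le> R * 2 * (1 / 2) ^ n * (1 - (1 / 2) ^ p) + R * (1 / 2) ^ (n + p)"
        by (intro add_mono Suc DA)
      also have "\<dots> = R * 2 * (1 / 2) ^ n * (1 - (1 / 2) ^ Suc p)"
        by (simp add: algebra_simps power_add)
      finally show ?case .
    qed
    have T_Cauchy: "anorm A (asub A (T m) (T n)) \<le> R * 4 * (1 / 2) ^ N" if "m \<ge> N" "n \<ge> N" for m n N
    proof -
      have bound: "anorm A (asub A (T k) (T N)) \<le> R * 2 * (1 / 2) ^ N" if "k \<ge> N" for k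
      proof -
        have "anorm A (asub A (T k) (T N)) \<le> R * 2 * (1 / 2) ^ N * (1 - (1 / 2) ^ (k - N))"
          using asubT[of N "k - N"] that by simp
        also have "\<dots> \<le> R * 2 * (1 / 2) ^ N * 1"
          using R by (intro mult_left_mono) simp_all
        finally show ?thesis by simp
      qed
      have "asub A (T m) (T n) = aadd A (asub A (T m) (T N)) (ascale A (- 1) (asub A (T n) (T N)))"
      proof -
        have "aadd A (asub A (T m) (T N)) (ascale A (- 1) (asub A (T n) (T N)))
          = aadd A (asub A (T m) (T n)) (aadd A (T N) (ascale A (- 1) (T N)))"
          unfolding asub_def
          by (simp add: A.scale_add_right A.scale_scale A.add_ac del: A.add_minus)
        then show ?thesis by simp
      qed
      then have "anorm A (asub A (T m) (T n)) \<le> anorm A (asub A (T m) (T N)) + anorm A (asub A (T n) (T N))"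
        using norm_triangle[of "asub A (T m) (T N)" "ascale A (- 1) (asub A (T n) (T N))"]
        by (simp add: norm_scale)
      then show ?thesis using bound[of m] bound[of n] that by linarith
    qed
    have "\<exists>E\<in>acarrier A. (\<lambda>n. anorm A (asub A (T n) E)) \<longlonglongrightarrow> 0"
    proof (rule complete)
      show "\<forall>e>0. \<exists>N. \<forall>m\<ge>N. \<forall>n\<ge>N. anorm A (asub A (T m) (T n)) < e"
      proof safe
        fix e :: real assume "e > 0"
        have "(\<lambda>N. R * 4 * (1 / 2) ^ N) \<longlonglongrightarrow> R * 4 * 0"
          by (intro tendsto_intros) auto
        then have "\<forall>\<^sub>F N in sequentially. R * 4 * (1 / 2) ^ N < e"
          using \<open>e > 0\<close> by (intro order_tendstoD) auto
        then obtain N where "R * 4 * (1 / 2) ^ N < e" by (auto simp: eventually_sequentially)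
        then show "\<exists>N. \<forall>m\<ge>N. \<forall>n\<ge>N. anorm A (asub A (T m) (T n)) < e"
          using T_Cauchy by (meson le_less_trans)
      qed
    qed auto
    then obtain E where E [simp]: "E \<in> acarrier A" and lim: "(\<lambda>n. anorm A (asub A (T n) E)) \<longlonglongrightarrow> 0"
      by blast
    \<comment> \<open>The recursion for \<open>T\<close> passes to the limit; it is used for multiplication by \<open>y\<close> from either side.\<close>
    have limit_eq: "E = aadd A x (f E)"
      if f: "\<And>a. a \<in> acarrier A \<Longrightarrow> f a \<in> acarrier A"
        and f_sub: "\<And>a b. a \<in> acarrier A \<Longrightarrow> b \<in> acarrier A \<Longrightarrow> asub A (f a) (f b) = f (asub A a b)"
        and f_bound: "\<And>a. a \<in> acarrier A \<Longrightarrow> anorm A (f a) \<le> F * anorm A a"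
        and f_T: "\<And>n. T (Suc n) = aadd A x (f (T n))" for f F
    proof -
      note [simp] = f
      let ?d = "asub A (aadd A x (f E)) E"
      have "anorm A ?d \<le> F * anorm A (asub A (T n) E) + anorm A (asub A (T (Suc n)) E)" for n
      proof -
        have "asub A (T (Suc n)) E = aadd A ?d (asub A (f (T n)) (f E))"
        proof -
          have "aadd A ?d (asub A (f (T n)) (f E))
            = aadd A (asub A (aadd A x (f (T n))) E) (aadd A (f E) (ascale A (- 1) (f E)))"
            by (simp add: asub_def A.add_ac del: A.add_minus)
          then show ?thesis by (simp add: f_T)
        qed
        then have "?d = aadd A (asub A (T (Suc n)) E) (ascale A (- 1) (f (asub A (T n) E)))"
          by (simp add: f_sub A.add_assoc)
        then have "anorm A ?d \<le> anorm A (asub A (T (Suc n)) E) + anorm A (f (asub A (T n) E))"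
          using norm_triangle[of "asub A (T (Suc n)) E" "ascale A (- 1) (f (asub A (T n) E))"]
          by (simp add: norm_scale)
        then show ?thesis using f_bound[of "asub A (T n) E"] by simp
      qed
      moreover have "(\<lambda>n. F * anorm A (asub A (T n) E) + anorm A (asub A (T (Suc n)) E)) \<longlonglongrightarrow> F * 0 + 0"
        using LIMSEQ_Suc[OF lim] lim by (intro tendsto_intros)
      ultimately have "anorm A ?d \<le> 0"
        by (intro LIMSEQ_le_const) auto
      then have "anorm A ?d = 0" by (intro antisym) simp_all
      then have "?d = azero A" by (intro norm_eq_zero) simp_all
      then show ?thesis by (simp add: A.sub_eq_zero_iff)
    qed
    have left: "E = aadd A x (amult A y E)"
      by (rule limit_eq[where F = "L * anorm A y"])
        (use multA[of y] in \<open>simp_all add: T_left asub_def A.distrib_left A.scale_mult_right\<close>)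
    have right: "E = aadd A x (amult A E y)"
      by (rule limit_eq[where F = "L * anorm A y"])
        (use multA[of _ y] in \<open>simp_all add: T_right asub_def A.distrib_right A.scale_mult_left mult_ac\<close>)
    show ?thesis
      using left right E
      by (intro exI[of _ E]) (simp add: is_resolvent_def y_def A.scale_mult_left A.scale_mult_right)
  qed
  moreover have "\<kappa> > 0" using C K by (simp add: \<kappa>_def)
  ultimately show ?thesis by blast
qed

text \<open>
  The set of \<open>t\<close> for which \<open>1 - t z h\<close> is invertible over \<open>A\<close> is open and closed in \<open>[0, 1]\<close>: the step of a Neumann series in \<open>A\<close> is governed by the norm of the resolvent in \<open>B\<close>, and this norm
  is locally bounded because the resolvent exists in \<open>B\<close> along the whole segment.
\<close>

lemma resolvent_transfer:
  assumes h: "h \<in> acarrier A" and res: "\<And>t. t \<in> {0..1::real} \<Longrightarrow> \<exists>c. is_resolvent B h (of_real t * z) c"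
  shows "\<exists>c. is_resolvent A h z c"
proof -
  note [simp] = h
  obtain \<kappa> where \<kappa>: "\<kappa> > 0" and neumann: "\<And>x u. x \<in> acarrier A \<Longrightarrow> \<kappa> * (cmod u * anorm B x) \<le> 1 \<Longrightarrow>
      \<exists>e. is_resolvent A x u e"
    using neumann_series by blast
  obtain K where K: "K > 0" and multB: "\<And>a b. a \<in> acarrier B \<Longrightarrow> b \<in> acarrier B \<Longrightarrow>
      anorm B (amult B a b) \<le> K * anorm B a * anorm B b"
    using banach_B unfolding banach_algebra_def by blast
  let ?P = "\<lambda>t::real. \<exists>c. is_resolvent A h (of_real t * z) c"
  have "?P 1"
  proof (rule connected_induction_simple[where S = "{0..1::real}" and a = 0 and P = ?P])
    show "?P 0" using h by (intro exI[of _ h]) (simp add: is_resolvent_def)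
    fix t0 :: real assume "t0 \<in> {0..1}"
    then obtain p where p: "is_resolvent B h (of_real t0 * z) p" using res by blast
    then have [simp]: "p \<in> acarrier B" by (simp add: is_resolvent_def)
    let ?n = "anorm B p"
    \<comment> \<open>This radius bounds \<open>K |t z - t0 z| \<parallel>p\<parallel>\<close> by \<open>1 / 2\<close>, so that the resolvents near \<open>t0\<close> have norm at
      most \<open>2 \<parallel>p\<parallel>\<close>, and it makes steps of length \<open>2 d\<close> admissible for the Neumann series.\<close>
    define d where "d = 1 / (4 * (\<kappa> + K) * (?n + 1) * (cmod z + 1))"
    have pos: "?n + 1 > 0" using norm_B_nonneg[of p] by (simp add: add_nonneg_pos)
    have "cmod z + 1 > 0" by (simp add: add_nonneg_pos)
    then have d: "d > 0" using \<kappa> K pos by (simp add: d_def)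
    have dz: "d * cmod z \<le> 1 / (4 * (\<kappa> + K) * (?n + 1))"
    proof -
      have "d * cmod z \<le> d * (cmod z + 1)" using d by simp
      also have "\<dots> = 1 / (4 * (\<kappa> + K) * (?n + 1))" using \<open>cmod z + 1 > 0\<close> by (simp add: d_def)
      finally show ?thesis .
    qed
    have bound: "d * cmod z * (2 * K * ?n) \<le> 1" "2 * (d * cmod z) * (\<kappa> * (2 * ?n)) \<le> 1"
    proof -
      have "d * cmod z * (4 * (\<kappa> + K) * (?n + 1)) \<le> 1"
        using dz \<kappa> K pos by (simp add: pos_le_divide_eq)
      moreover have "2 * K * ?n \<le> 4 * (\<kappa> + K) * (?n + 1)" "4 * \<kappa> * ?n \<le> 4 * (\<kappa> + K) * (?n + 1)"
        using \<kappa> K norm_B_nonneg[of p] by (auto intro!: mult_mono)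
      then have "d * cmod z * (2 * K * ?n) \<le> d * cmod z * (4 * (\<kappa> + K) * (?n + 1))"
        "d * cmod z * (4 * \<kappa> * ?n) \<le> d * cmod z * (4 * (\<kappa> + K) * (?n + 1))"
        using d by (auto intro!: mult_left_mono)
      ultimately show "d * cmod z * (2 * K * ?n) \<le> 1" "2 * (d * cmod z) * (\<kappa> * (2 * ?n)) \<le> 1"
        by (auto simp: mult_ac)
    qed
    have close: "cmod (of_real s * z - of_real t * z) \<le> r * cmod z" if "\<bar>s - t\<bar> \<le> r" for s t r
    proof -
      have "cmod (of_real s * z - of_real t * z) = \<bar>s - t\<bar> * cmod z"
        by (simp add: left_diff_distrib[symmetric] norm_mult of_real_diff[symmetric] del: of_real_diff)
      then show ?thesis using that by (simp add: mult_right_mono)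
    qed
    have step: "?P s" if near: "t \<in> ball t0 d" "s \<in> ball t0 d" and t: "?P t" for s t
    proof -
      obtain c where c: "is_resolvent A h (of_real t * z) c" using t by blast
      then have [simp]: "c \<in> acarrier A" by (simp add: is_resolvent_def)
      have "c = aadd B p (ascale B (of_real t * z - of_real t0 * z) (amult B p c))"
        by (rule B.resolvent_identity[OF in_B[OF h] p is_resolvent_B[OF h c]])
      then have "anorm B c \<le> ?n + cmod (of_real t * z - of_real t0 * z) * anorm B (amult B p c)"
        using norm_B_triangle[of p "ascale B (of_real t * z - of_real t0 * z) (amult B p c)"]
        by (simp add: norm_B_scale)
      also have "\<dots> \<le> ?n + (d * cmod z) * (K * ?n * anorm B c)"
        using near(1) multB[of p c] d
        by (intro add_left_mono mult_mono close) (auto simp: dist_real_def)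
      also have "(d * cmod z) * (K * ?n * anorm B c) = d * cmod z * (2 * K * ?n) * (anorm B c / 2)" by simp
      also have "\<dots> \<le> 1 * (anorm B c / 2)"
        using bound(1) by (intro mult_right_mono) simp_all
      finally have cB: "anorm B c \<le> 2 * ?n" by simp
      have "\<kappa> * (cmod (of_real s * z - of_real t * z) * anorm B c) \<le> \<kappa> * (2 * d * cmod z * (2 * ?n))"
        using near cB \<kappa> d by (intro mult_left_mono mult_mono close) (auto simp: dist_real_def)
      also have "\<dots> \<le> 1" using bound(2) by (simp add: mult_ac)
      finally obtain e where "is_resolvent A c (of_real s * z - of_real t * z) e"
        using neumann[of c "of_real s * z - of_real t * z"] by auto
      from A.resolvent_shift[OF h c this] show ?thesis by auto
    qed
    show "\<exists>T. openin (top_of_set {0..1}) T \<and> t0 \<in> T \<and> (\<forall>x\<in>T. \<forall>y\<in>T. ?P x \<longrightarrow> ?P y)"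
      by (rule exI[of _ "{0..1} \<inter> ball t0 d"])
        (use d step \<open>t0 \<in> {0..1}\<close> in \<open>auto simp: openin_open_Int simp del: mem_ball\<close>)
  qed auto
  then show ?thesis by simp
qed

end

text \<open>
  That \<open>[0, \<infinity>)\<close> is a half line is what makes segments available: if \<open>z\<close> lies outside it, then so does \<open>z / t\<close>
  for \<open>0 < t \<le> 1\<close>, so that \<open>1 - t z\<inverse> a\<^sup>* a\<close> is invertible over \<open>B\<close> for all these \<open>t\<close>.
\<close>

theorem symmetric_algebra_differential_subalgebra:
  assumes diff: "differential_star_subalgebra A B" and symm: "symmetric_algebra B"
  shows "symmetric_algebra A"
proof -
  have dA: "differential_subalgebra A B" and star: "banach_star_algebra A" and
    star_eq: "\<And>a. a \<in> acarrier A \<Longrightarrow> astar A a = astar B a"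
    using diff by (auto simp: differential_star_subalgebra_def)
  interpret differential_pair A B
    using dA by unfold_locales (auto simp: differential_subalgebra_def banach_algebra_def)
  have "spectrum A (amult A (astar A a) a) \<subseteq> complex_of_real ` {0..}" if a [simp]: "a \<in> acarrier A" for a
  proof (rule subsetI, rule ccontr)
    fix z assume z: "z \<in> spectrum A (amult A (astar A a) a)" and neg: "z \<notin> complex_of_real ` {0..}"
    have [simp]: "astar A a \<in> acarrier A" using star by (simp add: banach_star_algebra_def)
    define b where "b = amult A (astar A a) a"
    have b [simp]: "b \<in> acarrier A" by (simp add: b_def)
    have "b = amult B (astar B a) a"
      using mult_B[of "astar A a" a] star_eq[OF a] \<open>astar A a \<in> acarrier A\<close> by (simp add: b_def)
    then have specB: "spectrum B b \<subseteq> complex_of_real ` {0..}"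
      using symm by (simp add: symmetric_algebra_def)
    have z0: "z \<noteq> 0" using neg by force
    have "\<exists>c. is_resolvent A b (1 / z) c"
    proof (rule resolvent_transfer[OF b])
      fix t :: real assume t: "t \<in> {0..1}"
      show "\<exists>c. is_resolvent B b (of_real t * (1 / z)) c"
      proof (cases "t = 0")
        case True
        then show ?thesis using b by (intro exI[of _ b]) (simp add: is_resolvent_def)
      next
        case False
        have "z / of_real t \<notin> complex_of_real ` {0..}"
        proof
          assume "z / of_real t \<in> complex_of_real ` {0..}"
          then obtain r where r: "r \<ge> 0" "z / of_real t = of_real r" by auto
          then have "z = of_real (r * t)" using False by (simp add: field_simps)
          moreover have "r * t \<in> {0..}" using r(1) t by simp
          ultimately show False using neg by blast
        qed
        then have "z / of_real t \<notin> spectrum B b" using specB by blast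
        moreover have "z / of_real t \<noteq> 0" using z0 False by simp
        ultimately show ?thesis
          using B.spectrum_iff_resolvent[OF in_B[OF b]] by fastforce
      qed
    qed
    then have "z \<notin> spectrum A b"
      using A.spectrum_iff_resolvent[OF b z0] by simp
    then show False using z by (simp add: b_def)
  qed
  then show ?thesis using star by (simp add: symmetric_algebra_def)
qed

section \<open>\<open>\<sigma>\<close>-compact sets and Baire measurability\<close>

definition sigma_compact :: "'a::topological_space set \<Rightarrow> bool" where
  "sigma_compact S \<longleftrightarrow> (\<exists>K :: nat \<Rightarrow> 'a set. (\<forall>n. compact (K n)) \<and> S = (\<Union>n. K n))"

lemma sigma_compact_compact: "compact K \<Longrightarrow> sigma_compact K"
  unfolding sigma_compact_def by (rule exI[of _ "\<lambda>_. K"]) auto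

lemma sigma_compact_UN:
  fixes S :: "nat \<Rightarrow> 'a::topological_space set"
  assumes "\<And>n. sigma_compact (S n)"
  shows "sigma_compact (\<Union>n. S n)"
proof -
  obtain K where K: "\<And>n m. compact (K n m)" "\<And>n. S n = (\<Union>m::nat. K n m)"
    using assms unfolding sigma_compact_def by metis
  have "(\<Union>n. S n) = (\<Union>i. case prod_decode i of (n, m) \<Rightarrow> K n m)"
  proof (safe, goal_cases)
    case (1 x n)
    then obtain m where "x \<in> K n m" using K by auto
    then show ?case by (intro UN_I[of "prod_encode (n, m)"]) auto
  next
    case (2 x i)
    then show ?case using K by (auto split: prod.splits)
  qed
  then show ?thesis
    using K unfolding sigma_compact_def
    by (intro exI[of _ "\<lambda>i. case prod_decode i of (n, m) \<Rightarrow> K n m"]) (auto split: prod.splits)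
qed

lemma sigma_compact_Un: "sigma_compact S \<Longrightarrow> sigma_compact T \<Longrightarrow> sigma_compact (S \<union> T)"
proof -
  assume "sigma_compact S" "sigma_compact T"
  then have "sigma_compact (\<Union>n::nat. if n = 0 then S else T)" by (intro sigma_compact_UN) simp
  moreover have "(\<Union>n::nat. if n = 0 then S else T) = S \<union> T"
    by (auto split: if_splits intro: exI[of _ "1::nat"])
  ultimately show ?thesis by simp
qed

lemma sigma_compact_image:
  assumes "sigma_compact S" "continuous_on UNIV f"
  shows "sigma_compact (f ` S)"
proof -
  obtain K where "\<And>n::nat. compact (K n)" "S = (\<Union>n. K n)"
    using assms unfolding sigma_compact_def by auto
  then show ?thesis
    unfolding sigma_compact_def
    by (intro exI[of _ "\<lambda>n. f ` K n"])
      (auto intro!: compact_continuous_image continuous_on_subset[OF assms(2)])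
qed

lemma sigma_compact_Times:
  assumes "sigma_compact S" "sigma_compact T"
  shows "sigma_compact (S \<times> T)"
proof -
  obtain K L where K: "\<And>n::nat. compact (K n)" "S = (\<Union>n. K n)"
    and L: "\<And>n::nat. compact (L n)" "T = (\<Union>n. L n)"
    using assms unfolding sigma_compact_def by auto
  have "S \<times> T = (\<Union>n. \<Union>m. K n \<times> L m)" using K L by auto
  moreover have "sigma_compact (\<Union>n. \<Union>m. K n \<times> L m)"
    by (intro sigma_compact_UN sigma_compact_compact compact_Times K L)
  ultimately show ?thesis by simp
qed

lemma sigma_compact_borel: "sigma_compact (S :: 'a::t2_space set) \<Longrightarrow> S \<in> sets borel"
  unfolding sigma_compact_def by (elim exE conjE) (auto intro!: sets.countable_UN simp: borel_compact)

text \<open>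
  In a locally compact Hausdorff space the open \<sigma>-compact sets are the sets \<open>{x. 0 < f x}\<close> for uniform limits \<open>f\<close>
  of nonnegative continuous functions with compact support, so these are the Baire sets. Their merit is the next
  lemma: on \<sigma>-compact sets, the preimage of a Baire set under a continuous map of two variables is measurable
  for the product of the two Borel \<sigma>-algebras, whereas an open set of a product space in general is not.
\<close>

definition baire :: "'a::topological_space measure" where
  "baire = sigma UNIV {V. open V \<and> sigma_compact V}"

lemma space_baire [simp]: "space baire = UNIV"
  by (simp add: baire_def)

lemma sets_baire: "sets baire = sigma_sets UNIV {V. open V \<and> sigma_compact V}"
  by (simp add: baire_def)

lemma baire_borel: "A \<in> sets (baire :: 'a::topological_space measure) \<Longrightarrow> A \<in> sets borel"
proof -
  have "sets (baire :: 'a measure) \<subseteq> sets borel"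
    unfolding sets_baire using sets.sigma_sets_subset[of "{V :: 'a set. open V \<and> sigma_compact V}" borel]
    by (simp add: Collect_mono_iff subset_eq)
  then show "A \<in> sets (baire :: 'a measure) \<Longrightarrow> A \<in> sets borel" by blast
qed

lemma borel_measurable_baire: "f \<in> measurable baire N \<Longrightarrow> f \<in> measurable borel N"
  by (auto simp: measurable_def baire_borel)

lemma continuous_measurable_product:
  fixes \<phi> :: "'a::t2_space \<times> 'b::t2_space \<Rightarrow> 'c::t2_space"
  assumes \<phi>: "continuous_on UNIV \<phi>" and S: "sigma_compact S" and T: "sigma_compact T"
  shows "\<phi> \<in> measurable (restrict_space borel S \<Otimes>\<^sub>M restrict_space borel T) baire"
  unfolding baire_def
proof (rule measurable_measure_of)
  show "\<phi> \<in> space (restrict_space borel S \<Otimes>\<^sub>M restrict_space borel T) \<rightarrow> UNIV" by simp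
  fix V assume "V \<in> {V :: 'c set. open V \<and> sigma_compact V}"
  then obtain F where V: "open V" and F: "\<And>n::nat. compact (F n)" "V = (\<Union>n. F n)"
    by (auto simp: sigma_compact_def)
  obtain K L where K: "\<And>n::nat. compact (K n)" "S = (\<Union>n. K n)"
    and L: "\<And>n::nat. compact (L n)" "T = (\<Union>n. L n)"
    using S T unfolding sigma_compact_def by auto
  let ?N = "restrict_space borel S \<Otimes>\<^sub>M restrict_space borel T"
  have space: "space ?N = S \<times> T" by (simp add: space_pair_measure space_restrict_space)
  have rect: "(A \<times> B) \<inter> (S \<times> T) \<in> sets ?N" if "open A" "open B" for A B
  proof -
    have "A \<inter> S \<in> sets (restrict_space borel S)" "B \<inter> T \<in> sets (restrict_space borel T)"
      using that by (auto simp: sets_restrict_space)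
    then have "(A \<inter> S) \<times> (B \<inter> T) \<in> sets ?N" by (rule pair_measureI)
    then show ?thesis by (simp add: Times_Int_Times)
  qed
  \<comment> \<open>The preimage is a countable union of compact sets, and each of these is covered by finitely many open
    rectangles inside the preimage.\<close>
  have "\<exists>R. R \<inter> (S \<times> T) \<in> sets ?N \<and> (K i \<times> L j) \<inter> \<phi> -` F n \<subseteq> R \<and> R \<subseteq> \<phi> -` V" for i j n
  proof -
    have open_pre: "open (\<phi> -` V)" using \<phi> V by (simp add: open_vimage)
    have "closed (\<phi> -` F n)" using \<phi> F by (simp add: closed_vimage compact_imp_closed)
    then have cpt: "compact ((K i \<times> L j) \<inter> \<phi> -` F n)"
      by (intro compact_Int_closed compact_Times K L)
    define \<C> where "\<C> = {A \<times> B | A B. open A \<and> open B \<and> A \<times> B \<subseteq> \<phi> -` V}"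
    have "(K i \<times> L j) \<inter> \<phi> -` F n \<subseteq> \<Union>\<C>"
    proof
      fix p assume "p \<in> (K i \<times> L j) \<inter> \<phi> -` F n"
      then have "p \<in> \<phi> -` V" using F by auto
      then obtain A B where "open A" "open B" "p \<in> A \<times> B" "A \<times> B \<subseteq> \<phi> -` V"
        using open_pre by (auto elim!: open_prod_elim)
      then show "p \<in> \<Union>\<C>" unfolding \<C>_def by blast
    qed
    moreover have "\<And>C. C \<in> \<C> \<Longrightarrow> open C" by (auto simp: \<C>_def open_Times)
    ultimately obtain D where D: "D \<subseteq> \<C>" "finite D" "(K i \<times> L j) \<inter> \<phi> -` F n \<subseteq> \<Union>D"
      using compactE[OF cpt] by metis
    have "(\<Union>C\<in>D. C \<inter> (S \<times> T)) \<in> sets ?N"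
      using D rect by (intro sets.finite_UN) (auto simp: \<C>_def)
    moreover have "(\<Union>C\<in>D. C \<inter> (S \<times> T)) = \<Union>D \<inter> (S \<times> T)" by auto
    moreover have "\<Union>D \<subseteq> \<phi> -` V" using D by (auto simp: \<C>_def)
    ultimately show ?thesis using D by metis
  qed
  then obtain R where R: "\<And>i j n. R i j n \<inter> (S \<times> T) \<in> sets ?N"
    "\<And>i j n. (K i \<times> L j) \<inter> \<phi> -` F n \<subseteq> R i j n" "\<And>i j n. R i j n \<subseteq> \<phi> -` V"
    by metis
  have "\<phi> -` V \<inter> (S \<times> T) = (\<Union>i. \<Union>j. \<Union>n. R i j n \<inter> (S \<times> T))"
  proof (rule antisym)
    show "\<phi> -` V \<inter> (S \<times> T) \<subseteq> (\<Union>i. \<Union>j. \<Union>n. R i j n \<inter> (S \<times> T))"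
    proof
      fix p assume p: "p \<in> \<phi> -` V \<inter> (S \<times> T)"
      then obtain i j n where "p \<in> (K i \<times> L j) \<inter> \<phi> -` F n"
      proof -
        obtain n where n: "\<phi> p \<in> F n" using p F(2) by auto
        obtain i j where "fst p \<in> K i" "snd p \<in> L j" using p K(2) L(2) by auto
        then have "p \<in> (K i \<times> L j) \<inter> \<phi> -` F n" using n by (simp add: mem_Times_iff)
        then show thesis by (rule that)
      qed
      then have "p \<in> R i j n" by (rule subsetD[OF R(2)])
      then show "p \<in> (\<Union>i. \<Union>j. \<Union>n. R i j n \<inter> (S \<times> T))" using p by (intro UN_I IntI) auto
    qed
    show "(\<Union>i. \<Union>j. \<Union>n. R i j n \<inter> (S \<times> T)) \<subseteq> \<phi> -` V \<inter> (S \<times> T)"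
      using R(3) by (intro UN_least Int_mono order_refl)
  qed
  also have "\<dots> \<in> sets ?N" by (intro sets.countable_UN image_subsetI R(1))
  finally show "\<phi> -` V \<inter> space ?N \<in> sets ?N" by (simp add: space)
qed simp

lemma sets_baire_euclidean:
  "sets (baire :: 'a::euclidean_space measure) = sets borel"
proof
  show "sets (baire :: 'a measure) \<subseteq> sets borel" using baire_borel by blast
  have "open V \<Longrightarrow> V \<in> sets baire" for V :: "'a set"
  proof -
    assume V: "open V"
    then have "sigma_compact V"
      unfolding sigma_compact_def by (rule open_Union_compact_subsets) auto
    then show ?thesis using V by (auto simp: sets_baire)
  qed
  then show "sets borel \<subseteq> sets (baire :: 'a measure)"
    using sets.sigma_sets_subset[of "{V :: 'a set. open V}" baire] by (auto simp: borel_def)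
qed

lemma continuous_borel_measurable_product:
  fixes \<phi> :: "'a::t2_space \<times> 'b::t2_space \<Rightarrow> 'c::euclidean_space"
  assumes "continuous_on UNIV \<phi>" "sigma_compact S" "sigma_compact T"
  shows "\<phi> \<in> borel_measurable (restrict_space borel S \<Otimes>\<^sub>M restrict_space borel T)"
  using continuous_measurable_product[OF assms] measurable_cong_sets[OF refl sets_baire_euclidean] by blast

lemma sigma_compact_plus:
  fixes S :: "'g::topological_group_add set"
  assumes "sigma_compact S" "sigma_compact T"
  shows "sigma_compact ((\<lambda>(a, b). a + b) ` (S \<times> T))"
  by (intro sigma_compact_image sigma_compact_Times assms)
    (auto simp: case_prod_unfold intro!: continuous_intros)

section \<open>Unimodular Haar measure\<close>

locale unimodular_haar =
  fixes \<mu> :: "'g::{topological_group_add,t2_space} measure"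
  assumes locally_compact: "locally_compact_space (euclidean :: 'g topology)"
    and haar: "left_haar_measure \<mu>"
    and unimod: "unimodular \<mu>"
begin

lemma sets_mu [measurable_cong, simp]: "sets \<mu> = sets borel"
  using haar by (simp add: left_haar_measure_def)

lemma space_mu [simp]: "space \<mu> = UNIV"
  using sets_eq_imp_space_eq[OF sets_mu] by simp

lemma emeasure_compact: "compact K \<Longrightarrow> emeasure \<mu> K < \<infinity>"
  and outer_regular: "A \<in> sets borel \<Longrightarrow> emeasure \<mu> A = (INF U\<in>{U. open U \<and> A \<subseteq> U}. emeasure \<mu> U)"
  and inner_regular: "open U \<Longrightarrow> emeasure \<mu> U = (SUP K\<in>{K. compact K \<and> K \<subseteq> U}. emeasure \<mu> K)"
  using haar by (auto simp: left_haar_measure_def)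

lemma compact_positive:
  obtains K where "compact K" "0 < emeasure \<mu> K"
proof -
  have "emeasure \<mu> UNIV \<noteq> 0" using haar unfolding left_haar_measure_def by blast
  then have "0 < (SUP K\<in>{K. compact K \<and> K \<subseteq> UNIV}. emeasure \<mu> K)"
    by (metis inner_regular open_UNIV zero_less_iff_neq_zero)
  then obtain K where K: "compact K" "0 < emeasure \<mu> K" by (auto simp: less_SUP_iff)
  then show thesis by (rule that)
qed

lemma translation_measurable [measurable]:
  "(\<lambda>x :: 'g. a + x) \<in> measurable borel borel" "(\<lambda>x :: 'g. x + a) \<in> measurable borel borel"
  "(\<lambda>x :: 'g. - x) \<in> measurable borel borel"
  "(\<lambda>x :: 'g. - x + a) \<in> measurable borel borel" "(\<lambda>x :: 'g. - (a + x)) \<in> measurable borel borel"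
  "(\<lambda>x :: 'g. - a + x) \<in> measurable borel borel"
  by (intro borel_measurable_continuous_onI continuous_intros)+

lemma distr_left_translation: "distr \<mu> \<mu> (\<lambda>x. g + x) = \<mu>"
proof (rule measure_eqI)
  fix A assume "A \<in> sets (distr \<mu> \<mu> (\<lambda>x. g + x))"
  then have A: "A \<in> sets borel" by simp
  have "(\<lambda>x. g + x) -` A = (\<lambda>x. - g + x) ` A"
    by (auto simp: image_iff add.assoc[symmetric] intro!: bexI[of _ "g + _"])
  moreover have "emeasure \<mu> ((\<lambda>x. - g + x) ` A) = emeasure \<mu> A"
    using haar A unfolding left_haar_measure_def by blast
  ultimately show "emeasure (distr \<mu> \<mu> (\<lambda>x. g + x)) A = emeasure \<mu> A"
    using A by (subst emeasure_distr) auto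
qed simp

lemma distr_right_translation: "distr \<mu> \<mu> (\<lambda>x. x + g) = \<mu>"
proof (rule measure_eqI)
  fix A assume "A \<in> sets (distr \<mu> \<mu> (\<lambda>x. x + g))"
  then have A: "A \<in> sets borel" by simp
  have "(\<lambda>x. x + g) -` A = (\<lambda>x. x + (- g)) ` A"
    by (auto simp: image_iff add.assoc intro!: bexI[of _ "_ + g"])
  moreover have "emeasure \<mu> ((\<lambda>x. x + (- g)) ` A) = emeasure \<mu> A"
    using unimod A unfolding unimodular_def by (metis sets_mu)
  ultimately show "emeasure (distr \<mu> \<mu> (\<lambda>x. x + g)) A = emeasure \<mu> A"
    using A by (subst emeasure_distr) auto
qed simp

lemma nn_integral_left_translation:
  assumes "f \<in> borel_measurable borel" shows "(\<integral>\<^sup>+ x. f (g + x) \<partial>\<mu>) = (\<integral>\<^sup>+ x. f x \<partial>\<mu>)"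
  using nn_integral_distr[of "\<lambda>x. g + x" \<mu> \<mu> f] assms by (simp add: distr_left_translation)

lemma nn_integral_right_translation:
  assumes "f \<in> borel_measurable borel" shows "(\<integral>\<^sup>+ x. f (x + g) \<partial>\<mu>) = (\<integral>\<^sup>+ x. f x \<partial>\<mu>)"
  using nn_integral_distr[of "\<lambda>x. x + g" \<mu> \<mu> f] assms by (simp add: distr_right_translation)

lemma integral_left_translation:
  fixes f :: "'g \<Rightarrow> 'b::{banach, second_countable_topology}"
  assumes "f \<in> borel_measurable borel" shows "(\<integral> x. f (g + x) \<partial>\<mu>) = (\<integral> x. f x \<partial>\<mu>)"
  using integral_distr[of "\<lambda>x. g + x" \<mu> \<mu> f] assms by (simp add: distr_left_translation)

lemma compact_between:
  fixes K U :: "'g set"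
  assumes K: "compact K" and U: "open U" "K \<subseteq> U"
  obtains V L where "open V" "compact L" "K \<subseteq> V" "V \<subseteq> L" "L \<subseteq> U"
proof -
  have Hausdorff: "Hausdorff_space (euclidean :: 'g topology)"
    unfolding Hausdorff_space_def
    by (auto simp: disjnt_def) (meson hausdorff)
  then have nb: "neighbourhood_base_of (compactin euclidean) (euclidean :: 'g topology)"
    using locally_compact locally_compact_space_neighbourhood_base by blast
  have "\<forall>x\<in>K. \<exists>V L. open V \<and> compact L \<and> x \<in> V \<and> V \<subseteq> L \<and> L \<subseteq> U"
  proof
    fix x assume "x \<in> K"
    then show "\<exists>V L. open V \<and> compact L \<and> x \<in> V \<and> V \<subseteq> L \<and> L \<subseteq> U"
      using nb U unfolding neighbourhood_base_of by (simp add: subset_eq)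
  qed
  then obtain V L where VL: "\<And>x. x \<in> K \<Longrightarrow> open (V x) \<and> compact (L x) \<and> x \<in> V x \<and> V x \<subseteq> L x \<and> L x \<subseteq> U"
    by metis
  obtain D where D: "D \<subseteq> K" "finite D" "K \<subseteq> (\<Union>x\<in>D. V x)"
    using compactE_image[OF K, of K V] VL by (metis UN_I subsetI)
  show thesis
  proof
    show "open (\<Union>x\<in>D. V x)" "compact (\<Union>x\<in>D. L x)" "K \<subseteq> (\<Union>x\<in>D. V x)"
      "(\<Union>x\<in>D. V x) \<subseteq> (\<Union>x\<in>D. L x)" "(\<Union>x\<in>D. L x) \<subseteq> U"
      using D VL by (auto intro!: compact_UN) blast+
  qed
qed

text \<open>Iterating the insertion of a compact neighbourhood makes the open set in between \<sigma>-compact.\<close>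

lemma sigma_compact_between:
  fixes K U :: "'g set"
  assumes K: "compact K" and U: "open U" "K \<subseteq> U"
  obtains V where "open V" "sigma_compact V" "K \<subseteq> V" "V \<subseteq> U"
proof -
  obtain L :: "nat \<Rightarrow> 'g set" where L: "\<And>n. (compact (L n) \<and> K \<subseteq> L n \<and> L n \<subseteq> U) \<and> (\<exists>V. open V \<and> L n \<subseteq> V \<and> V \<subseteq> L (Suc n))"
  proof -
    have "\<exists>L. \<forall>n. (compact (L n) \<and> K \<subseteq> L n \<and> L n \<subseteq> U) \<and> (\<exists>V. open V \<and> L n \<subseteq> V \<and> V \<subseteq> L (Suc n))"
    proof (rule dependent_nat_choice)
      show "\<exists>x. compact x \<and> K \<subseteq> x \<and> x \<subseteq> U" using K U by blast
      fix x and n :: nat assume x: "compact x \<and> K \<subseteq> x \<and> x \<subseteq> U"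
      then obtain V L where "open V" "compact L" "x \<subseteq> V" "V \<subseteq> L" "L \<subseteq> U"
        using compact_between[of x U] U by blast
      then show "\<exists>y. (compact y \<and> K \<subseteq> y \<and> y \<subseteq> U) \<and> (\<exists>V. open V \<and> x \<subseteq> V \<and> V \<subseteq> y)"
        using x by blast
    qed
    then show thesis using that by blast
  qed
  then obtain V where V: "\<And>n. open (V n) \<and> L n \<subseteq> V n \<and> V n \<subseteq> L (Suc n)" by metis
  have eq: "(\<Union>n. L n) = (\<Union>n. V n)"
  proof
    show "(\<Union>n. L n) \<subseteq> (\<Union>n. V n)" using V by (intro UN_mono) auto
    show "(\<Union>n. V n) \<subseteq> (\<Union>n. L n)" using V by blast
  qed
  show thesis
  proof
    show "open (\<Union>n. L n)" unfolding eq using V by auto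
    show "sigma_compact (\<Union>n. L n)" using L by (intro sigma_compact_UN sigma_compact_compact) auto
    show "K \<subseteq> (\<Union>n. L n)" "(\<Union>n. L n) \<subseteq> U" using L by blast+
  qed
qed

lemma emeasure_open_baire:
  assumes U: "open U"
  shows "emeasure \<mu> U = (SUP V\<in>{V. open V \<and> sigma_compact V \<and> V \<subseteq> U}. emeasure \<mu> V)"
proof (rule antisym)
  show "emeasure \<mu> U \<le> (SUP V\<in>{V. open V \<and> sigma_compact V \<and> V \<subseteq> U}. emeasure \<mu> V)"
    unfolding inner_regular[OF U]
  proof (rule SUP_least)
    fix K assume "K \<in> {K. compact K \<and> K \<subseteq> U}"
    then obtain V where V: "open V" "sigma_compact V" "K \<subseteq> V" "V \<subseteq> U"
      using sigma_compact_between[of K U] U by blast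
    then have "emeasure \<mu> K \<le> emeasure \<mu> V" by (intro emeasure_mono) auto
    also have "\<dots> \<le> (SUP V\<in>{V. open V \<and> sigma_compact V \<and> V \<subseteq> U}. emeasure \<mu> V)"
      using V by (intro SUP_upper) auto
    finally show "emeasure \<mu> K \<le> \<dots>" .
  qed
qed (use U in \<open>auto intro!: SUP_least emeasure_mono\<close>)

subsection \<open>Baire representatives\<close>

definition sigma_supported :: "('g \<Rightarrow> 'b::{zero,topological_space}) \<Rightarrow> bool" where
  "sigma_supported f \<longleftrightarrow> f \<in> borel_measurable borel \<and> (\<exists>S. sigma_compact S \<and> (AE x in \<mu>. x \<notin> S \<longrightarrow> f x = 0))"

definition baire_rep :: "('g \<Rightarrow> 'b::{zero,topological_space}) \<Rightarrow> ('g \<Rightarrow> 'b) \<Rightarrow> bool" where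
  "baire_rep f f' \<longleftrightarrow> f' \<in> borel_measurable baire \<and> (\<exists>S. sigma_compact S \<and> (\<forall>x. x \<notin> S \<longrightarrow> f' x = 0)) \<and>
     (AE x in \<mu>. f x = f' x)"

text \<open>
  Regularity in two steps: outer regularity encloses \<open>E\<close> in open sets of nearly the same measure, and
  each of these agrees up to a null set with a \<sigma>-compact open subset, by inner regularity.
\<close>

lemma baire_rep_set:
  assumes E: "E \<in> sets borel" "emeasure \<mu> E < \<infinity>"
  obtains E' S where "E' \<in> sets baire" "sigma_compact S" "E' \<subseteq> S" "AE x in \<mu>. x \<in> E \<longleftrightarrow> x \<in> E'"
proof -
  have "\<exists>U. open U \<and> E \<subseteq> U \<and> emeasure \<mu> U < emeasure \<mu> E + inverse (of_nat (Suc n))" for n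
  proof -
    have "(INF U\<in>{U. open U \<and> E \<subseteq> U}. emeasure \<mu> U) < emeasure \<mu> E + inverse (of_nat (Suc n))"
      unfolding outer_regular[OF E(1), symmetric]
      using E(2) ennreal_add_left_cancel_less[of "emeasure \<mu> E" 0 "inverse (of_nat (Suc n))"]
      by (simp add: ennreal_inverse_positive less_top)
    then show ?thesis by (auto simp: INF_less_iff)
  qed
  then obtain U where U: "\<And>n. open (U n)" "\<And>n. E \<subseteq> U n"
    "\<And>n. emeasure \<mu> (U n) < emeasure \<mu> E + inverse (of_nat (Suc n))" by metis
  have "\<exists>V. V \<in> sets baire \<and> sigma_compact V \<and> V \<subseteq> U n \<and> emeasure \<mu> (U n - V) = 0" for n
  proof -
    have ne: "(\<lambda>V. emeasure \<mu> V) ` {V. open V \<and> sigma_compact V \<and> V \<subseteq> U n} \<noteq> {}"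
      using sigma_compact_compact[of "{}"] by auto
    from ennreal_SUP_countable_SUP[of "{V. open V \<and> sigma_compact V \<and> V \<subseteq> U n}" "emeasure \<mu>"] ne
    obtain f :: "nat \<Rightarrow> ennreal" where f: "range f \<subseteq> emeasure \<mu> ` {V. open V \<and> sigma_compact V \<and> V \<subseteq> U n}"
      "emeasure \<mu> (U n) = (SUP i. f i)"
      unfolding emeasure_open_baire[OF U(1)] by auto
    then have "\<forall>i. \<exists>V. open V \<and> sigma_compact V \<and> V \<subseteq> U n \<and> f i = emeasure \<mu> V" by blast
    then obtain V where V: "\<And>i. open (V i) \<and> sigma_compact (V i) \<and> V i \<subseteq> U n \<and> f i = emeasure \<mu> (V i)"
      by metis
    let ?V = "\<Union>i. V i"
    have op: "open ?V" and sub: "?V \<subseteq> U n" and sc: "sigma_compact ?V"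
      using V by (auto intro!: sigma_compact_UN)
    have "emeasure \<mu> (U n) \<le> emeasure \<mu> ?V"
      unfolding f(2) using V op by (intro SUP_least) (auto intro!: emeasure_mono)
    moreover have "emeasure \<mu> (U n) < \<infinity>"
    proof -
      have "inverse (of_nat (Suc n) :: ennreal) < \<infinity>"
        by (simp add: ennreal_inverse_eq_top_iff less_top[symmetric] del: of_nat_Suc)
      then have "emeasure \<mu> E + inverse (of_nat (Suc n)) < \<infinity>"
        using E(2) by (simp add: ennreal_add_less_top)
      then show ?thesis using U(3)[of n] by (rule less_trans[rotated])
    qed
    moreover have "emeasure \<mu> ?V \<le> emeasure \<mu> (U n)"
      using sub U(1)[of n] by (intro emeasure_mono) auto
    ultimately have "emeasure \<mu> (U n) - emeasure \<mu> ?V = 0" "emeasure \<mu> ?V \<noteq> \<infinity>"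
      using diff_eq_0_ennreal by (auto simp: less_top)
    then have "emeasure \<mu> (U n - ?V) = 0"
      using sub op U(1)[of n] by (subst emeasure_Diff) auto
    moreover have "?V \<in> sets baire" using op sc by (auto simp: sets_baire)
    ultimately show ?thesis using sub sc by blast
  qed
  then obtain V where V: "\<And>n. V n \<in> sets baire" "\<And>n. sigma_compact (V n)" "\<And>n. V n \<subseteq> U n"
    "\<And>n. emeasure \<mu> (U n - V n) = 0" by metis
  have Vb [measurable]: "V n \<in> sets borel" and Ub [measurable]: "U n \<in> sets borel" for n
    using V(1) baire_borel U(1) by auto
  note E(1) [measurable]
  have "AE x in \<mu>. x \<notin> U n - V n" for n
    using V(4)[of n] by (intro AE_not_in) auto
  then have AE1: "AE x in \<mu>. \<forall>n. x \<notin> U n - V n" by (simp add: AE_all_countable)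
  have "emeasure \<mu> ((\<Inter>n. U n) - E) \<le> inverse (of_nat (Suc n))" for n
  proof -
    have "emeasure \<mu> E + emeasure \<mu> ((\<Inter>n. U n) - E) = emeasure \<mu> (\<Inter>n. U n)"
      using U(2) by (subst plus_emeasure) (auto intro!: arg_cong[where f = "emeasure \<mu>"])
    also have "\<dots> \<le> emeasure \<mu> (U n)" by (intro emeasure_mono) auto
    also have "\<dots> \<le> emeasure \<mu> E + inverse (of_nat (Suc n))" using U(3) less_imp_le by blast
    finally show ?thesis using E(2) by (auto simp: ennreal_add_left_cancel_le less_top)
  qed
  moreover have "(\<lambda>n. inverse (of_nat (Suc n)) :: ennreal) \<longlonglongrightarrow> 0"
  proof -
    have "(\<lambda>n. ennreal (inverse (real (Suc n)))) \<longlonglongrightarrow> ennreal 0"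
      by (intro tendsto_ennrealI LIMSEQ_inverse_real_of_nat)
    moreover have "ennreal (inverse (real (Suc n))) = inverse (of_nat (Suc n))" for n
      by (subst inverse_ennreal[symmetric]) (auto simp: ennreal_of_nat_eq_real_of_nat)
    ultimately show ?thesis by simp
  qed
  ultimately have "emeasure \<mu> ((\<Inter>n. U n) - E) \<le> 0"
    by (intro LIMSEQ_le_const) auto
  then have AE2: "AE x in \<mu>. x \<notin> (\<Inter>n. U n) - E" by (intro AE_not_in) auto
  show thesis
  proof
    show "(\<Inter>n. V n) \<in> sets baire" using V(1) by (intro sets.countable_INT) auto
    show "sigma_compact (V 0)" "(\<Inter>n. V n) \<subseteq> V 0" using V(2) by auto
    show "AE x in \<mu>. x \<in> E \<longleftrightarrow> x \<in> (\<Inter>n. V n)"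
      using AE1 AE2 by eventually_elim (use U(2) V(3) in blast)
  qed
qed

lemma baire_rep_lim:
  fixes f :: "'g \<Rightarrow> 'b::{banach, second_countable_topology}"
  assumes s: "\<And>i::nat. baire_rep (s i) (s' i)" and lim: "AE x in \<mu>. (\<lambda>i. s i x) \<longlonglongrightarrow> f x"
  shows "baire_rep f (\<lambda>x. lim (\<lambda>i. s' i x))"
proof -
  have [measurable]: "s' i \<in> borel_measurable baire" for i using s by (simp add: baire_rep_def)
  have "\<forall>i. \<exists>S. sigma_compact S \<and> (\<forall>x. x \<notin> S \<longrightarrow> s' i x = 0)" using s by (simp add: baire_rep_def)
  then obtain S where S: "\<And>i. sigma_compact (S i)" "\<And>i x. x \<notin> S i \<Longrightarrow> s' i x = 0" by metis
  have "AE x in \<mu>. \<forall>i. s i x = s' i x"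
    unfolding AE_all_countable using s by (simp add: baire_rep_def)
  then have "AE x in \<mu>. f x = lim (\<lambda>i. s' i x)"
    using lim by eventually_elim (auto simp: limI)
  moreover have "lim (\<lambda>i. s' i x) = 0" if "x \<notin> (\<Union>i. S i)" for x
    using S that by simp
  ultimately show ?thesis
    unfolding baire_rep_def using sigma_compact_UN[of S] S(1) by (intro conjI exI[of _ "\<Union>i. S i"]) auto
qed

lemma integrable_baire_rep:
  fixes f :: "'g \<Rightarrow> 'b::{banach, second_countable_topology}"
  assumes "integrable \<mu> f"
  shows "\<exists>f'. baire_rep f f'"
  using assms
proof induct
  case (base A c)
  obtain E' S where E: "E' \<in> sets baire" "sigma_compact S" "E' \<subseteq> S" "AE x in \<mu>. x \<in> A \<longleftrightarrow> x \<in> E'"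
    using baire_rep_set base by auto
  have "baire_rep (\<lambda>x. indicator A x *\<^sub>R c) (\<lambda>x. indicator E' x *\<^sub>R c)"
    unfolding baire_rep_def
  proof (intro conjI exI[of _ S])
    show "AE x in \<mu>. indicator A x *\<^sub>R c = indicator E' x *\<^sub>R c"
      using E(4) by eventually_elim (simp add: indicator_def)
  qed (use E in \<open>auto simp: indicator_def\<close>)
  then show ?case by (intro exI)
next
  case (add f g)
  then obtain f' g' where fg: "baire_rep f f'" "baire_rep g g'" by blast
  then obtain S T where ST: "sigma_compact S" "sigma_compact T"
    "\<And>x. x \<notin> S \<Longrightarrow> f' x = 0" "\<And>x. x \<notin> T \<Longrightarrow> g' x = 0" by (auto simp: baire_rep_def)
  have "AE x in \<mu>. f x = f' x" "AE x in \<mu>. g x = g' x" using fg by (auto simp: baire_rep_def)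
  then have "AE x in \<mu>. f x + g x = f' x + g' x" by eventually_elim simp
  then have "baire_rep (\<lambda>x. f x + g x) (\<lambda>x. f' x + g' x)"
    using fg ST sigma_compact_Un[OF ST(1,2)]
    unfolding baire_rep_def by (intro conjI exI[of _ "S \<union> T"]) auto
  then show ?case by (intro exI)
next
  case (lim f s)
  then obtain s' where "\<And>i. baire_rep (s i) (s' i)" by metis
  then show ?case using lim baire_rep_lim[of s s' f] by auto
qed

lemma baire_rep_borel: "baire_rep f f' \<Longrightarrow> f' \<in> borel_measurable borel"
  by (auto simp: baire_rep_def intro: borel_measurable_baire)

lemma baire_rep_AE: "baire_rep f f' \<Longrightarrow> AE x in \<mu>. f x = f' x"
  by (simp add: baire_rep_def)

lemma integrable_sigma_supported:
  fixes f :: "'g \<Rightarrow> 'b::{banach, second_countable_topology}"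
  assumes f: "integrable \<mu> f"
  shows "sigma_supported f"
proof -
  obtain f' S where "baire_rep f f'" "sigma_compact S" "\<forall>x. x \<notin> S \<longrightarrow> f' x = 0"
    using integrable_baire_rep[OF f] by (auto simp: baire_rep_def)
  then have "AE x in \<mu>. x \<notin> S \<longrightarrow> f x = 0"
    using baire_rep_AE[of f f'] by (auto elim!: eventually_mono)
  then show ?thesis
    using f \<open>sigma_compact S\<close> borel_measurable_integrable[OF f] by (auto simp: sigma_supported_def)
qed

text \<open>Bounded truncations to compact sets are integrable, which reduces the claim to integrable functions.\<close>

lemma sigma_supported_baire_rep:
  fixes f :: "'g \<Rightarrow> 'b::{banach, second_countable_topology}"
  assumes "sigma_supported f"
  shows "\<exists>f'. baire_rep f f'"
proof -
  obtain S where [measurable]: "f \<in> borel_measurable borel" and S: "sigma_compact S" "AE x in \<mu>. x \<notin> S \<longrightarrow> f x = 0"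
    using assms by (auto simp: sigma_supported_def)
  obtain K where K: "\<And>n::nat. compact (K n)" "S = (\<Union>n. K n)"
    using S by (auto simp: sigma_compact_def)
  define A where "A n = (\<Union>k\<le>n. K k) \<inter> {x. norm (f x) \<le> real n}" for n
  have cpt: "compact (\<Union>k\<le>n. K k)" for n using K by (intro compact_UN) auto
  then have [measurable]: "A n \<in> sets borel" for n
    unfolding A_def by (intro sets.Int) (auto intro: borel_compact)
  have fin: "emeasure \<mu> (A n) < \<infinity>" for n
  proof -
    have "emeasure \<mu> (A n) \<le> emeasure \<mu> (\<Union>k\<le>n. K k)"
      using cpt[of n] by (intro emeasure_mono) (auto simp: A_def intro: borel_compact)
    then show ?thesis using emeasure_compact[OF cpt[of n]] by (rule le_less_trans)
  qed
  have "integrable \<mu> (\<lambda>x. indicator (A n) x *\<^sub>R f x)" for n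
  proof (rule integrableI_bounded_set[where A = "A n" and B = "real n"])
    show "AE x in \<mu>. x \<in> A n \<longrightarrow> norm (indicator (A n) x *\<^sub>R f x) \<le> real n"
      by (auto simp: A_def indicator_def)
  qed (use fin in auto)
  then have "\<forall>n. \<exists>s'. baire_rep (\<lambda>x. indicator (A n) x *\<^sub>R f x) s'" using integrable_baire_rep by blast
  then obtain s' where s': "\<And>n. baire_rep (\<lambda>x. indicator (A n) x *\<^sub>R f x) (s' n)" by metis
  have "AE x in \<mu>. (\<lambda>n. indicator (A n) x *\<^sub>R f x) \<longlonglongrightarrow> f x"
    using S(2)
  proof eventually_elim
    fix x assume x: "x \<notin> S \<longrightarrow> f x = 0"
    show "(\<lambda>n. indicator (A n) x *\<^sub>R f x) \<longlonglongrightarrow> f x"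
    proof (cases "x \<in> S")
      case True
      then obtain k where k: "x \<in> K k" using K by auto
      have "\<forall>\<^sub>F n in sequentially. indicator (A n) x *\<^sub>R f x = f x"
        using eventually_ge_at_top[of "max k (nat \<lceil>norm (f x)\<rceil>)"]
      proof eventually_elim
        case (elim n)
        then have "x \<in> A n" using k by (auto simp: A_def)
        then show ?case by simp
      qed
      then show ?thesis by (rule tendsto_eventually)
    qed (use x in simp)
  qed
  then show ?thesis using baire_rep_lim[of "\<lambda>n x. indicator (A n) x *\<^sub>R f x" s' f, OF s'] by blast
qed

end

context unimodular_haar begin

subsection \<open>Fubini and inversion\<close>

text \<open>
  The whole measure need not be \<sigma>-finite. Fubini's theorem is applied to its restriction to a \<sigma>-compact set
  outside of which the integrand vanishes.
\<close>

abbreviation mu_on :: "'g set \<Rightarrow> 'g measure" where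
  "mu_on H \<equiv> restrict_space \<mu> H"

abbreviation mu_sq :: "'g set \<Rightarrow> ('g \<times> 'g) measure" where
  "mu_sq H \<equiv> mu_on H \<Otimes>\<^sub>M mu_on H"

lemma sets_mu_on: "sets (mu_on H) = sets (restrict_space borel H)"
  by (intro sets_restrict_space_cong) simp

lemma sigma_finite_mu_on:
  assumes "sigma_compact H" shows "sigma_finite_measure (mu_on H)"
proof
  obtain K where K: "\<And>n::nat. compact (K n)" "H = (\<Union>n. K n)"
    using assms by (auto simp: sigma_compact_def)
  have H [simp]: "H \<in> sets borel" using assms by (rule sigma_compact_borel)
  have in_sets: "K n \<in> sets (mu_on H)" for n
  proof -
    have "K n \<in> sets borel" using K(1) by (rule borel_compact)
    moreover have "K n \<subseteq> H" using K(2) by blast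
    ultimately show ?thesis by (simp add: sets_restrict_space_iff)
  qed
  moreover have "emeasure (mu_on H) (K n) \<noteq> \<infinity>" for n
  proof -
    have "emeasure (mu_on H) (K n) = emeasure \<mu> (K n)"
    proof (subst emeasure_restrict_space)
      show "K n \<subseteq> H" using K(2) by blast
    qed auto
    then show ?thesis using emeasure_compact[OF K(1)[of n]] by simp
  qed
  ultimately show "\<exists>A. countable A \<and> A \<subseteq> sets (mu_on H) \<and> \<Union> A = space (mu_on H) \<and> (\<forall>a\<in>A. emeasure (mu_on H) a \<noteq> \<infinity>)"
    by (intro exI[of _ "range K"]) (auto simp: space_restrict_space K(2))
qed

lemma continuous_measurable_mu_on:
  fixes \<phi> :: "'g \<times> 'g \<Rightarrow> 'b::t2_space"
  assumes "continuous_on UNIV \<phi>" "sigma_compact H"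
  shows "\<phi> \<in> measurable (mu_sq H) baire"
  using continuous_measurable_product[OF assms(1,2,2)]
    measurable_cong_sets[OF sets_pair_measure_cong[OF sets_mu_on sets_mu_on] refl] by blast

lemma continuous_borel_measurable_mu_on:
  fixes \<phi> :: "'g \<times> 'g \<Rightarrow> 'b::euclidean_space"
  assumes "continuous_on UNIV \<phi>" "sigma_compact H"
  shows "\<phi> \<in> borel_measurable (mu_sq H)"
  using continuous_borel_measurable_product[OF assms(1,2,2)]
    measurable_cong_sets[OF sets_pair_measure_cong[OF sets_mu_on sets_mu_on] refl] by blast

lemma borel_measurable_mu_on: "f \<in> measurable borel N \<Longrightarrow> f \<in> measurable (mu_on H) N"
  by (intro measurable_restrict_space1) simp

lemma nn_integral_mu_on:
  assumes "H \<in> sets borel" "\<And>x. x \<notin> H \<Longrightarrow> f x = 0"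
  shows "(\<integral>\<^sup>+ x. f x \<partial>mu_on H) = (\<integral>\<^sup>+ x. f x \<partial>\<mu>)"
  using assms by (subst nn_integral_restrict_space) (auto intro!: nn_integral_cong simp: indicator_def)

lemma integral_mu_on:
  fixes f :: "'g \<Rightarrow> 'b::{banach, second_countable_topology}"
  assumes "H \<in> sets borel" "\<And>x. x \<notin> H \<Longrightarrow> f x = 0"
  shows "(\<integral> x. f x \<partial>mu_on H) = (\<integral> x. f x \<partial>\<mu>)"
  using assms by (subst integral_restrict_space) (auto intro!: Bochner_Integration.integral_cong simp: indicator_def)

context
  fixes H :: "'g set"
  assumes H: "sigma_compact H"
begin

interpretation \<nu>: sigma_finite_measure "mu_on H"
  by (rule sigma_finite_mu_on[OF H])

interpretation \<nu>\<nu>: pair_sigma_finite "mu_on H" "mu_on H"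
  by unfold_locales

private lemma [simp, measurable]: "H \<in> sets borel" using H by (rule sigma_compact_borel)

lemma nn_integral_swap:
  assumes F: "(\<lambda>(s, t). F s t) \<in> borel_measurable (mu_sq H)"
    and supp: "\<And>s t. s \<notin> H \<or> t \<notin> H \<Longrightarrow> F s t = 0"
  shows "(\<integral>\<^sup>+ s. (\<integral>\<^sup>+ t. F s t \<partial>\<mu>) \<partial>\<mu>) = (\<integral>\<^sup>+ t. (\<integral>\<^sup>+ s. F s t \<partial>\<mu>) \<partial>\<mu>)"
proof -
  have [simp]: "F s = (\<lambda>_. 0)" if "s \<notin> H" for s using supp that by auto
  have "(\<integral>\<^sup>+ s. (\<integral>\<^sup>+ t. F s t \<partial>\<mu>) \<partial>\<mu>) = (\<integral>\<^sup>+ s. (\<integral>\<^sup>+ t. F s t \<partial>mu_on H) \<partial>mu_on H)"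
    using supp by (subst (1 2) nn_integral_mu_on) auto
  also have "\<dots> = (\<integral>\<^sup>+ t. (\<integral>\<^sup>+ s. F s t \<partial>mu_on H) \<partial>mu_on H)"
    using F by (rule \<nu>\<nu>.Fubini'[symmetric])
  also have "\<dots> = (\<integral>\<^sup>+ t. (\<integral>\<^sup>+ s. F s t \<partial>\<mu>) \<partial>\<mu>)"
    using supp by (subst (1 2) nn_integral_mu_on) auto
  finally show ?thesis .
qed

lemma measurable_inner_nn_integral:
  assumes F: "(\<lambda>(s, t). F s t) \<in> borel_measurable (mu_sq H)"
    and supp: "\<And>s t. s \<notin> H \<or> t \<notin> H \<Longrightarrow> F s t = (0::ennreal)"
  shows "(\<lambda>t. \<integral>\<^sup>+ s. F s t \<partial>\<mu>) \<in> borel_measurable borel"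
proof -
  have "(\<lambda>(t, s). F s t) \<in> borel_measurable (mu_sq H)"
    using measurable_pair_swap[OF F] by simp
  then have "(\<lambda>t. \<integral>\<^sup>+ s. F s t \<partial>mu_on H) \<in> borel_measurable (mu_on H)"
    by (rule \<nu>.borel_measurable_nn_integral)
  moreover have "(\<integral>\<^sup>+ s. F s t \<partial>mu_on H) = (\<integral>\<^sup>+ s. F s t \<partial>\<mu>)" for t
    using supp by (intro nn_integral_mu_on) auto
  ultimately have "(\<lambda>t. (\<integral>\<^sup>+ s. F s t \<partial>\<mu>) * indicator H t) \<in> borel_measurable \<mu>"
    by (simp add: borel_measurable_restrict_space_iff_ennreal)
  moreover have "(\<integral>\<^sup>+ s. F s t \<partial>\<mu>) * indicator H t = (\<integral>\<^sup>+ s. F s t \<partial>\<mu>)" for t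
    using supp by (auto simp: indicator_def)
  ultimately show ?thesis by (simp cong: measurable_cong_sets)
qed

lemma measurable_inner_integral:
  fixes F :: "'g \<Rightarrow> 'g \<Rightarrow> 'b::{banach, second_countable_topology}"
  assumes F: "(\<lambda>(s, t). F s t) \<in> borel_measurable (mu_sq H)"
    and supp: "\<And>s t. s \<notin> H \<or> t \<notin> H \<Longrightarrow> F s t = 0"
  shows "(\<lambda>t. \<integral> s. F s t \<partial>\<mu>) \<in> borel_measurable borel"
proof -
  have "(\<lambda>(t, s). F s t) \<in> borel_measurable (mu_sq H)"
    using measurable_pair_swap[OF F] by simp
  then have "(\<lambda>t. \<integral> s. F s t \<partial>mu_on H) \<in> borel_measurable (mu_on H)"
    by (rule \<nu>.borel_measurable_lebesgue_integral)
  moreover have "(\<integral> s. F s t \<partial>mu_on H) = (\<integral> s. F s t \<partial>\<mu>)" for t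
    using supp by (intro integral_mu_on) auto
  ultimately have "(\<lambda>t. indicator H t *\<^sub>R (\<integral> s. F s t \<partial>\<mu>)) \<in> borel_measurable \<mu>"
    by (simp add: borel_measurable_restrict_space_iff)
  moreover have "indicator H t *\<^sub>R (\<integral> s. F s t \<partial>\<mu>) = (\<integral> s. F s t \<partial>\<mu>)" for t
    using supp by (auto simp: indicator_def)
  ultimately show ?thesis by (simp cong: measurable_cong_sets)
qed

lemma integral_swap:
  fixes F :: "'g \<Rightarrow> 'g \<Rightarrow> 'b::{banach, second_countable_topology}"
  assumes F: "(\<lambda>(s, t). F s t) \<in> borel_measurable (mu_sq H)"
    and supp: "\<And>s t. s \<notin> H \<or> t \<notin> H \<Longrightarrow> F s t = 0"
    and fin: "(\<integral>\<^sup>+ t. (\<integral>\<^sup>+ s. norm (F s t) \<partial>\<mu>) \<partial>\<mu>) < \<infinity>"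
  shows "(\<integral> s. (\<integral> t. F s t \<partial>\<mu>) \<partial>\<mu>) = (\<integral> t. (\<integral> s. F s t \<partial>\<mu>) \<partial>\<mu>)"
proof -
  have [simp]: "F s = (\<lambda>_. 0)" if "s \<notin> H" for s using supp that by auto
  have norm_F: "(\<lambda>(s, t). ennreal (norm (F s t))) \<in> borel_measurable (mu_sq H)"
    using F by (simp add: case_prod_unfold)
  have "integrable (mu_sq H) (\<lambda>(s, t). F s t)"
  proof (rule integrableI_bounded[OF F])
    have "(\<integral>\<^sup>+ x. norm (case x of (s, t) \<Rightarrow> F s t) \<partial>(mu_sq H))
        = (\<integral>\<^sup>+ x. (case x of (s, t) \<Rightarrow> ennreal (norm (F s t))) \<partial>(mu_sq H))"
      by (simp add: case_prod_unfold)
    also have "\<dots> = (\<integral>\<^sup>+ t. (\<integral>\<^sup>+ s. norm (F s t) \<partial>mu_on H) \<partial>mu_on H)"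
      using \<nu>\<nu>.nn_integral_snd[OF norm_F] by simp
    also have "\<dots> = (\<integral>\<^sup>+ t. (\<integral>\<^sup>+ s. norm (F s t) \<partial>\<mu>) \<partial>\<mu>)"
      using supp by (subst (1 2) nn_integral_mu_on) auto
    finally show "(\<integral>\<^sup>+ x. norm (case x of (s, t) \<Rightarrow> F s t) \<partial>(mu_sq H)) < \<infinity>"
      using fin by simp
  qed
  then have "(\<integral> t. (\<integral> s. F s t \<partial>mu_on H) \<partial>mu_on H) = (\<integral> s. (\<integral> t. F s t \<partial>mu_on H) \<partial>mu_on H)"
    by (rule \<nu>\<nu>.Fubini_integral)
  moreover have "(\<integral> t. (\<integral> s. F s t \<partial>mu_on H) \<partial>mu_on H) = (\<integral> t. (\<integral> s. F s t \<partial>\<mu>) \<partial>\<mu>)"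
    using supp by (subst (1 2) integral_mu_on) auto
  moreover have "(\<integral> s. (\<integral> t. F s t \<partial>mu_on H) \<partial>mu_on H) = (\<integral> s. (\<integral> t. F s t \<partial>\<mu>) \<partial>\<mu>)"
    using supp by (subst (1 2) integral_mu_on) auto
  ultimately show ?thesis by simp
qed

end

text \<open>
  With an open \<sigma>-compact set \<open>W\<close> of finite positive measure, both \<open>\<mu>(W) \<mu>(-V)\<close> and \<open>\<mu>(W) \<mu>(V)\<close> are equal to the double integral of
  \<open>1\<^sub>W(s) 1\<^sub>V(- t + s)\<close>, by left invariance in \<open>t\<close> and by right invariance, respectively.
\<close>

lemma emeasure_uminus_baire:
  assumes V: "open V" "sigma_compact V"
  shows "emeasure \<mu> (uminus -` V) = emeasure \<mu> V"
proof -
  obtain K where K: "compact K" "0 < emeasure \<mu> K" by (rule compact_positive)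
  obtain U L where U: "open U" "compact L" "K \<subseteq> U" "U \<subseteq> L"
    by (rule compact_between[OF K(1) open_UNIV]) auto
  obtain W where W: "open W" "sigma_compact W" "K \<subseteq> W" "W \<subseteq> U"
    by (rule sigma_compact_between[OF K(1) U(1,3)])
  have "emeasure \<mu> K \<le> emeasure \<mu> W" using W by (intro emeasure_mono) auto
  then have W_pos: "emeasure \<mu> W \<noteq> 0" using K by auto
  have "emeasure \<mu> W \<le> emeasure \<mu> L" using W U by (intro emeasure_mono borel_compact) (auto intro: borel_compact)
  then have W_fin: "emeasure \<mu> W \<noteq> \<infinity>" using emeasure_compact[OF U(2)] by auto
  \<comment> \<open>Both kernels below vanish unless \<open>s\<close> lies in \<open>W\<close> or \<open>V\<close> and \<open>t\<close> in \<open>W - V\<close>.\<close>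
  define H where "H = V \<union> W \<union> (\<lambda>(a, b). a + b) ` (W \<times> uminus ` V)"
  have H: "sigma_compact H" "V \<union> W \<subseteq> H"
    unfolding H_def
    by (intro sigma_compact_Un sigma_compact_plus sigma_compact_image V W continuous_intros) auto
  have in_H: "x \<in> H" if "a \<in> W" "b \<in> V" "x = a + - b" for x a b
    using that unfolding H_def by blast
  have VW [measurable]: "V \<in> sets borel" "W \<in> sets borel" using V W by auto
  have VWb: "V \<in> sets baire" "W \<in> sets baire" using V W by (auto simp: sets_baire)
  have meas: "(\<lambda>p. indicator A (\<phi> p)) \<in> borel_measurable (mu_sq H)"
    if "A \<in> sets baire" "continuous_on UNIV \<phi>" for A :: "'g set" and \<phi> :: "'g \<times> 'g \<Rightarrow> 'g"
    by (rule measurable_compose[OF continuous_measurable_mu_on[OF that(2) H(1)] borel_measurable_indicator[OF that(1)]])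
  have "emeasure \<mu> W * emeasure \<mu> (uminus -` V)
      = (\<integral>\<^sup>+ s. indicator W s * (\<integral>\<^sup>+ t. indicator V (- t) \<partial>\<mu>) \<partial>\<mu>)"
  proof -
    have "(\<integral>\<^sup>+ t. indicator V (- t) \<partial>\<mu>) = (\<integral>\<^sup>+ t. indicator (uminus -` V) t \<partial>\<mu>)"
      by (simp add: indicator_def)
    also have "\<dots> = emeasure \<mu> (uminus -` V)"
      using V(1) by (intro nn_integral_indicator) (auto intro!: borel_open open_vimage continuous_intros)
    finally show ?thesis by (simp add: nn_integral_multc)
  qed
  also have "\<dots> = (\<integral>\<^sup>+ s. (\<integral>\<^sup>+ t. indicator W s * indicator V (- t + s) \<partial>\<mu>) \<partial>\<mu>)"
  proof (rule nn_integral_cong)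
    fix s
    have "(\<integral>\<^sup>+ t. indicator V (- t) \<partial>\<mu>) = (\<integral>\<^sup>+ t. indicator V (- (- s + t)) \<partial>\<mu>)"
      by (rule nn_integral_left_translation[symmetric]) measurable
    also have "\<dots> = (\<integral>\<^sup>+ t. indicator V (- t + s) \<partial>\<mu>)"
      by (simp add: minus_add)
    finally show "indicator W s * (\<integral>\<^sup>+ t. indicator V (- t) \<partial>\<mu>)
        = (\<integral>\<^sup>+ t. indicator W s * indicator V (- t + s) \<partial>\<mu>)"
      by (simp add: nn_integral_cmult)
  qed
  also have "\<dots> = (\<integral>\<^sup>+ t. (\<integral>\<^sup>+ s. indicator W s * indicator V (- t + s) \<partial>\<mu>) \<partial>\<mu>)"
  proof (rule nn_integral_swap[OF H(1)])
    have "(\<lambda>p. indicator W (fst p) * indicator V (- snd p + fst p) :: ennreal) \<in> borel_measurable (mu_sq H)"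
      by (intro borel_measurable_times_ennreal meas VWb continuous_intros)
    then show "(\<lambda>(s, t). indicator W s * indicator V (- t + s) :: ennreal) \<in> borel_measurable (mu_sq H)"
      by (simp add: case_prod_unfold)
    show "indicator W s * indicator V (- t + s) = (0 :: ennreal)" if st: "s \<notin> H \<or> t \<notin> H" for s t
    proof (rule ccontr)
      assume "indicator W s * indicator V (- t + s) \<noteq> (0 :: ennreal)"
      then have "s \<in> W" "- t + s \<in> V" by (auto simp: indicator_def split: if_splits)
      moreover have "t = s + - (- t + s)" by (simp add: minus_add add.assoc[symmetric])
      ultimately show False using st H(2) in_H[of s "- t + s" t] by auto
    qed
  qed
  also have "\<dots> = (\<integral>\<^sup>+ t. (\<integral>\<^sup>+ s. indicator W (t + s) * indicator V s \<partial>\<mu>) \<partial>\<mu>)"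
  proof (rule nn_integral_cong)
    fix t
    show "(\<integral>\<^sup>+ s. indicator W s * indicator V (- t + s) \<partial>\<mu>) = (\<integral>\<^sup>+ s. indicator W (t + s) * indicator V s \<partial>\<mu>)"
      using nn_integral_left_translation[of "\<lambda>s. indicator W s * indicator V (- t + s)" t]
      by (simp add: add.assoc[symmetric])
  qed
  also have "\<dots> = (\<integral>\<^sup>+ s. (\<integral>\<^sup>+ t. indicator W (t + s) * indicator V s \<partial>\<mu>) \<partial>\<mu>)"
  proof (rule nn_integral_swap[OF H(1)])
    have "(\<lambda>p. indicator W (fst p + snd p) * indicator V (snd p) :: ennreal) \<in> borel_measurable (mu_sq H)"
      by (intro borel_measurable_times_ennreal meas VWb continuous_intros)
    then show "(\<lambda>(t, s). indicator W (t + s) * indicator V s :: ennreal) \<in> borel_measurable (mu_sq H)"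
      by (simp add: case_prod_unfold)
    show "indicator W (t + s) * indicator V s = (0 :: ennreal)" if st: "t \<notin> H \<or> s \<notin> H" for s t
    proof (rule ccontr)
      assume "indicator W (t + s) * indicator V s \<noteq> (0 :: ennreal)"
      then have "s \<in> V" "t + s \<in> W" by (auto simp: indicator_def split: if_splits)
      moreover have "t = (t + s) + - s" by (simp add: add.assoc)
      ultimately show False using st H(2) in_H[of "t + s" s t] by auto
    qed
  qed
  also have "\<dots> = (\<integral>\<^sup>+ s. emeasure \<mu> W * indicator V s \<partial>\<mu>)"
  proof (rule nn_integral_cong)
    fix s
    show "(\<integral>\<^sup>+ t. indicator W (t + s) * indicator V s \<partial>\<mu>) = emeasure \<mu> W * indicator V s"
      using nn_integral_right_translation[of "indicator W" s] by (simp add: nn_integral_multc)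
  qed
  also have "\<dots> = emeasure \<mu> W * emeasure \<mu> V"
    by (simp add: nn_integral_cmult)
  finally show ?thesis using W_pos W_fin by (simp add: ennreal_mult_cancel_left)
qed

text \<open>Inner and outer regularity reduce the claim to open \<sigma>-compact sets.\<close>

lemma distr_uminus: "distr \<mu> \<mu> uminus = \<mu>"
proof (rule measure_eqI)
  have pre: "uminus -` A \<in> sets borel" if "A \<in> sets borel" for A :: "'g set"
    using measurable_sets[OF translation_measurable(3) that] by simp
  have le_open: "emeasure \<mu> (uminus -` U) \<le> emeasure \<mu> U" if U: "open U" for U :: "'g set"
  proof -
    have "open (uminus -` U)" using U by (intro open_vimage continuous_intros)
    then have "emeasure \<mu> (uminus -` U) = (SUP V\<in>{V. open V \<and> sigma_compact V \<and> V \<subseteq> uminus -` U}. emeasure \<mu> V)"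
      by (rule emeasure_open_baire)
    also have "\<dots> \<le> emeasure \<mu> U"
    proof (rule SUP_least)
      fix V assume "V \<in> {V. open V \<and> sigma_compact V \<and> V \<subseteq> uminus -` U}"
      then have V: "open V" "sigma_compact V" "V \<subseteq> uminus -` U" by auto
      have "emeasure \<mu> V = emeasure \<mu> (uminus -` V)" using emeasure_uminus_baire V by simp
      also have "\<dots> \<le> emeasure \<mu> U" using V U by (intro emeasure_mono) (auto dest!: subsetD)
      finally show "emeasure \<mu> V \<le> emeasure \<mu> U" .
    qed
    finally show ?thesis .
  qed
  have le: "emeasure \<mu> (uminus -` A) \<le> emeasure \<mu> A" if A: "A \<in> sets borel" for A :: "'g set"
    unfolding outer_regular[OF A]
  proof (rule INF_greatest)
    fix U assume "U \<in> {U. open U \<and> A \<subseteq> U}"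
    then have U: "open U" "A \<subseteq> U" by auto
    then have "emeasure \<mu> (uminus -` A) \<le> emeasure \<mu> (uminus -` U)" by (intro emeasure_mono) (auto intro!: pre)
    then show "emeasure \<mu> (uminus -` A) \<le> emeasure \<mu> U" using le_open[OF U(1)] by simp
  qed
  fix A assume "A \<in> sets (distr \<mu> \<mu> uminus)"
  then have A: "A \<in> sets borel" by simp
  have "emeasure \<mu> A \<le> emeasure \<mu> (uminus -` A)"
    using le[OF pre[OF A]] by (simp add: vimage_comp[symmetric] vimage_def)
  then have "emeasure \<mu> (uminus -` A) = emeasure \<mu> A" using le[OF A] by simp
  then show "emeasure (distr \<mu> \<mu> uminus) A = emeasure \<mu> A"
    using A by (subst emeasure_distr) auto
qed simp

lemma distr_reflection: "distr \<mu> \<mu> (\<lambda>s. - s + t) = \<mu>"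
proof -
  have "distr \<mu> \<mu> (\<lambda>s. - s + t) = distr (distr \<mu> \<mu> uminus) \<mu> (\<lambda>s. s + t)"
    by (subst distr_distr) (auto simp: comp_def)
  then show ?thesis by (simp add: distr_uminus distr_right_translation)
qed

lemma nn_integral_uminus:
  assumes "f \<in> borel_measurable borel" shows "(\<integral>\<^sup>+ x. f (- x) \<partial>\<mu>) = (\<integral>\<^sup>+ x. f x \<partial>\<mu>)"
  using nn_integral_distr[of uminus \<mu> \<mu> f] assms by (simp add: distr_uminus)

lemma AE_left_translation: "AE x in \<mu>. P x \<Longrightarrow> AE s in \<mu>. P (g + s)"
  by (rule AE_distrD[where M' = \<mu>], simp) (subst distr_left_translation)

lemma AE_uminus: "AE x in \<mu>. P x \<Longrightarrow> AE s in \<mu>. P (- s)"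
  by (rule AE_distrD[where M' = \<mu>], simp) (subst distr_uminus)

lemma AE_reflection: "AE x in \<mu>. P x \<Longrightarrow> AE s in \<mu>. P (- s + t)"
  by (rule AE_distrD[where M' = \<mu>], simp) (subst distr_reflection)

end

section \<open>Convolution\<close>

abbreviation enorm :: "complex \<Rightarrow> ennreal" where "enorm z \<equiv> ennreal (cmod z)"

context unimodular_haar begin

subsection \<open>The convolution kernel\<close>

text \<open>
  The convolution of absolute values. With extended nonnegative values it exists at every point, and its
  finiteness is the condition for the other convolutions to be given by integrable functions.
\<close>

definition nnconv :: "('g \<Rightarrow> complex) \<Rightarrow> ('g \<Rightarrow> complex) \<Rightarrow> 'g \<Rightarrow> ennreal" where
  "nnconv f g t = (\<integral>\<^sup>+ s. enorm (f s) * enorm (g (- s + t)) \<partial>\<mu>)"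

text \<open>
  A convolution does not change at any point when both factors are changed on null sets, because a
  unimodular Haar measure is invariant under \<open>s \<mapsto> - s + t\<close>. So it may be computed from Baire
  representatives, whose kernel is measurable on the square of a \<sigma>-compact set.
\<close>

lemma convolution_kernel:
  assumes f: "sigma_supported (f :: 'g \<Rightarrow> complex)" and g: "sigma_supported (g :: 'g \<Rightarrow> complex)"
  obtains f' g' H where "sigma_compact H" "f' \<in> borel_measurable borel" "g' \<in> borel_measurable baire"
    "AE s in \<mu>. f s = f' s" "AE s in \<mu>. g s = g' s"
    "\<And>s t. s \<notin> H \<or> t \<notin> H \<Longrightarrow> f' s = 0 \<or> g' (- s + t) = 0"
    "(\<lambda>(s, t). f' s * g' (- s + t)) \<in> borel_measurable (mu_sq H)"
    "(\<lambda>(s, t). enorm (f' s) * enorm (g' (- s + t))) \<in> borel_measurable (mu_sq H)"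
proof -
  obtain f' g' where reps: "baire_rep f f'" "baire_rep g g'"
    using sigma_supported_baire_rep[OF f] sigma_supported_baire_rep[OF g] by blast
  obtain S where S: "sigma_compact S" "\<And>x. x \<notin> S \<Longrightarrow> f' x = 0"
    using reps(1) unfolding baire_rep_def by blast
  obtain T where T: "sigma_compact T" "\<And>x. x \<notin> T \<Longrightarrow> g' x = 0"
    using reps(2) unfolding baire_rep_def by blast
  define H where "H = S \<union> (\<lambda>(a, b). a + b) ` (S \<times> T)"
  have H: "sigma_compact H"
    unfolding H_def by (intro sigma_compact_Un sigma_compact_plus S T)
  show thesis
  proof (rule that[of H f' g'])
    show "f' s = 0 \<or> g' (- s + t) = 0" if st: "s \<notin> H \<or> t \<notin> H" for s t
    proof (rule ccontr)
      assume "\<not> ?thesis"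
      then have "s \<in> S" "- s + t \<in> T" using S(2)[of s] T(2)[of "- s + t"] by auto
      then have "s + (- s + t) \<in> H" unfolding H_def by blast
      then show False using st \<open>s \<in> S\<close> by (simp add: H_def add.assoc[symmetric])
    qed
    have "(\<lambda>p. f' (fst p)) \<in> borel_measurable (mu_sq H)"
      using measurable_compose[OF measurable_fst borel_measurable_mu_on[OF baire_rep_borel[OF reps(1)]]] .
    moreover have "(\<lambda>p. g' (- fst p + snd p)) \<in> borel_measurable (mu_sq H)"
    proof (rule measurable_compose[where f = "\<lambda>p. - fst p + snd p" and g = g' and N = baire])
      show "(\<lambda>p. - fst p + snd p) \<in> measurable (mu_sq H) baire"
        by (intro continuous_measurable_mu_on H continuous_intros)
      show "g' \<in> borel_measurable baire" using reps(2) by (simp add: baire_rep_def)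
    qed
    ultimately have "(\<lambda>p. f' (fst p) * g' (- fst p + snd p)) \<in> borel_measurable (mu_sq H)"
      by (rule borel_measurable_times)
    then show meas: "(\<lambda>(s, t). f' s * g' (- s + t)) \<in> borel_measurable (mu_sq H)"
      by (simp add: case_prod_unfold)
    then show "(\<lambda>(s, t). enorm (f' s) * enorm (g' (- s + t))) \<in> borel_measurable (mu_sq H)"
      using measurable_compose[OF measurable_compose[OF meas borel_measurable_norm] measurable_ennreal]
      by (simp add: case_prod_unfold norm_mult ennreal_mult)
    show "g' \<in> borel_measurable baire" using reps(2) by (simp add: baire_rep_def)
  qed (use H reps baire_rep_borel baire_rep_AE in auto)
qed

lemma nnconv_cong:
  assumes "AE s in \<mu>. f s = f' s" "AE s in \<mu>. g s = g' s"
  shows "nnconv f g t = nnconv f' g' t"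
  unfolding nnconv_def
proof (rule nn_integral_cong_AE)
  show "AE s in \<mu>. enorm (f s) * enorm (g (- s + t))
      = enorm (f' s) * enorm (g' (- s + t))"
    using assms(1) AE_reflection[OF assms(2), of t] by eventually_elim simp
qed

lemma convolution_cong:
  assumes "AE s in \<mu>. f s = f' s" "AE s in \<mu>. g s = g' s"
    and [measurable]: "f \<in> borel_measurable borel" "f' \<in> borel_measurable borel"
      "g \<in> borel_measurable borel" "g' \<in> borel_measurable borel" "\<kappa> \<in> borel_measurable borel"
  shows "(\<integral> s. f s * g (- s + t) * \<kappa> s \<partial>\<mu>) = (\<integral> s. f' s * g' (- s + t) * (\<kappa> s :: complex) \<partial>\<mu>)"
proof (rule integral_cong_AE)
  show "AE s in \<mu>. f s * g (- s + t) * \<kappa> s = f' s * g' (- s + t) * \<kappa> s"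
    using assms(1) AE_reflection[OF assms(2), of t] by eventually_elim simp
qed measurable

lemma nnconv_measurable:
  assumes f: "sigma_supported f" and g: "sigma_supported g"
  shows "nnconv f g \<in> borel_measurable borel"
proof -
  obtain f' g' H where H: "sigma_compact H" and f': "f' \<in> borel_measurable borel"
    and g': "g' \<in> borel_measurable baire"
    and ae: "AE s in \<mu>. f s = f' s" "AE s in \<mu>. g s = g' s"
    and supp: "\<And>s t. s \<notin> H \<or> t \<notin> H \<Longrightarrow> f' s = 0 \<or> g' (- s + t) = 0"
    and meas: "(\<lambda>(s, t). f' s * g' (- s + t)) \<in> borel_measurable (mu_sq H)"
      "(\<lambda>(s, t). enorm (f' s) * enorm (g' (- s + t))) \<in> borel_measurable (mu_sq H)"
    by (rule convolution_kernel[OF f g]) (rule that; assumption)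
  note f' [measurable]
  have "(\<lambda>t. \<integral>\<^sup>+ s. enorm (f' s) * enorm (g' (- s + t)) \<partial>\<mu>) \<in> borel_measurable borel"
    using supp meas(2) by (intro measurable_inner_nn_integral[OF H]) auto
  then show ?thesis
    using nnconv_cong[OF ae] unfolding nnconv_def by simp
qed

text \<open>
  In \<open>f(s) g(- s + t) v(t)\<close> only \<open>g\<close> is evaluated at a combination of the two variables, so \<open>v\<close> may be any
  Borel function.
\<close>

lemma nn_integral_nnconv:
  assumes f: "sigma_supported f" and g: "sigma_supported g" and v [measurable]: "v \<in> borel_measurable borel"
  shows "(\<integral>\<^sup>+ t. nnconv f g t * v t \<partial>\<mu>)
    = (\<integral>\<^sup>+ s. enorm (f s) * (\<integral>\<^sup>+ t. enorm (g t) * v (s + t) \<partial>\<mu>) \<partial>\<mu>)"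
proof -
  obtain f' g' H where H: "sigma_compact H" and f': "f' \<in> borel_measurable borel"
    and g': "g' \<in> borel_measurable baire"
    and ae: "AE s in \<mu>. f s = f' s" "AE s in \<mu>. g s = g' s"
    and supp: "\<And>s t. s \<notin> H \<or> t \<notin> H \<Longrightarrow> f' s = 0 \<or> g' (- s + t) = 0"
    and meas: "(\<lambda>(s, t). f' s * g' (- s + t)) \<in> borel_measurable (mu_sq H)"
      "(\<lambda>(s, t). enorm (f' s) * enorm (g' (- s + t))) \<in> borel_measurable (mu_sq H)"
    by (rule convolution_kernel[OF f g]) (rule that; assumption)
  note f' [measurable]
  have [measurable]: "g' \<in> borel_measurable borel" using g' by (rule borel_measurable_baire)
  let ?F = "\<lambda>s t. enorm (f' s) * enorm (g' (- s + t))"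
  note F = meas(2)
  have vH: "(\<lambda>p. v (snd p)) \<in> borel_measurable (mu_sq H)"
    using measurable_compose[OF measurable_snd borel_measurable_mu_on[OF v]] .
  have Fv: "(\<lambda>(s, t). ?F s t * v t) \<in> borel_measurable (mu_sq H)"
    using borel_measurable_times_ennreal[OF F vH] by (simp add: case_prod_unfold)
  have "(\<integral>\<^sup>+ t. nnconv f g t * v t \<partial>\<mu>) = (\<integral>\<^sup>+ t. (\<integral>\<^sup>+ s. ?F s t * v t \<partial>\<mu>) \<partial>\<mu>)"
    by (subst nnconv_cong[OF ae]) (simp add: nnconv_def nn_integral_multc)
  also have "\<dots> = (\<integral>\<^sup>+ s. (\<integral>\<^sup>+ t. ?F s t * v t \<partial>\<mu>) \<partial>\<mu>)"
    by (rule nn_integral_swap[OF H Fv, symmetric]) (use supp in auto)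
  also have "\<dots> = (\<integral>\<^sup>+ s. enorm (f s) * (\<integral>\<^sup>+ t. enorm (g t) * v (s + t) \<partial>\<mu>) \<partial>\<mu>)"
  proof (rule nn_integral_cong_AE)
    show "AE s in \<mu>. (\<integral>\<^sup>+ t. ?F s t * v t \<partial>\<mu>)
        = enorm (f s) * (\<integral>\<^sup>+ t. enorm (g t) * v (s + t) \<partial>\<mu>)"
      using ae(1)
    proof eventually_elim
      fix s assume s: "f s = f' s"
      have "(\<integral>\<^sup>+ t. ?F s t * v t \<partial>\<mu>) = enorm (f' s) * (\<integral>\<^sup>+ t. enorm (g' (- s + t)) * v t \<partial>\<mu>)"
        by (subst nn_integral_cmult[symmetric]) (auto simp: mult.assoc)
      also have "(\<integral>\<^sup>+ t. enorm (g' (- s + t)) * v t \<partial>\<mu>) = (\<integral>\<^sup>+ t. enorm (g' t) * v (s + t) \<partial>\<mu>)"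
        using nn_integral_left_translation[of "\<lambda>t. enorm (g' (- s + t)) * v t" s]
        by (simp add: add.assoc[symmetric])
      also have "\<dots> = (\<integral>\<^sup>+ t. enorm (g t) * v (s + t) \<partial>\<mu>)"
      proof (rule nn_integral_cong_AE)
        show "AE t in \<mu>. enorm (g' t) * v (s + t) = enorm (g t) * v (s + t)"
          using ae(2) by eventually_elim simp
      qed
      finally show "(\<integral>\<^sup>+ t. ?F s t * v t \<partial>\<mu>)
        = enorm (f s) * (\<integral>\<^sup>+ t. enorm (g t) * v (s + t) \<partial>\<mu>)"
        using s by simp
    qed
  qed
  finally show ?thesis .
qed

text \<open>Reflection exchanges the two factors, which reduces estimates in the first factor to those in the second.\<close>

lemma nnconv_uminus:
  assumes [measurable]: "f \<in> borel_measurable borel" "g \<in> borel_measurable borel"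
  shows "nnconv f g (- t) = nnconv (\<lambda>s. g (- s)) (\<lambda>s. f (- s)) t"
proof -
  have "nnconv (\<lambda>s. g (- s)) (\<lambda>s. f (- s)) t
      = (\<integral>\<^sup>+ s. enorm (g (- (t + s))) * enorm (f (- (- (t + s) + t))) \<partial>\<mu>)"
    unfolding nnconv_def
    by (rule nn_integral_left_translation[symmetric]) measurable
  also have "\<dots> = nnconv f g (- t)"
  proof -
    have "- (- (t + s) + t) = s" for s by (simp add: minus_add add.assoc)
    then show ?thesis by (simp add: nnconv_def minus_add mult.commute)
  qed
  finally show ?thesis by simp
qed

lemma borel_measurable_continuous_section:
  fixes \<kappa> :: "'g \<times> 'g \<Rightarrow> complex"
  assumes "continuous_on UNIV \<kappa>"
  shows "(\<lambda>s. \<kappa> (s, t)) \<in> borel_measurable borel" "(\<lambda>s. \<kappa> (t, s)) \<in> borel_measurable borel"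
  by (intro borel_measurable_continuous_onI continuous_on_compose2[OF assms] continuous_intros; simp)+

lemma convolution_measurable:
  fixes f g :: "'g \<Rightarrow> complex" and \<kappa> :: "'g \<times> 'g \<Rightarrow> complex"
  assumes f: "sigma_supported f" and g: "sigma_supported g" and \<kappa>: "continuous_on UNIV \<kappa>"
  shows "(\<lambda>t. \<integral> s. f s * g (- s + t) * \<kappa> (s, t) \<partial>\<mu>) \<in> borel_measurable borel"
proof -
  obtain f' g' H where H: "sigma_compact H" and f': "f' \<in> borel_measurable borel"
    and g': "g' \<in> borel_measurable baire"
    and ae: "AE s in \<mu>. f s = f' s" "AE s in \<mu>. g s = g' s"
    and supp: "\<And>s t. s \<notin> H \<or> t \<notin> H \<Longrightarrow> f' s = 0 \<or> g' (- s + t) = 0"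
    and meas: "(\<lambda>(s, t). f' s * g' (- s + t)) \<in> borel_measurable (mu_sq H)"
      "(\<lambda>(s, t). enorm (f' s) * enorm (g' (- s + t))) \<in> borel_measurable (mu_sq H)"
    by (rule convolution_kernel[OF f g]) (rule that; assumption)
  note f' [measurable]
  have "(\<lambda>(s, t). f' s * g' (- s + t) * \<kappa> (s, t)) \<in> borel_measurable (mu_sq H)"
    using borel_measurable_times[OF meas(1) continuous_borel_measurable_mu_on[OF \<kappa> H]]
    by (simp add: case_prod_unfold)
  then have "(\<lambda>t. \<integral> s. f' s * g' (- s + t) * \<kappa> (s, t) \<partial>\<mu>) \<in> borel_measurable borel"
    using supp by (intro measurable_inner_integral[OF H]) auto
  moreover have "(\<integral> s. f s * g (- s + t) * \<kappa> (s, t) \<partial>\<mu>) = (\<integral> s. f' s * g' (- s + t) * \<kappa> (s, t) \<partial>\<mu>)" for t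
    using f g by (intro convolution_cong ae f' borel_measurable_baire[OF g'] borel_measurable_continuous_section \<kappa>)
      (auto simp: sigma_supported_def)
  ultimately show ?thesis by simp
qed

text \<open>
  The measurability of the inner integral on the right is assumed because \<open>f\<close> is replaced by a representative
  there: the two integrands agree almost everywhere, and this gives equal integrals only for measurable ones.
\<close>

lemma convolution_fubini:
  fixes f g w :: "'g \<Rightarrow> complex" and \<kappa> :: "'g \<times> 'g \<Rightarrow> complex"
  assumes f: "sigma_supported f" and g: "sigma_supported g" and w [measurable]: "w \<in> borel_measurable borel"
    and \<kappa>: "continuous_on UNIV \<kappa>" "\<And>p. cmod (\<kappa> p) \<le> 1"
    and X: "(\<lambda>r. \<integral> s. g (- r + s) * \<kappa> (r, s) * w s \<partial>\<mu>) \<in> borel_measurable borel"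
    and fin: "(\<integral>\<^sup>+ s. nnconv f g s * enorm (w s) \<partial>\<mu>) < \<infinity>"
  shows "(\<integral> s. (\<integral> r. f r * g (- r + s) * \<kappa> (r, s) \<partial>\<mu>) * w s \<partial>\<mu>)
    = (\<integral> r. f r * (\<integral> s. g (- r + s) * \<kappa> (r, s) * w s \<partial>\<mu>) \<partial>\<mu>)"
proof -
  obtain f' g' H where H: "sigma_compact H" and f': "f' \<in> borel_measurable borel"
    and g': "g' \<in> borel_measurable baire"
    and ae: "AE s in \<mu>. f s = f' s" "AE s in \<mu>. g s = g' s"
    and supp: "\<And>s t. s \<notin> H \<or> t \<notin> H \<Longrightarrow> f' s = 0 \<or> g' (- s + t) = 0"
    and meas: "(\<lambda>(s, t). f' s * g' (- s + t)) \<in> borel_measurable (mu_sq H)"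
      "(\<lambda>(s, t). enorm (f' s) * enorm (g' (- s + t))) \<in> borel_measurable (mu_sq H)"
    by (rule convolution_kernel[OF f g]) (rule that; assumption)
  note f' [measurable]
  have g'_borel [measurable]: "g' \<in> borel_measurable borel" using g' by (rule borel_measurable_baire)
  have [measurable]: "f \<in> borel_measurable borel" "g \<in> borel_measurable borel"
    using f g by (auto simp: sigma_supported_def)
  note \<kappa>_meas [measurable] = borel_measurable_continuous_section[OF \<kappa>(1)]
  let ?F = "\<lambda>r s. f' r * g' (- r + s) * \<kappa> (r, s) * w s"
  have wH: "(\<lambda>p. w (snd p)) \<in> borel_measurable (mu_sq H)"
    using measurable_compose[OF measurable_snd borel_measurable_mu_on[OF w]] .
  have F: "(\<lambda>(r, s). ?F r s) \<in> borel_measurable (mu_sq H)"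
    using borel_measurable_times[OF borel_measurable_times[OF meas(1) continuous_borel_measurable_mu_on[OF \<kappa>(1) H]] wH]
    by (simp add: case_prod_unfold)
  have "(\<integral>\<^sup>+ s. (\<integral>\<^sup>+ r. norm (?F r s) \<partial>\<mu>) \<partial>\<mu>) \<le> (\<integral>\<^sup>+ s. nnconv f g s * enorm (w s) \<partial>\<mu>)"
  proof (rule nn_integral_mono)
    fix s
    have "(\<integral>\<^sup>+ r. norm (?F r s) \<partial>\<mu>) \<le> (\<integral>\<^sup>+ r. enorm (f' r) * enorm (g' (- r + s)) * enorm (w s) \<partial>\<mu>)"
    proof (rule nn_integral_mono)
      fix r
      have "norm (?F r s) \<le> cmod (f' r) * cmod (g' (- r + s)) * 1 * cmod (w s)"
        unfolding norm_mult by (intro mult_mono \<kappa>(2)) auto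
      then show "ennreal (norm (?F r s)) \<le> enorm (f' r) * enorm (g' (- r + s)) * enorm (w s)"
        by (simp add: ennreal_mult[symmetric])
    qed
    also have "\<dots> = nnconv f' g' s * enorm (w s)"
      unfolding nnconv_def by (intro nn_integral_multc) measurable
    finally show "(\<integral>\<^sup>+ r. norm (?F r s) \<partial>\<mu>) \<le> nnconv f g s * enorm (w s)"
      using nnconv_cong[OF ae] by simp
  qed
  then have fin': "(\<integral>\<^sup>+ s. (\<integral>\<^sup>+ r. norm (?F r s) \<partial>\<mu>) \<partial>\<mu>) < \<infinity>" using fin by (rule le_less_trans)
  have "(\<integral> s. (\<integral> r. f r * g (- r + s) * \<kappa> (r, s) \<partial>\<mu>) * w s \<partial>\<mu>) = (\<integral> s. (\<integral> r. ?F r s \<partial>\<mu>) \<partial>\<mu>)"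
  proof (rule Bochner_Integration.integral_cong[OF refl])
    fix s
    have "(\<integral> r. f r * g (- r + s) * \<kappa> (r, s) \<partial>\<mu>) = (\<integral> r. f' r * g' (- r + s) * \<kappa> (r, s) \<partial>\<mu>)"
      by (intro convolution_cong ae) measurable
    then show "(\<integral> r. f r * g (- r + s) * \<kappa> (r, s) \<partial>\<mu>) * w s = (\<integral> r. ?F r s \<partial>\<mu>)"
      by simp
  qed
  also have "\<dots> = (\<integral> r. (\<integral> s. ?F r s \<partial>\<mu>) \<partial>\<mu>)"
    by (rule integral_swap[OF H F _ fin', symmetric]) (use supp in auto)
  also have "\<dots> = (\<integral> r. f r * (\<integral> s. g (- r + s) * \<kappa> (r, s) * w s \<partial>\<mu>) \<partial>\<mu>)"
  proof -
    have inner: "(\<integral> s. ?F r s \<partial>\<mu>) = f' r * (\<integral> s. g (- r + s) * \<kappa> (r, s) * w s \<partial>\<mu>)" for r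
    proof -
      have "(\<integral> s. ?F r s \<partial>\<mu>) = f' r * (\<integral> s. g' (- r + s) * \<kappa> (r, s) * w s \<partial>\<mu>)"
        by (subst integral_mult_right_zero[symmetric]) (simp add: mult.assoc)
      also have "(\<integral> s. g' (- r + s) * \<kappa> (r, s) * w s \<partial>\<mu>) = (\<integral> s. g (- r + s) * \<kappa> (r, s) * w s \<partial>\<mu>)"
      proof (rule integral_cong_AE)
        show "AE s in \<mu>. g' (- r + s) * \<kappa> (r, s) * w s = g (- r + s) * \<kappa> (r, s) * w s"
          using AE_left_translation[OF ae(2), of "- r"] by eventually_elim simp
      qed measurable
      finally show ?thesis .
    qed
    have swap_meas: "(\<lambda>r. \<integral> s. ?F r s \<partial>\<mu>) \<in> borel_measurable borel"
    proof (rule measurable_inner_integral[OF H, of "\<lambda>s r. ?F r s"])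
      show "(\<lambda>(s, r). ?F r s) \<in> borel_measurable (mu_sq H)"
        using measurable_pair_swap[OF F] by simp
    qed (use supp in auto)
    show ?thesis
    proof (rule integral_cong_AE)
      show "AE r in \<mu>. (\<integral> s. ?F r s \<partial>\<mu>) = f r * (\<integral> s. g (- r + s) * \<kappa> (r, s) * w s \<partial>\<mu>)"
        using ae(1) by eventually_elim (simp add: inner)
    qed (use swap_meas X in measurable)
  qed
  finally show ?thesis .
qed

end

section \<open>Twisted convolution\<close>

lemma (in unimodular_haar) modular_function_one: "modular_function \<mu> g = 1"
  unfolding modular_function_def
proof (rule the_equality)
  show "0 < (1::real) \<and> (\<forall>A\<in>sets \<mu>. emeasure \<mu> ((\<lambda>x. x + g) ` A) = ennreal 1 * emeasure \<mu> A)"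
    using unimod by (simp add: unimodular_def)
  fix c :: real assume c: "0 < c \<and> (\<forall>A\<in>sets \<mu>. emeasure \<mu> ((\<lambda>x. x + g) ` A) = ennreal c * emeasure \<mu> A)"
  obtain K where K: "compact K" "0 < emeasure \<mu> K" by (rule compact_positive)
  have "emeasure \<mu> K = ennreal c * emeasure \<mu> K"
    using c unimod borel_compact[OF K(1)] unfolding unimodular_def by (metis sets_mu)
  then have "emeasure \<mu> K * ennreal c = emeasure \<mu> K * 1" by (simp add: mult.commute)
  then have "ennreal c = 1"
    using K emeasure_compact[OF K(1)] unfolding ennreal_mult_cancel_left by auto
  then show "c = 1" using c by (metis ennreal_1 ennreal_inj less_imp_le zero_le_one)
qed

locale twisted_haar = unimodular_haar \<mu> for \<mu> :: "'g::{topological_group_add,t2_space} measure" +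
  fixes \<Omega> :: "'g \<times> 'g \<Rightarrow> complex"
  assumes cocycle: "cocycle \<Omega>" and continuous_part: "continuous_on UNIV (unimodular_part \<Omega>)"
begin

abbreviation u :: "'g \<times> 'g \<Rightarrow> complex" where "u \<equiv> unimodular_part \<Omega>"
abbreviation conv :: "('g \<Rightarrow> complex) \<Rightarrow> ('g \<Rightarrow> complex) \<Rightarrow> 'g \<Rightarrow> complex" where
  "conv \<equiv> twisted_convolution \<mu> \<Omega>"
abbreviation invol :: "('g \<Rightarrow> complex) \<Rightarrow> 'g \<Rightarrow> complex" where
  "invol \<equiv> twisted_involution \<mu> \<Omega>"

lemma norm_u [simp]: "cmod (u p) = 1"
proof -
  have "\<Omega> p \<noteq> 0" using cocycle unfolding cocycle_def by blast
  then show ?thesis by (simp add: unimodular_part_def norm_divide)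
qed

lemma u_cocycle: "u (r, s) * u (r + s, t) = u (s, t) * u (r, s + t)"
proof -
  have eq: "\<Omega> (r, s) * \<Omega> (r + s, t) = \<Omega> (s, t) * \<Omega> (r, s + t)"
    using cocycle by (simp add: cocycle_def)
  have "u (r, s) * u (r + s, t) = \<Omega> (r, s) * \<Omega> (r + s, t) / of_real (cmod (\<Omega> (r, s) * \<Omega> (r + s, t)))"
    by (simp add: unimodular_part_def norm_mult)
  also have "\<dots> = u (s, t) * u (r, s + t)"
    unfolding eq by (simp add: unimodular_part_def norm_mult)
  finally show ?thesis .
qed

lemma u_zero [simp]: "u (r, 0) = 1" "u (0, r) = 1"
  using cocycle by (simp_all add: cocycle_def unimodular_part_def)

lemma u_minus: "u (s, - s) = u (- s, s)"
  using u_cocycle[of s "- s" s] by simp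

lemma cnj_u: "cnj (u p) * u p = 1"
  using complex_norm_square[of "u p"] by (simp add: mult.commute)

lemma continuous_kernel: "continuous_on UNIV (\<lambda>(s, t). u (s, - s + t))"
  unfolding case_prod_unfold
  by (intro continuous_on_compose2[OF continuous_part] continuous_intros) auto

lemma borel_measurable_u [measurable]:
  "(\<lambda>s. u (s, - s + t)) \<in> borel_measurable borel" "(\<lambda>s. u (t, - t + s)) \<in> borel_measurable borel"
  "(\<lambda>s. u (s, - s)) \<in> borel_measurable borel"
  by (intro borel_measurable_continuous_onI continuous_on_compose2[OF continuous_part] continuous_intros; simp)+

lemma conv_cong:
  assumes "AE s in \<mu>. f s = f' s" "AE s in \<mu>. g s = g' s"
    and "f \<in> borel_measurable borel" "f' \<in> borel_measurable borel"
      "g \<in> borel_measurable borel" "g' \<in> borel_measurable borel"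
  shows "conv f g = conv f' g'"
  unfolding twisted_convolution_def using assms by (intro ext convolution_cong) auto

lemma conv_measurable [measurable]:
  assumes "integrable \<mu> f" "integrable \<mu> g"
  shows "conv f g \<in> borel_measurable borel"
  using convolution_measurable[OF integrable_sigma_supported[OF assms(1)]
      integrable_sigma_supported[OF assms(2)] continuous_kernel]
  unfolding twisted_convolution_def by simp

lemma integrable_nnconv:
  assumes f: "integrable \<mu> f" and g: "integrable \<mu> g"
  shows "(\<integral>\<^sup>+ t. nnconv f g t \<partial>\<mu>) < \<infinity>"
proof -
  have "(\<integral>\<^sup>+ t. nnconv f g t \<partial>\<mu>) = (\<integral>\<^sup>+ s. enorm (f s) * (\<integral>\<^sup>+ t. enorm (g t) \<partial>\<mu>) \<partial>\<mu>)"
    using nn_integral_nnconv[OF integrable_sigma_supported[OF f] integrable_sigma_supported[OF g], of "\<lambda>_. 1"] by simp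
  also have "\<dots> = (\<integral>\<^sup>+ s. enorm (f s) \<partial>\<mu>) * (\<integral>\<^sup>+ t. enorm (g t) \<partial>\<mu>)"
    using f by (intro nn_integral_multc) auto
  also have "\<dots> < \<infinity>"
    using f g by (auto simp: integrable_iff_bounded ennreal_mult_less_top)
  finally show ?thesis .
qed

lemma AE_nnconv_finite:
  assumes f: "integrable \<mu> f" and g: "integrable \<mu> g"
  shows "AE t in \<mu>. nnconv f g t < \<infinity>"
proof -
  have [measurable]: "nnconv f g \<in> borel_measurable borel"
    using nnconv_measurable integrable_sigma_supported f g by blast
  show ?thesis
    using nn_integral_noteq_infinite[of "nnconv f g" \<mu>] integrable_nnconv[OF f g] by (simp add: less_top)
qed

lemma integrable_kernel:
  assumes [measurable]: "f \<in> borel_measurable borel" "g \<in> borel_measurable borel" and "nnconv f g t < \<infinity>"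
  shows "integrable \<mu> (\<lambda>s. f s * g (- s + t) * u (s, - s + t))"
proof (rule integrableI_bounded)
  show "(\<integral>\<^sup>+ s. norm (f s * g (- s + t) * u (s, - s + t)) \<partial>\<mu>) < \<infinity>"
    using assms(3) by (simp add: nnconv_def norm_mult ennreal_mult)
qed measurable

lemma norm_conv_le_nnconv:
  assumes "f \<in> borel_measurable borel" "g \<in> borel_measurable borel"
  shows "enorm (conv f g t) \<le> nnconv f g t"
proof (cases "integrable \<mu> (\<lambda>s. f s * g (- s + t) * u (s, - s + t))")
  case True
  then show ?thesis
    using integral_norm_bound_ennreal[OF True]
    by (simp add: twisted_convolution_def nnconv_def norm_mult ennreal_mult)
qed (simp add: twisted_convolution_def not_integrable_integral_eq)

lemma conv_add_left:
  assumes f: "integrable \<mu> f" "integrable \<mu> f'" and g: "integrable \<mu> g"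
  shows "AE t in \<mu>. conv (\<lambda>s. f s + f' s) g t = conv f g t + conv f' g t"
  using AE_nnconv_finite[OF f(1) g] AE_nnconv_finite[OF f(2) g]
proof eventually_elim
  case (elim t)
  then have "integrable \<mu> (\<lambda>s. f s * g (- s + t) * u (s, - s + t))" "integrable \<mu> (\<lambda>s. f' s * g (- s + t) * u (s, - s + t))"
    using f g by (auto intro!: integrable_kernel)
  then show ?case by (simp add: twisted_convolution_def distrib_right)
qed

lemma conv_add_right:
  assumes f: "integrable \<mu> f" and g: "integrable \<mu> g" "integrable \<mu> g'"
  shows "AE t in \<mu>. conv f (\<lambda>s. g s + g' s) t = conv f g t + conv f g' t"
  using AE_nnconv_finite[OF f g(1)] AE_nnconv_finite[OF f g(2)]
proof eventually_elim
  case (elim t)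
  then have "integrable \<mu> (\<lambda>s. f s * g (- s + t) * u (s, - s + t))" "integrable \<mu> (\<lambda>s. f s * g' (- s + t) * u (s, - s + t))"
    using f g by (auto intro!: integrable_kernel)
  then show ?case by (simp add: twisted_convolution_def distrib_right distrib_left)
qed

lemma conv_scale: "conv (\<lambda>s. z * f s) g t = z * conv f g t" "conv f (\<lambda>s. z * g s) t = z * conv f g t"
proof -
  have "(\<lambda>s. z * f s * g (- s + t) * u (s, - s + t)) = (\<lambda>s. z * (f s * g (- s + t) * u (s, - s + t)))"
    "(\<lambda>s. f s * (z * g (- s + t)) * u (s, - s + t)) = (\<lambda>s. z * (f s * g (- s + t) * u (s, - s + t)))"
    by (auto simp: mult_ac)
  then show "conv (\<lambda>s. z * f s) g t = z * conv f g t" "conv f (\<lambda>s. z * g s) t = z * conv f g t"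
    by (simp_all add: twisted_convolution_def)
qed

text \<open>
  After Fubini and the substitution \<open>s \<mapsto> r + s\<close>, both sides are the same double integral, by the
  cocycle identity for \<open>(r, s, - (r + s) + t)\<close>.
\<close>

lemma conv_assoc:
  assumes f: "integrable \<mu> f" and g: "integrable \<mu> g" and h: "integrable \<mu> h"
  shows "AE t in \<mu>. conv (conv f g) h t = conv f (conv g h) t"
proof -
  have [measurable]: "f \<in> borel_measurable borel" "g \<in> borel_measurable borel" "h \<in> borel_measurable borel"
    using f g h by auto
  have [measurable]: "nnconv f g \<in> borel_measurable borel"
    using nnconv_measurable integrable_sigma_supported f g by blast
  have gh [measurable]: "conv g h \<in> borel_measurable borel" using g h by measurable
  define q where "q t = complex_of_real (enn2real (nnconv f g t))" for t
  have [measurable]: "q \<in> borel_measurable borel" unfolding q_def by measurable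
  have q_AE: "AE s in \<mu>. enorm (q s) = nnconv f g s"
    using AE_nnconv_finite[OF f g] by eventually_elim (simp add: q_def)
  have q: "integrable \<mu> q"
  proof (rule integrableI_bounded)
    have "(\<integral>\<^sup>+ s. enorm (q s) \<partial>\<mu>) = (\<integral>\<^sup>+ s. nnconv f g s \<partial>\<mu>)"
      using q_AE by (rule nn_integral_cong_AE)
    then show "(\<integral>\<^sup>+ s. norm (q s) \<partial>\<mu>) < \<infinity>" using integrable_nnconv[OF f g] by simp
  qed simp
  show ?thesis
    using AE_nnconv_finite[OF q h]
  proof eventually_elim
    fix t assume fin: "nnconv q h t < \<infinity>"
    let ?w = "\<lambda>s. h (- s + t) * u (s, - s + t)"
    have inner: "(\<integral> s. g (- r + s) * u (r, - r + s) * ?w s \<partial>\<mu>) = conv g h (- r + t) * u (r, - r + t)" for r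
    proof -
      have "(\<integral> s. g (- r + s) * u (r, - r + s) * ?w s \<partial>\<mu>)
          = (\<integral> s. g (- r + (r + s)) * u (r, - r + (r + s)) * ?w (r + s) \<partial>\<mu>)"
        by (rule integral_left_translation[symmetric]) measurable
      also have "\<dots> = (\<integral> s. g s * h (- s + (- r + t)) * u (s, - s + (- r + t)) * u (r, - r + t) \<partial>\<mu>)"
      proof (rule Bochner_Integration.integral_cong[OF refl])
        fix s
        have "u (r, s) * u (r + s, - s + (- r + t)) = u (s, - s + (- r + t)) * u (r, - r + t)"
        proof -
          have "s + (- s + (- r + t)) = - r + t" by (rule add_minus_cancel)
          then show ?thesis using u_cocycle[of r s "- s + (- r + t)"] by (simp only:)
        qed
        then show "g (- r + (r + s)) * u (r, - r + (r + s)) * ?w (r + s)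
            = g s * h (- s + (- r + t)) * u (s, - s + (- r + t)) * u (r, - r + t)"
          by (simp add: add.assoc[symmetric] minus_add mult_ac)
      qed
      also have "\<dots> = conv g h (- r + t) * u (r, - r + t)"
        by (simp add: twisted_convolution_def)
      finally show ?thesis .
    qed
    have "conv (conv f g) h t = (\<integral> s. (\<integral> r. f r * g (- r + s) * (\<lambda>(r, s). u (r, - r + s)) (r, s) \<partial>\<mu>) * ?w s \<partial>\<mu>)"
      by (simp add: twisted_convolution_def mult.assoc)
    also have "\<dots> = (\<integral> r. f r * (\<integral> s. g (- r + s) * (\<lambda>(r, s). u (r, - r + s)) (r, s) * ?w s \<partial>\<mu>) \<partial>\<mu>)"
    proof (rule convolution_fubini)
      show "(\<integral>\<^sup>+ s. nnconv f g s * enorm (?w s) \<partial>\<mu>) < \<infinity>"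
      proof -
        have "(\<integral>\<^sup>+ s. nnconv f g s * enorm (?w s) \<partial>\<mu>) = nnconv q h t"
          unfolding nnconv_def[of q]
        proof (rule nn_integral_cong_AE)
          show "AE s in \<mu>. nnconv f g s * enorm (?w s) = enorm (q s) * enorm (h (- s + t))"
            using q_AE by eventually_elim (simp add: norm_mult)
        qed
        then show ?thesis using fin by simp
      qed
      show "(\<lambda>r. \<integral> s. g (- r + s) * (\<lambda>(r, s). u (r, - r + s)) (r, s) * ?w s \<partial>\<mu>) \<in> borel_measurable borel"
        by (simp add: inner)
    qed (use integrable_sigma_supported f g continuous_kernel in auto)
    also have "\<dots> = conv f (conv g h) t"
      unfolding prod.case inner by (simp add: twisted_convolution_def[of \<mu> \<Omega> f] mult_ac)
    finally show "conv (conv f g) h t = conv f (conv g h) t" .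
  qed
qed

lemma invol_eq: "invol f s = cnj (f (- s)) * cnj (u (s, - s))"
  by (simp add: twisted_involution_def modular_function_one)

lemma norm_invol: "cmod (invol f s) = cmod (f (- s))"
  by (simp add: invol_eq norm_mult)

lemma invol_invol: "invol (invol f) = f"
proof
  fix s
  have "invol (invol f) s = f s * (cnj (u (s, - s)) * u (s, - s))"
    by (simp add: invol_eq u_minus mult_ac)
  then show "invol (invol f) s = f s" by (simp add: cnj_u)
qed

lemma invol_measurable [measurable]:
  assumes [measurable]: "f \<in> borel_measurable borel" shows "invol f \<in> borel_measurable borel"
proof -
  have "(\<lambda>s. cnj (f (- s)) * cnj (u (s, - s))) \<in> borel_measurable borel"
    by (intro borel_measurable_times measurable_compose[OF _ borel_measurable_continuous_onI[of cnj]] continuous_intros) measurable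
  then show ?thesis by (simp add: invol_eq[abs_def])
qed

lemma invol_conv:
  assumes [measurable]: "f \<in> borel_measurable borel" "g \<in> borel_measurable borel"
  shows "invol (conv f g) t = conv (invol g) (invol f) t"
proof -
  have "conv (invol g) (invol f) t
      = (\<integral> s. invol g (t + s) * invol f (- (t + s) + t) * u (t + s, - (t + s) + t) \<partial>\<mu>)"
    unfolding twisted_convolution_def by (rule integral_left_translation[symmetric]) measurable
  also have "\<dots> = (\<integral> s. cnj (f s * g (- s + - t) * u (s, - s + - t)) * cnj (u (t, - t)) \<partial>\<mu>)"
  proof (rule Bochner_Integration.integral_cong[OF refl])
    fix s
    have rw: "- (t + s) = - s + - t" "- s + - t + t = - s"
      by (simp_all add: minus_add)
    \<comment> \<open>The cocycle identities for \<open>(t + s, - s, - t)\<close> and for \<open>(s, - s, - t)\<close>.\<close>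
    have c1: "u (t + s, - s) * u (t, - t) = u (- s, - t) * u (t + s, - s + - t)"
      using u_cocycle[of "t + s" "- s" "- t"] by (simp add: add.assoc del: add_uminus_conv_diff)
    have c2: "u (s, - s) = u (- s, - t) * u (s, - s + - t)"
      using u_cocycle[of s "- s" "- t"] by (simp del: add_uminus_conv_diff)
    let ?a = "u (s, - s + - t)" and ?b = "u (t, - t)" and ?c = "u (t + s, - s)" and ?d = "u (t + s, - s + - t)"
      and ?e = "u (- s, - t)"
    have "?a * ?b * ?c = u (s, - s) * ?d"
      using c1 c2 by (simp add: mult_ac)
    then have "cnj (?a * ?b * ?c) * ?c = cnj (u (s, - s) * ?d) * ?c" by (simp only:)
    then have "cnj ?d * cnj (u (- s, s)) * ?c = cnj ?a * cnj ?b * (cnj ?c * ?c)"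
      unfolding u_minus[of s] complex_cnj_mult by (simp only: mult_ac)
    then have "cnj ?d * cnj (u (- s, s)) * ?c = cnj ?a * cnj ?b"
      by (simp only: cnj_u mult_1_right)
    then show "invol g (t + s) * invol f (- (t + s) + t) * u (t + s, - (t + s) + t)
        = cnj (f s * g (- s + - t) * u (s, - s + - t)) * cnj (u (t, - t))"
      unfolding rw invol_eq by (simp add: mult_ac del: add_uminus_conv_diff)
  qed
  also have "\<dots> = invol (conv f g) t"
    by (simp add: invol_eq twisted_convolution_def del: complex_cnj_mult add_uminus_conv_diff)
  finally show ?thesis by simp
qed

end

section \<open>Weighted convolution algebras\<close>

text \<open>
  The norm of a function space in terms of a set of test functions: the norm of \<open>L\<^sup>1\<close> comes from the
  constant \<open>1\<close>, and the norm of \<open>L\<^sup>\<Phi>\<close> from the unit ball of the modular of \<open>\<Psi>\<close>.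
\<close>

definition test_norm :: "'g measure \<Rightarrow> ('g \<Rightarrow> ennreal) set \<Rightarrow> ('g \<Rightarrow> ennreal) \<Rightarrow> ennreal" where
  "test_norm \<mu> V F = (SUP v\<in>V. \<integral>\<^sup>+ s. F s * v s \<partial>\<mu>)"

lemma test_norm_mono:
  assumes "AE s in \<mu>. F s \<le> G s" shows "test_norm \<mu> V F \<le> test_norm \<mu> V G"
  unfolding test_norm_def
proof (rule SUP_mono)
  fix v assume "v \<in> V"
  moreover have "(\<integral>\<^sup>+ s. F s * v s \<partial>\<mu>) \<le> (\<integral>\<^sup>+ s. G s * v s \<partial>\<mu>)"
    using assms by (intro nn_integral_mono_AE) (auto elim!: eventually_mono intro: mult_right_mono)
  ultimately show "\<exists>w\<in>V. (\<integral>\<^sup>+ s. F s * v s \<partial>\<mu>) \<le> (\<integral>\<^sup>+ s. G s * w s \<partial>\<mu>)" by blast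
qed

lemma test_norm_cong_AE: "AE s in \<mu>. F s = G s \<Longrightarrow> test_norm \<mu> V F = test_norm \<mu> V G"
  by (intro antisym test_norm_mono) (auto elim: eventually_mono)

lemma test_norm_triangle:
  assumes V: "V \<subseteq> borel_measurable \<mu>" and [measurable]: "F \<in> borel_measurable \<mu>" "G \<in> borel_measurable \<mu>"
  shows "test_norm \<mu> V (\<lambda>s. F s + G s) \<le> test_norm \<mu> V F + test_norm \<mu> V G"
  unfolding test_norm_def[of \<mu> V "\<lambda>s. F s + G s"]
proof (rule SUP_least)
  fix v assume v: "v \<in> V"
  then have [measurable]: "v \<in> borel_measurable \<mu>" using V by blast
  have "(\<integral>\<^sup>+ s. (F s + G s) * v s \<partial>\<mu>) = (\<integral>\<^sup>+ s. F s * v s \<partial>\<mu>) + (\<integral>\<^sup>+ s. G s * v s \<partial>\<mu>)"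
    by (simp add: distrib_right nn_integral_add)
  also have "\<dots> \<le> test_norm \<mu> V F + test_norm \<mu> V G"
    unfolding test_norm_def using v by (intro add_mono SUP_upper)
  finally show "(\<integral>\<^sup>+ s. (F s + G s) * v s \<partial>\<mu>) \<le> test_norm \<mu> V F + test_norm \<mu> V G" .
qed

lemma test_norm_cmult:
  assumes V: "V \<subseteq> borel_measurable \<mu>" and [measurable]: "F \<in> borel_measurable \<mu>"
  shows "test_norm \<mu> V (\<lambda>s. c * F s) = c * test_norm \<mu> V F"
  unfolding test_norm_def SUP_mult_left_ennreal
proof (intro SUP_cong refl)
  fix v assume "v \<in> V"
  then have [measurable]: "v \<in> borel_measurable \<mu>" using V by blast
  show "(\<integral>\<^sup>+ s. c * F s * v s \<partial>\<mu>) = c * (\<integral>\<^sup>+ s. F s * v s \<partial>\<mu>)"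
    by (simp add: mult.assoc nn_integral_cmult)
qed

lemma test_norm_liminf:
  fixes F :: "nat \<Rightarrow> 'g \<Rightarrow> ennreal"
  assumes V: "V \<subseteq> borel_measurable \<mu>" and [measurable]: "\<And>i. F i \<in> borel_measurable \<mu>"
    and F: "\<And>i. i \<ge> N \<Longrightarrow> test_norm \<mu> V (F i) \<le> e" and G: "AE s in \<mu>. (\<lambda>i. F i s) \<longlonglongrightarrow> G s"
  shows "test_norm \<mu> V G \<le> e"
proof -
  have "test_norm \<mu> V (\<lambda>s. liminf (\<lambda>i. F i s)) \<le> e"
    unfolding test_norm_def
  proof (rule SUP_least)
    fix v assume v: "v \<in> V"
    then have [measurable]: "v \<in> borel_measurable \<mu>" using V by blast
    have "(\<integral>\<^sup>+ s. liminf (\<lambda>i. F i s) * v s \<partial>\<mu>) \<le> (\<integral>\<^sup>+ s. liminf (\<lambda>i. F i s * v s) \<partial>\<mu>)"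
    proof (rule nn_integral_mono)
      fix s
      show "liminf (\<lambda>i. F i s) * v s \<le> liminf (\<lambda>i. F i s * v s)"
        unfolding liminf_SUP_INF
        by (auto simp: SUP_mult_right_ennreal intro!: SUP_mono INF_greatest mult_right_mono INF_lower)
    qed
    also have "\<dots> \<le> liminf (\<lambda>i. \<integral>\<^sup>+ s. F i s * v s \<partial>\<mu>)"
      by (rule nn_integral_liminf) measurable
    also have "\<dots> \<le> e"
    proof (rule Liminf_le)
      show "\<forall>\<^sub>F i in sequentially. (\<integral>\<^sup>+ s. F i s * v s \<partial>\<mu>) \<le> e"
        using eventually_ge_at_top[of N]
      proof eventually_elim
        case (elim i)
        have "(\<integral>\<^sup>+ s. F i s * v s \<partial>\<mu>) \<le> test_norm \<mu> V (F i)"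
          unfolding test_norm_def using v by (rule SUP_upper)
        then show ?case using F[OF elim] by simp
      qed
    qed simp
    finally show "(\<integral>\<^sup>+ s. liminf (\<lambda>i. F i s) * v s \<partial>\<mu>) \<le> e" .
  qed
  moreover have "AE s in \<mu>. G s = liminf (\<lambda>i. F i s)"
    using G by eventually_elim (simp add: lim_imp_Liminf)
  ultimately show ?thesis using test_norm_cong_AE[of G] by simp
qed

lemma (in unimodular_haar) test_norm_uminus:
  assumes V: "V \<subseteq> borel_measurable borel" and inv: "\<And>v. v \<in> V \<Longrightarrow> (\<lambda>s. v (- s)) \<in> V"
    and [measurable]: "F \<in> borel_measurable borel"
  shows "test_norm \<mu> V (\<lambda>s. F (- s)) = test_norm \<mu> V F"
proof -
  have le: "test_norm \<mu> V (\<lambda>s. G (- s)) \<le> test_norm \<mu> V G" if [measurable]: "G \<in> borel_measurable borel" for G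
    unfolding test_norm_def
  proof (rule SUP_mono)
    fix v assume v: "v \<in> V"
    then have [measurable]: "v \<in> borel_measurable borel" using V by blast
    have "(\<integral>\<^sup>+ s. G (- s) * v s \<partial>\<mu>) = (\<integral>\<^sup>+ s. G (- (- s)) * v (- s) \<partial>\<mu>)"
      by (rule nn_integral_uminus[symmetric]) measurable
    then show "\<exists>w\<in>V. (\<integral>\<^sup>+ s. G (- s) * v s \<partial>\<mu>) \<le> (\<integral>\<^sup>+ s. G s * w s \<partial>\<mu>)"
      using inv[OF v] by (intro bexI[of _ "\<lambda>s. v (- s)"]) auto
  qed
  show ?thesis using le[of F] le[of "\<lambda>s. F (- s)"] by simp
qed

lemma the_elem_image_const: "S \<noteq> {} \<Longrightarrow> (\<And>x. x \<in> S \<Longrightarrow> F x = c) \<Longrightarrow> the_elem (F ` S) = c"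
proof -
  assume "S \<noteq> {}" "\<And>x. x \<in> S \<Longrightarrow> F x = c"
  then have "F ` S = {c}" by auto
  then show ?thesis by simp
qed

lemma lift1_eq: "x \<in> X \<Longrightarrow> (\<And>y. y \<in> X \<Longrightarrow> F y = c) \<Longrightarrow> lift1 F X = c"
  unfolding lift1_def by (rule the_elem_image_const) auto

lemma lift2_eq:
  "x \<in> X \<Longrightarrow> y \<in> Y \<Longrightarrow> (\<And>a b. a \<in> X \<Longrightarrow> b \<in> Y \<Longrightarrow> F a b = c) \<Longrightarrow> lift2 F X Y = c"
  unfolding lift2_def by (rule the_elem_image_const) auto

text \<open>
  The functions \<open>f\<close> for which \<open>f w\<close> has finite norm. The embedding into \<open>L\<^sup>1\<close> makes all convolutions exist and
  gives almost everywhere convergence of subsequences; \<open>X\<close> and \<open>N\<close> are separate parameters because the two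
  algebras present their carrier and norm in different ways.
\<close>

locale weighted_space = twisted_haar \<mu> \<Omega>
  for \<mu> :: "'g::{topological_group_add,t2_space} measure" and \<Omega> +
  fixes V :: "('g \<Rightarrow> ennreal) set" and w :: "'g \<Rightarrow> real"
    and X :: "('g \<Rightarrow> complex) set" and N :: "('g \<Rightarrow> complex) \<Rightarrow> real"
  assumes V_measurable: "V \<subseteq> borel_measurable borel"
    and V_uminus: "v \<in> V \<Longrightarrow> (\<lambda>s. v (- s)) \<in> V"
    and w_measurable [measurable]: "w \<in> borel_measurable borel"
    and w_pos: "0 < w s" and w_uminus: "w (- s) = w s"
    and X_eq: "X = {f \<in> borel_measurable borel. test_norm \<mu> V (\<lambda>s. ennreal (cmod (f s) * w s)) < \<infinity>}"
    and N_eq: "f \<in> X \<Longrightarrow> N f = enn2real (test_norm \<mu> V (\<lambda>s. ennreal (cmod (f s) * w s)))"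
    and embedding: "\<exists>c<\<infinity>. \<forall>f\<in>borel_measurable borel.
      (\<integral>\<^sup>+ s. enorm (f s) \<partial>\<mu>) \<le> c * test_norm \<mu> V (\<lambda>s. ennreal (cmod (f s) * w s))"
    and submult: "\<exists>c<\<infinity>. \<forall>f\<in>X. \<forall>g\<in>X. integrable \<mu> f \<longrightarrow> integrable \<mu> g \<longrightarrow>
      test_norm \<mu> V (\<lambda>s. ennreal (cmod (conv f g s) * w s)) \<le>
      c * test_norm \<mu> V (\<lambda>s. ennreal (cmod (f s) * w s)) * test_norm \<mu> V (\<lambda>s. ennreal (cmod (g s) * w s))"
begin

abbreviation nrm :: "('g \<Rightarrow> complex) \<Rightarrow> ennreal" where
  "nrm f \<equiv> test_norm \<mu> V (\<lambda>s. ennreal (cmod (f s) * w s))"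

abbreviation cls :: "('g \<Rightarrow> complex) \<Rightarrow> ('g \<Rightarrow> complex) set" where
  "cls \<equiv> ae_class \<mu>"

abbreviation A :: "('g \<Rightarrow> complex) set normed_star_algebra" where
  "A \<equiv> twisted_algebra \<mu> \<Omega> X N"

lemma V_sub: "V \<subseteq> borel_measurable \<mu>"
  using V_measurable by (simp cong: measurable_cong_sets)

lemma X_measurable [measurable_dest]: "f \<in> X \<Longrightarrow> f \<in> borel_measurable borel"
  by (simp add: X_eq)

lemma X_integrable: "f \<in> X \<Longrightarrow> integrable \<mu> f"
proof -
  assume f: "f \<in> X"
  obtain c where "c < \<infinity>" "(\<integral>\<^sup>+ s. enorm (f s) \<partial>\<mu>) \<le> c * nrm f"
    using embedding X_measurable[OF f] by blast
  moreover have "nrm f < \<infinity>" using f by (simp add: X_eq)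
  ultimately have "(\<integral>\<^sup>+ s. enorm (f s) \<partial>\<mu>) < \<infinity>"
    by (auto simp: ennreal_mult_less_top intro: le_less_trans)
  then show ?thesis using X_measurable[OF f] by (intro integrableI_bounded) (auto cong: measurable_cong_sets)
qed

lemma nrm_cong: "AE s in \<mu>. f s = g s \<Longrightarrow> nrm f = nrm g"
  by (intro test_norm_cong_AE) (auto elim!: eventually_mono)

lemma nrm_N: "f \<in> X \<Longrightarrow> nrm f = ennreal (N f)"
  by (simp add: N_eq X_eq)

lemma N_nonneg: "f \<in> X \<Longrightarrow> 0 \<le> N f"
  by (simp add: N_eq)

lemma XI: "f \<in> borel_measurable borel \<Longrightarrow> nrm f \<le> ennreal c \<Longrightarrow> f \<in> X"
  using ennreal_less_top[of c] by (auto simp: X_eq intro: le_less_trans)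

lemma N_leI: "f \<in> X \<Longrightarrow> nrm f \<le> ennreal c \<Longrightarrow> 0 \<le> c \<Longrightarrow> N f \<le> c"
  by (simp add: nrm_N)

lemma nrm_add:
  assumes [measurable]: "f \<in> borel_measurable borel" "g \<in> borel_measurable borel"
  shows "nrm (\<lambda>s. f s + g s) \<le> nrm f + nrm g"
proof -
  have "nrm (\<lambda>s. f s + g s) \<le> test_norm \<mu> V (\<lambda>s. ennreal (cmod (f s) * w s) + ennreal (cmod (g s) * w s))"
  proof (rule test_norm_mono, rule AE_I2)
    fix s
    have "cmod (f s + g s) * w s \<le> (cmod (f s) + cmod (g s)) * w s"
      using w_pos[of s] by (intro mult_right_mono norm_triangle_ineq) auto
    then show "ennreal (cmod (f s + g s) * w s) \<le> ennreal (cmod (f s) * w s) + ennreal (cmod (g s) * w s)"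
      using w_pos[of s] by (simp add: ennreal_plus[symmetric] distrib_right del: ennreal_plus)
  qed
  also have "\<dots> \<le> nrm f + nrm g" by (intro test_norm_triangle V_sub) measurable
  finally show ?thesis .
qed

lemma nrm_scale:
  assumes [measurable]: "f \<in> borel_measurable borel"
  shows "nrm (\<lambda>s. z * f s) = enorm z * nrm f"
proof -
  have "nrm (\<lambda>s. z * f s) = test_norm \<mu> V (\<lambda>s. enorm z * ennreal (cmod (f s) * w s))"
    using w_pos by (simp add: norm_mult ennreal_mult[symmetric] mult.assoc less_imp_le)
  also have "\<dots> = enorm z * nrm f" by (intro test_norm_cmult V_sub) measurable
  finally show ?thesis .
qed

lemma nrm_uminus:
  assumes [measurable]: "f \<in> borel_measurable borel"
  shows "nrm (\<lambda>s. f (- s)) = nrm f"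
  using test_norm_uminus[OF V_measurable V_uminus, of "\<lambda>s. ennreal (cmod (f s) * w s)"]
  by (simp add: w_uminus)

lemma X_zero: "(\<lambda>_. 0) \<in> X"
proof -
  have "nrm (\<lambda>_. 0) \<le> 0" unfolding test_norm_def by (intro SUP_least) simp
  then show ?thesis by (simp add: X_eq)
qed

lemma X_add: "f \<in> X \<Longrightarrow> g \<in> X \<Longrightarrow> (\<lambda>s. f s + g s) \<in> X"
  and N_add: "f \<in> X \<Longrightarrow> g \<in> X \<Longrightarrow> N (\<lambda>s. f s + g s) \<le> N f + N g"
proof -
  assume f: "f \<in> X" and g: "g \<in> X"
  have le: "nrm (\<lambda>s. f s + g s) \<le> ennreal (N f + N g)"
    using nrm_add[OF X_measurable[OF f] X_measurable[OF g]] f g by (simp add: nrm_N N_nonneg)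
  show *: "(\<lambda>s. f s + g s) \<in> X"
    using f g le by (intro XI[OF _ le]) auto
  show "N (\<lambda>s. f s + g s) \<le> N f + N g"
    using f g by (intro N_leI[OF * le]) (simp add: N_nonneg)
qed

lemma X_scale: "f \<in> X \<Longrightarrow> (\<lambda>s. z * f s) \<in> X"
  and N_scale: "f \<in> X \<Longrightarrow> N (\<lambda>s. z * f s) = cmod z * N f"
proof -
  assume f: "f \<in> X"
  have eq: "nrm (\<lambda>s. z * f s) = ennreal (cmod z * N f)"
    using nrm_scale[OF X_measurable[OF f]] f by (simp add: nrm_N N_nonneg ennreal_mult)
  show *: "(\<lambda>s. z * f s) \<in> X"
    using f by (intro XI[OF _ eq_refl[OF eq]]) auto
  show "N (\<lambda>s. z * f s) = cmod z * N f"
    using eq f by (simp add: N_eq[OF *] N_nonneg)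
qed

lemma X_invol: "f \<in> X \<Longrightarrow> invol f \<in> X"
  and N_invol: "f \<in> X \<Longrightarrow> N (invol f) = N f"
proof -
  assume f: "f \<in> X"
  have eq: "nrm (invol f) = nrm f"
    using nrm_uminus[OF X_measurable[OF f]] by (simp add: norm_invol)
  then show *: "invol f \<in> X"
    using f by (auto simp: X_eq)
  show "N (invol f) = N f" using eq f by (simp add: N_eq[OF *] N_eq)
qed

lemma N_cong:
  assumes f: "f \<in> X" and g: "g \<in> borel_measurable borel" "AE s in \<mu>. g s = f s"
  shows "N g = N f"
proof -
  have eq: "nrm g = nrm f" using g(2) by (rule nrm_cong)
  then have "g \<in> X" using f g by (simp add: X_eq)
  then show ?thesis using eq f by (simp add: N_eq)
qed

lemma conv_bound:
  "\<exists>C>0. \<forall>f\<in>X. \<forall>g\<in>X. conv f g \<in> X \<and> N (conv f g) \<le> C * N f * N g"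
proof -
  obtain c where c: "c < \<infinity>" and le: "\<And>f g. f \<in> X \<Longrightarrow> g \<in> X \<Longrightarrow> integrable \<mu> f \<Longrightarrow> integrable \<mu> g \<Longrightarrow>
      nrm (conv f g) \<le> c * nrm f * nrm g"
    using submult by blast
  define C where "C = enn2real c + 1"
  have "c = ennreal (enn2real c)" using c by simp
  also have "\<dots> \<le> ennreal C" by (intro ennreal_leI) (simp add: C_def)
  finally have cC: "c \<le> ennreal C" .
  have C: "C > 0" by (simp add: C_def add_nonneg_pos)
  have "conv f g \<in> X \<and> N (conv f g) \<le> C * N f * N g" if f: "f \<in> X" and g: "g \<in> X" for f g
  proof -
    have "nrm (conv f g) \<le> ennreal C * nrm f * nrm g"
      using le[OF f g X_integrable[OF f] X_integrable[OF g]] cC by (meson mult_right_mono order_trans zero_le)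
    also have "\<dots> = ennreal (C * N f * N g)"
      using f g C by (simp add: nrm_N N_nonneg ennreal_mult)
    finally have le: "nrm (conv f g) \<le> ennreal (C * N f * N g)" .
    have *: "conv f g \<in> X"
      using X_integrable[OF f] X_integrable[OF g] by (intro XI[OF _ le] conv_measurable)
    show ?thesis using * C f g by (auto intro!: N_leI[OF * le] simp: N_nonneg)
  qed
  then show ?thesis using C by blast
qed

lemma X_conv: "f \<in> X \<Longrightarrow> g \<in> X \<Longrightarrow> conv f g \<in> X"
  using conv_bound by blast

text \<open>Since Cauchy sequences converge almost everywhere along a subsequence, completeness is Fatou's lemma.\<close>

lemma complete:
  fixes F :: "nat \<Rightarrow> 'g \<Rightarrow> complex"
  assumes F: "\<And>n. F n \<in> X" and Cauchy: "\<And>e. e > 0 \<Longrightarrow> \<exists>K. \<forall>m\<ge>K. \<forall>n\<ge>K. N (\<lambda>s. F m s + (- 1) * F n s) < e"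
  shows "\<exists>G\<in>X. (\<lambda>n. N (\<lambda>s. F n s + (- 1) * G s)) \<longlonglongrightarrow> 0"
proof -
  have diff [simp]: "(\<lambda>s. F m s + (- 1) * F n s) \<in> X" for m n by (intro X_add X_scale F)
  have F_meas [measurable]: "F n \<in> borel_measurable borel" for n using F by (rule X_measurable)
  obtain c where c: "c < \<infinity>" and L1: "\<And>f. f \<in> borel_measurable borel \<Longrightarrow> (\<integral>\<^sup>+ s. enorm (f s) \<partial>\<mu>) \<le> c * nrm f"
    using embedding by blast
  have L1N: "(\<integral> s. cmod (f s) \<partial>\<mu>) \<le> enn2real c * N f" if f: "f \<in> X" for f
  proof -
    have "ennreal (\<integral> s. cmod (f s) \<partial>\<mu>) = (\<integral>\<^sup>+ s. enorm (f s) \<partial>\<mu>)"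
      using X_integrable[OF f] by (intro nn_integral_eq_integral[symmetric]) auto
    also have "\<dots> \<le> c * nrm f" using L1 f by (simp add: X_measurable)
    also have "\<dots> = ennreal (enn2real c * N f)"
      using c f by (simp add: nrm_N ennreal_mult N_nonneg)
    finally show ?thesis using f by (simp add: N_nonneg)
  qed
  obtain r where r: "strict_mono r" "AE x in \<mu>. Cauchy (\<lambda>i. F (r i) x)"
  proof (rule cauchy_L1_AE_cauchy_subseq[of \<mu> F])
    show "integrable \<mu> (F n)" for n using F by (rule X_integrable)
    fix e :: real assume "e > 0"
    then have "e / (enn2real c + 1) > 0" by (simp add: add_nonneg_pos)
    then obtain K where K: "\<forall>m\<ge>K. \<forall>n\<ge>K. N (\<lambda>s. F m s + (- 1) * F n s) < e / (enn2real c + 1)"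
      using Cauchy by blast
    have "(\<integral> x. norm (F i x - F j x) \<partial>\<mu>) < e" if "i \<ge> K" "j \<ge> K" for i j
    proof -
      have "(\<integral> x. norm (F i x - F j x) \<partial>\<mu>) \<le> enn2real c * N (\<lambda>s. F i s + (- 1) * F j s)"
        using L1N[OF diff[of i j]] by simp
      also have "\<dots> \<le> (enn2real c + 1) * N (\<lambda>s. F i s + (- 1) * F j s)"
        using N_nonneg[OF diff[of i j]] by (intro mult_right_mono) auto
      also have "\<dots> < e"
        using K that by (simp add: pos_less_divide_eq add_nonneg_pos mult.commute)
      finally show ?thesis .
    qed
    then show "\<exists>K. \<forall>i\<ge>K. \<forall>j\<ge>K. (\<integral> x. norm (F i x - F j x) \<partial>\<mu>) < e" by blast
  qed auto
  define G where "G x = lim (\<lambda>i. F (r i) x)" for x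
  have [measurable]: "G \<in> borel_measurable borel" unfolding G_def by measurable
  have G: "AE x in \<mu>. (\<lambda>i. F (r i) x) \<longlonglongrightarrow> G x"
    using r(2) by eventually_elim (simp add: G_def Cauchy_convergent_iff convergent_LIMSEQ_iff)
  have tail: "nrm (\<lambda>s. F n s + (- 1) * G s) \<le> ennreal e"
    if K: "\<forall>m\<ge>K. \<forall>n\<ge>K. N (\<lambda>s. F m s + (- 1) * F n s) < e" and n: "n \<ge> K" for n K e
  proof (rule test_norm_liminf[OF V_sub, where F = "\<lambda>i s. ennreal (cmod (F n s + (- 1) * F (r i) s) * w s)" and N = K])
    show "nrm (\<lambda>s. F n s + (- 1) * F (r i) s) \<le> ennreal e" if "i \<ge> K" for i
    proof -
      have "r i \<ge> K" using seq_suble[OF r(1), of i] that by simp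
      then have "N (\<lambda>s. F n s + (- 1) * F (r i) s) \<le> e" using K n by (simp add: less_imp_le)
      then show ?thesis by (simp only: nrm_N[OF diff] ennreal_leI)
    qed
    show "AE s in \<mu>. (\<lambda>i. ennreal (cmod (F n s + (- 1) * F (r i) s) * w s)) \<longlonglongrightarrow> ennreal (cmod (F n s + (- 1) * G s) * w s)"
      using G by eventually_elim (intro tendsto_intros tendsto_ennrealI)
  qed measurable
  have sub_G: "(\<lambda>s. F n s + (- 1) * G s) \<in> X"
    if "\<forall>m\<ge>K. \<forall>n\<ge>K. N (\<lambda>s. F m s + (- 1) * F n s) < e" "n \<ge> K" for n K e
    by (rule XI[OF _ tail[OF that]]) measurable
  have "G \<in> X"
  proof -
    obtain K where K: "\<forall>m\<ge>K. \<forall>n\<ge>K. N (\<lambda>s. F m s + (- 1) * F n s) < 1" using Cauchy[of 1] by auto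
    have "(\<lambda>s. F K s + (- 1) * (F K s + (- 1) * G s)) \<in> X"
      by (rule X_add[OF F X_scale[OF sub_G[OF K]]]) simp
    then show ?thesis by simp
  qed
  moreover have "(\<lambda>n. N (\<lambda>s. F n s + (- 1) * G s)) \<longlonglongrightarrow> 0"
  proof (rule LIMSEQ_I)
    fix e :: real assume e: "e > 0"
    then obtain K where K: "\<forall>m\<ge>K. \<forall>n\<ge>K. N (\<lambda>s. F m s + (- 1) * F n s) < e / 2"
      using Cauchy[of "e / 2"] by auto
    have "norm (N (\<lambda>s. F n s + (- 1) * G s) - 0) < e" if "n \<ge> K" for n
    proof -
      have "N (\<lambda>s. F n s + (- 1) * G s) \<le> e / 2"
        using e by (intro N_leI[OF sub_G[OF K that] tail[OF K that]]) auto
      then show ?thesis using e N_nonneg[OF sub_G[OF K that]] by simp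
    qed
    then show "\<exists>K. \<forall>n\<ge>K. norm (N (\<lambda>s. F n s + (- 1) * G s) - 0) < e" by blast
  qed
  ultimately show ?thesis by blast
qed

subsection \<open>Passing to classes\<close>

lemma mem_cls: "g \<in> cls f \<longleftrightarrow> g \<in> borel_measurable borel \<and> (AE s in \<mu>. g s = f s)"
  by (simp add: ae_class_def cong: measurable_cong_sets)

lemma cls_eqI:
  assumes "AE s in \<mu>. f s = g s" shows "cls f = cls g"
proof (intro set_eqI)
  fix h
  have "(AE s in \<mu>. h s = f s) \<longleftrightarrow> (AE s in \<mu>. h s = g s)"
    using assms by (intro iffI; elim AE_mp) (auto elim!: eventually_mono)
  then show "h \<in> cls f \<longleftrightarrow> h \<in> cls g" by (simp add: mem_cls)
qed

lemma cls_self: "f \<in> X \<Longrightarrow> f \<in> cls f"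
  by (simp add: mem_cls X_measurable)

lemma carrier_A: "acarrier A = cls ` X"
  and zero_A: "azero A = cls (\<lambda>_. 0)"
  by (simp_all add: twisted_algebra_def)

lemma add_A: "f \<in> X \<Longrightarrow> g \<in> X \<Longrightarrow> aadd A (cls f) (cls g) = cls (\<lambda>s. f s + g s)"
  unfolding twisted_algebra_def complex_algebra.select_convs
  by (rule lift2_eq[OF cls_self cls_self]) (auto simp: mem_cls intro!: cls_eqI)

lemma scale_A: "f \<in> X \<Longrightarrow> ascale A z (cls f) = cls (\<lambda>s. z * f s)"
  unfolding twisted_algebra_def complex_algebra.select_convs
  by (rule lift1_eq[OF cls_self]) (auto simp: mem_cls intro!: cls_eqI)

lemma mult_A: "f \<in> X \<Longrightarrow> g \<in> X \<Longrightarrow> amult A (cls f) (cls g) = cls (conv f g)"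
  unfolding twisted_algebra_def complex_algebra.select_convs
  by (rule lift2_eq[OF cls_self cls_self]) (auto simp: mem_cls X_measurable intro!: arg_cong[where f = cls] conv_cong)

lemma norm_A: "f \<in> X \<Longrightarrow> anorm A (cls f) = N f"
  unfolding twisted_algebra_def normed_algebra.select_convs
  by (rule lift1_eq[OF cls_self]) (auto simp: mem_cls intro: N_cong)

lemma star_A: "f \<in> X \<Longrightarrow> astar A (cls f) = cls (invol f)"
  unfolding twisted_algebra_def normed_star_algebra.select_convs
proof (rule lift1_eq[OF cls_self])
  fix g assume "g \<in> cls f"
  then have "AE s in \<mu>. g (- s) = f (- s)" by (intro AE_uminus) (simp add: mem_cls)
  then show "cls (invol g) = cls (invol f)"
    by (intro cls_eqI) (auto elim!: eventually_mono simp: invol_eq)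
qed

lemmas ops_A = add_A scale_A mult_A norm_A star_A X_add X_scale X_conv X_invol

lemma sub_A: "f \<in> X \<Longrightarrow> g \<in> X \<Longrightarrow> asub A (cls f) (cls g) = cls (\<lambda>s. f s + (- 1) * g s)"
  unfolding asub_def by (subst scale_A, simp, subst add_A) (auto intro: X_scale[of _ "- 1", simplified])

lemma complex_algebra_A: "is_complex_algebra A"
  unfolding is_complex_algebra_def carrier_A zero_A ball_simps(9)
proof (intro conjI ballI allI)
  show "cls (\<lambda>_. 0) \<in> cls ` X" using X_zero by blast
next
  fix f g assume "f \<in> X" "g \<in> X"
  then show "aadd A (cls f) (cls g) \<in> cls ` X" "amult A (cls f) (cls g) \<in> cls ` X"
    "aadd A (cls f) (cls g) = aadd A (cls g) (cls f)"
    by (auto simp: ops_A add.commute)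
next
  fix z f assume "f \<in> X"
  then show "ascale A z (cls f) \<in> cls ` X" by (auto simp: ops_A)
next
  fix f g h assume f: "f \<in> X" and g: "g \<in> X" and h: "h \<in> X"
  note [simp] = f g h and int = X_integrable[OF f] X_integrable[OF g] X_integrable[OF h]
  show "aadd A (aadd A (cls f) (cls g)) (cls h) = aadd A (cls f) (aadd A (cls g) (cls h))"
    by (simp add: ops_A add.assoc)
  show "amult A (amult A (cls f) (cls g)) (cls h) = amult A (cls f) (amult A (cls g) (cls h))"
    using conv_assoc[OF int] by (auto simp: ops_A intro!: cls_eqI)
  show "amult A (aadd A (cls f) (cls g)) (cls h) = aadd A (amult A (cls f) (cls h)) (amult A (cls g) (cls h))"
    using conv_add_left[OF int] by (auto simp: ops_A intro!: cls_eqI)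
  show "amult A (cls f) (aadd A (cls g) (cls h)) = aadd A (amult A (cls f) (cls g)) (amult A (cls f) (cls h))"
    using conv_add_right[OF int] by (auto simp: ops_A intro!: cls_eqI)
next
  fix f assume f: "f \<in> X"
  show "aadd A (cls (\<lambda>_. 0)) (cls f) = cls f" using f X_zero by (simp add: ops_A)
  show "asub A (cls f) (cls f) = cls (\<lambda>_. 0)" using f by (simp add: sub_A)
  show "ascale A 1 (cls f) = cls f" using f by (simp add: ops_A)
next
  fix z w f assume f: "f \<in> X"
  show "ascale A (z * w) (cls f) = ascale A z (ascale A w (cls f))" using f by (simp add: ops_A mult.assoc)
  show "ascale A (z + w) (cls f) = aadd A (ascale A z (cls f)) (ascale A w (cls f))"
    using f by (simp add: ops_A distrib_right)
next
  fix z f g assume f: "f \<in> X" and g: "g \<in> X"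
  show "ascale A z (aadd A (cls f) (cls g)) = aadd A (ascale A z (cls f)) (ascale A z (cls g))"
    using f g by (simp add: ops_A distrib_left)
  show "amult A (ascale A z (cls f)) (cls g) = ascale A z (amult A (cls f) (cls g))"
    "amult A (cls f) (ascale A z (cls g)) = ascale A z (amult A (cls f) (cls g))"
    using f g by (simp_all add: ops_A conv_scale[abs_def])
qed

lemma N_eq_zero_iff:
  assumes f: "f \<in> X"
  shows "N f = 0 \<longleftrightarrow> cls f = cls (\<lambda>_. 0)"
proof
  assume N0: "N f = 0"
  obtain c where "(\<integral>\<^sup>+ s. enorm (f s) \<partial>\<mu>) \<le> c * nrm f"
    using embedding X_measurable[OF f] by blast
  then have "(\<integral>\<^sup>+ s. enorm (f s) \<partial>\<mu>) = 0" using N0 f by (simp add: nrm_N)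
  then have "AE s in \<mu>. f s = 0"
    using X_measurable[OF f] by (subst (asm) nn_integral_0_iff_AE) (auto cong: measurable_cong_sets)
  then show "cls f = cls (\<lambda>_. 0)" by (rule cls_eqI)
next
  assume "cls f = cls (\<lambda>_. 0)"
  then have "N f = N (\<lambda>_. 0)" using norm_A[OF f] norm_A[OF X_zero] by simp
  then show "N f = 0" using N_scale[OF f, of 0] by simp
qed

lemma banach_algebra_A: "banach_algebra A"
  unfolding banach_algebra_def
proof (intro conjI)
  show "is_complex_algebra A" by (rule complex_algebra_A)
  show "\<forall>a\<in>acarrier A. 0 \<le> anorm A a \<and> (anorm A a = 0 \<longleftrightarrow> a = azero A)"
    by (auto simp: carrier_A zero_A norm_A N_nonneg N_eq_zero_iff)
  show "\<forall>z. \<forall>a\<in>acarrier A. anorm A (ascale A z a) = cmod z * anorm A a"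
    by (auto simp: carrier_A ops_A N_scale)
  show "\<forall>a\<in>acarrier A. \<forall>b\<in>acarrier A. anorm A (aadd A a b) \<le> anorm A a + anorm A b"
    by (auto simp: carrier_A ops_A N_add)
  show "\<exists>C>0. \<forall>a\<in>acarrier A. \<forall>b\<in>acarrier A. anorm A (amult A a b) \<le> C * anorm A a * anorm A b"
    using conv_bound by (fastforce simp: carrier_A ops_A)
  show "\<forall>Y. range Y \<subseteq> acarrier A \<longrightarrow> (\<forall>e>0. \<exists>K. \<forall>m\<ge>K. \<forall>n\<ge>K. anorm A (asub A (Y m) (Y n)) < e) \<longrightarrow>
      (\<exists>x\<in>acarrier A. (\<lambda>n. anorm A (asub A (Y n) x)) \<longlonglongrightarrow> 0)"
  proof (intro allI impI)
    fix Y :: "nat \<Rightarrow> ('g \<Rightarrow> complex) set"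
    assume Y: "range Y \<subseteq> acarrier A" and C: "\<forall>e>0. \<exists>K. \<forall>m\<ge>K. \<forall>n\<ge>K. anorm A (asub A (Y m) (Y n)) < e"
    have "\<forall>n. \<exists>f. f \<in> X \<and> Y n = cls f" using Y by (auto simp: carrier_A)
    then obtain F where F: "\<And>n. F n \<in> X" "\<And>n. Y n = cls (F n)" by metis
    have norm_sub: "anorm A (asub A (cls f) (cls g)) = N (\<lambda>s. f s + (- 1) * g s)" if "f \<in> X" "g \<in> X" for f g
      unfolding sub_A[OF that] by (intro norm_A X_add X_scale that)
    have "\<exists>G\<in>X. (\<lambda>n. N (\<lambda>s. F n s + (- 1) * G s)) \<longlonglongrightarrow> 0"
    proof (rule complete)
      fix e :: real assume "e > 0"
      then show "\<exists>K. \<forall>m\<ge>K. \<forall>n\<ge>K. N (\<lambda>s. F m s + (- 1) * F n s) < e"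
        using C unfolding F(2) norm_sub[OF F(1) F(1)] by blast
    qed (rule F)
    then obtain G where "G \<in> X" "(\<lambda>n. N (\<lambda>s. F n s + (- 1) * G s)) \<longlonglongrightarrow> 0" by blast
    then show "\<exists>x\<in>acarrier A. (\<lambda>n. anorm A (asub A (Y n) x)) \<longlonglongrightarrow> 0"
      unfolding F(2) carrier_A by (auto simp: norm_sub[OF F(1)])
  qed
qed

lemma banach_star_algebra_A: "banach_star_algebra A"
  unfolding banach_star_algebra_def
proof (intro conjI)
  have invol_scale: "invol (\<lambda>s. z * f s) = (\<lambda>s. cnj z * invol f s)" for z f
    by (simp add: fun_eq_iff invol_eq mult.assoc)
  have invol_add: "invol (\<lambda>s. f s + g s) = (\<lambda>s. invol f s + invol g s)" for f g
    by (simp add: fun_eq_iff invol_eq distrib_right)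
  show "banach_algebra A" by (rule banach_algebra_A)
  show "\<forall>a\<in>acarrier A. astar A a \<in> acarrier A \<and> astar A (astar A a) = a \<and> anorm A (astar A a) = anorm A a"
    by (auto simp: carrier_A ops_A N_invol invol_invol)
  show "\<forall>z. \<forall>a\<in>acarrier A. astar A (ascale A z a) = ascale A (cnj z) (astar A a)"
    by (auto simp: carrier_A ops_A invol_scale)
  show "\<forall>a\<in>acarrier A. \<forall>b\<in>acarrier A.
      astar A (aadd A a b) = aadd A (astar A a) (astar A b) \<and>
      astar A (amult A a b) = amult A (astar A b) (astar A a)"
    by (auto simp: carrier_A ops_A invol_add invol_conv X_measurable intro!: cls_eqI)
qed

end

section \<open>Orlicz spaces\<close>

lemma young_scale:
  assumes F: "young_function F" and "0 \<le> t" "t \<le> 1" "0 \<le> y"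
  shows "F (t * y) \<le> ennreal t * F y"
proof -
  have "F ((1 - t) * 0 + t * y) \<le> ennreal (1 - t) * F 0 + ennreal t * F y"
    using assms unfolding young_function_def by (auto simp del: mult_zero_right)
  then show ?thesis using F by (simp add: young_function_def)
qed

lemma young_mono:
  assumes F: "young_function F" and "0 \<le> x" "x \<le> y"
  shows "F x \<le> F y"
proof (cases "y = 0")
  case False
  then have "F x \<le> ennreal (x / y) * F y"
    using young_scale[OF F, of "x / y" y] assms by simp
  also have "\<dots> \<le> 1 * F y" using assms False by (intro mult_right_mono) (auto simp: divide_simps)
  finally show ?thesis by simp
qed (use assms in simp)

lemma mono_ennreal_borel_measurable:
  fixes F :: "real \<Rightarrow> ennreal"
  assumes F: "mono F" shows "F \<in> borel_measurable borel"
proof -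
  have "(\<lambda>x. enn2real (inf (F x) (of_nat n))) \<in> borel_measurable borel" for n
    by (intro borel_measurable_mono monoI enn2real_mono inf_mono monoD[OF F])
      (auto simp: inf_min min_less_iff_disj of_nat_less_top)
  then have "(\<lambda>x. SUP n. ennreal (enn2real (inf (F x) (of_nat n)))) \<in> borel_measurable borel"
    by measurable
  moreover have "(SUP n. ennreal (enn2real (inf (F x) (of_nat n)))) = F x" for x
  proof -
    have "ennreal (enn2real (inf (F x) (of_nat n))) = inf (F x) (of_nat n)" for n
      by (simp add: inf_min min_less_iff_disj of_nat_less_top)
    then show ?thesis by (simp add: inf_SUP[symmetric] ennreal_SUP_of_nat_eq_top)
  qed
  ultimately show ?thesis by simp
qed

lemma young_measurable:
  assumes F: "young_function F" and [measurable]: "f \<in> borel_measurable M" and "\<And>x. 0 \<le> f x"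
  shows "(\<lambda>x. F (f x)) \<in> borel_measurable M"
proof -
  have "mono (\<lambda>x. F (max 0 x))" by (intro monoI young_mono[OF F]) auto
  then have "(\<lambda>x. F (max 0 x)) \<in> borel_measurable borel" by (rule mono_ennreal_borel_measurable)
  then have "(\<lambda>x. F (max 0 (f x))) \<in> borel_measurable M" by (rule measurable_compose[rotated]) fact
  then show ?thesis using assms(3) by (simp add: max_absorb2)
qed

lemma young_inequality:
  assumes "complementary_young_pair \<Phi> \<Psi>" "0 \<le> x" "0 \<le> y"
  shows "ennreal (x * y) \<le> \<Phi> x + \<Psi> y"
proof -
  have "ennreal (x * y) - \<Phi> x \<le> \<Psi> y"
    using assms by (auto simp: complementary_young_pair_def intro!: SUP_upper2[of x])
  then show ?thesis by (simp add: ennreal_minus_le_iff)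
qed

text \<open>
  The line through the origin and \<open>(x, \<Phi> x)\<close> lies above the graph of \<open>\<Phi>\<close> before \<open>x\<close> and below it after
  \<open>x\<close>. So its slope can replace a subgradient of \<open>\<Phi>\<close> when a function is tested for membership in \<open>L\<^sup>\<Phi>\<close>.
\<close>

lemma complementary_slope_le:
  assumes pair: "complementary_young_pair \<Phi> \<Psi>" and x: "0 < x" and fin: "\<Phi> x < \<infinity>"
  shows "\<Psi> (enn2real (\<Phi> x) / x) \<le> \<Phi> x"
proof -
  have \<Phi>: "young_function \<Phi>" using pair by (simp add: complementary_young_pair_def)
  have \<Phi>x: "\<Phi> x = ennreal (enn2real (\<Phi> x))" using fin by simp
  let ?p = "enn2real (\<Phi> x) / x"
  have "ennreal (z * ?p) - \<Phi> z \<le> \<Phi> x" if z: "0 \<le> z" for z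
  proof (cases "z \<le> x")
    case True
    have "z * ?p \<le> x * ?p" using True x by (intro mult_right_mono) auto
    then have "ennreal (z * ?p) \<le> \<Phi> x" using x \<Phi>x by (metis ennreal_leI less_irrefl nonzero_mult_div_cancel_left times_divide_eq_right)
    then show ?thesis by (metis diff_le_self_ennreal order_trans)
  next
    case False
    have "\<Phi> x \<le> ennreal (x / z) * \<Phi> z"
      using young_scale[OF \<Phi>, of "x / z" z] False x by simp
    then have "ennreal (z / x) * \<Phi> x \<le> ennreal (z / x) * (ennreal (x / z) * \<Phi> z)"
      by (rule mult_left_mono) simp
    also have "\<dots> = \<Phi> z" using x False by (simp add: mult.assoc[symmetric] ennreal_mult[symmetric])
    also have "ennreal (z / x) * \<Phi> x = ennreal (z * ?p)"
      using x z by (subst \<Phi>x) (simp add: ennreal_mult[symmetric])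
    finally have "ennreal (z * ?p) - \<Phi> z = 0" by (simp add: ennreal_minus_eq_0 diff_eq_0_iff_ennreal)
    then show ?thesis by simp
  qed
  then show ?thesis using pair x by (auto simp: complementary_young_pair_def intro!: SUP_least)
qed

definition orlicz_tests :: "'g measure \<Rightarrow> (real \<Rightarrow> ennreal) \<Rightarrow> ('g \<Rightarrow> ennreal) set" where
  "orlicz_tests \<mu> \<Psi> = (\<lambda>v s. enorm (v s)) `
     {v \<in> borel_measurable \<mu>. (\<integral>\<^sup>+ s. \<Psi> (cmod (v s)) \<partial>\<mu>) \<le> 1}"

lemma orlicz_testsI:
  assumes [measurable]: "v \<in> borel_measurable \<mu>" and "\<And>s. 0 \<le> v s" and "(\<integral>\<^sup>+ s. \<Psi> (v s) \<partial>\<mu>) \<le> 1"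
  shows "(\<lambda>s. ennreal (v s)) \<in> orlicz_tests \<mu> \<Psi>"
  unfolding orlicz_tests_def using assms
  by (intro image_eqI[of _ _ "\<lambda>s. complex_of_real (v s)"]) auto

lemma orlicz_norm_eq_test_norm:
  assumes "\<And>s. 0 < \<sigma> s"
  shows "orlicz_norm \<mu> \<Psi> (\<lambda>s. f s * of_real (\<sigma> s)) =
    enn2real (test_norm \<mu> (orlicz_tests \<mu> \<Psi>) (\<lambda>s. ennreal (cmod (f s) * \<sigma> s)))"
proof -
  have "cmod (f s * of_real (\<sigma> s) * v s) = cmod (f s) * \<sigma> s * cmod (v s)" for v s
    using assms[of s] by (simp add: norm_mult)
  then show ?thesis
    using assms by (simp add: orlicz_norm_def test_norm_def orlicz_tests_def image_image ennreal_mult less_imp_le)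
qed

lemma orlicz_test_norm_finite:
  assumes pair: "complementary_young_pair \<Phi> \<Psi>" and f [measurable]: "f \<in> borel_measurable \<mu>"
    and nonneg: "\<And>s. 0 \<le> f s" and \<alpha>: "\<alpha> > 0" and fin: "(\<integral>\<^sup>+ s. \<Phi> (\<alpha> * f s) \<partial>\<mu>) < \<infinity>"
  shows "test_norm \<mu> (orlicz_tests \<mu> \<Psi>) (\<lambda>s. ennreal (f s)) < \<infinity>"
proof -
  have Y: "young_function \<Phi>" "young_function \<Psi>" using pair by (auto simp: complementary_young_pair_def)
  have "test_norm \<mu> (orlicz_tests \<mu> \<Psi>) (\<lambda>s. ennreal (f s)) \<le> ennreal (1 / \<alpha>) * ((\<integral>\<^sup>+ s. \<Phi> (\<alpha> * f s) \<partial>\<mu>) + 1)"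
    unfolding test_norm_def orlicz_tests_def
  proof (rule SUP_least, clarify)
    fix v assume [measurable]: "v \<in> borel_measurable \<mu>" and v: "(\<integral>\<^sup>+ s. \<Psi> (cmod (v s)) \<partial>\<mu>) \<le> 1"
    have [measurable]: "(\<lambda>s. \<Phi> (\<alpha> * f s)) \<in> borel_measurable \<mu>" "(\<lambda>s. \<Psi> (cmod (v s))) \<in> borel_measurable \<mu>"
      using nonneg \<alpha> by (auto intro!: young_measurable[OF Y(1)] young_measurable[OF Y(2)])
    have "(\<integral>\<^sup>+ s. ennreal (f s) * enorm (v s) \<partial>\<mu>) = (\<integral>\<^sup>+ s. ennreal (1 / \<alpha>) * ennreal (\<alpha> * f s * cmod (v s)) \<partial>\<mu>)"
      using \<alpha> nonneg by (simp add: ennreal_mult[symmetric])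
    also have "\<dots> = ennreal (1 / \<alpha>) * (\<integral>\<^sup>+ s. ennreal (\<alpha> * f s * cmod (v s)) \<partial>\<mu>)"
      by (rule nn_integral_cmult) measurable
    also have "\<dots> \<le> ennreal (1 / \<alpha>) * (\<integral>\<^sup>+ s. \<Phi> (\<alpha> * f s) + \<Psi> (cmod (v s)) \<partial>\<mu>)"
      using \<alpha> nonneg by (intro mult_left_mono nn_integral_mono young_inequality[OF pair]) auto
    also have "\<dots> \<le> ennreal (1 / \<alpha>) * ((\<integral>\<^sup>+ s. \<Phi> (\<alpha> * f s) \<partial>\<mu>) + 1)"
      using v by (subst nn_integral_add) (auto intro!: mult_left_mono add_left_mono)
    finally show "(\<integral>\<^sup>+ s. ennreal (f s) * enorm (v s) \<partial>\<mu>) \<le> ennreal (1 / \<alpha>) * ((\<integral>\<^sup>+ s. \<Phi> (\<alpha> * f s) \<partial>\<mu>) + 1)" .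
  qed
  also have "\<dots> < \<infinity>" using fin by (simp add: ennreal_mult_less_top)
  finally show ?thesis .
qed

text \<open>
  For a truncation \<open>h\<close> of \<open>f\<close> with \<open>c = \<integral> \<Phi>(h)\<close> finite, suppose \<open>c > 1\<close>. The slopes \<open>v = \<Phi>(h) / h\<close> satisfy
  \<open>\<integral> \<Psi>(v / c) \<le> c\<inverse> \<integral> \<Psi>(v) \<le> 1\<close>, so \<open>v / c\<close> is a test function, and it gives \<open>\<integral> h v / c = 1\<close>, which
  exceeds the norm.
\<close>

lemma orlicz_modular_le_one:
  assumes pair: "complementary_young_pair \<Phi> \<Psi>" and real: "\<And>x. 0 \<le> x \<Longrightarrow> \<Phi> x < \<infinity>"
    and f [measurable]: "f \<in> borel_measurable \<mu>" and nonneg: "\<And>s. 0 \<le> f s"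
    and norm: "test_norm \<mu> (orlicz_tests \<mu> \<Psi>) (\<lambda>s. ennreal (f s)) < 1"
    and A [measurable]: "\<And>n::nat. A n \<in> sets \<mu>" "\<And>n. emeasure \<mu> (A n) < \<infinity>" "incseq A"
      "AE s in \<mu>. f s = 0 \<or> s \<in> (\<Union>n. A n)"
  shows "(\<integral>\<^sup>+ s. \<Phi> (f s) \<partial>\<mu>) \<le> 1"
proof -
  have Y: "young_function \<Phi>" "young_function \<Psi>" using pair by (auto simp: complementary_young_pair_def)
  have \<Phi>0: "\<Phi> 0 = 0" "\<Psi> 0 = 0" using Y by (auto simp: young_function_def)
  define h where "h n s = min (f s) (real n) * indicator (A n) s" for n s
  have [measurable]: "h n \<in> borel_measurable \<mu>" for n unfolding h_def by measurable
  have h_nonneg: "0 \<le> h n s" for n s using nonneg by (simp add: h_def)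
  have h_le: "h n s \<le> f s" for n s using nonneg by (auto simp: h_def indicator_def)
  have [measurable]: "(\<lambda>s. \<Phi> (h n s)) \<in> borel_measurable \<mu>" for n
    by (intro young_measurable[OF Y(1)] h_nonneg) measurable
  have bound: "(\<integral>\<^sup>+ s. \<Phi> (h n s) \<partial>\<mu>) \<le> 1" for n
  proof (rule ccontr)
    let ?c = "\<integral>\<^sup>+ s. \<Phi> (h n s) \<partial>\<mu>"
    assume "\<not> ?c \<le> 1"
    then have c1: "1 < ?c" by simp
    have "?c \<le> (\<integral>\<^sup>+ s. \<Phi> (real n) * indicator (A n) s \<partial>\<mu>)"
    proof (rule nn_integral_mono)
      fix s show "\<Phi> (h n s) \<le> \<Phi> (real n) * indicator (A n) s"
        using nonneg \<Phi>0 by (auto simp: h_def indicator_def intro!: young_mono[OF Y(1)])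
    qed
    also have "\<dots> = \<Phi> (real n) * emeasure \<mu> (A n)" by (rule nn_integral_cmult_indicator) measurable
    also have "\<dots> < \<infinity>" using A(2) real by (simp add: ennreal_mult_less_top)
    finally have "?c < \<infinity>" .
    then obtain c where c: "?c = ennreal c" "1 < c"
      using c1 by (cases ?c) (auto simp: one_less_ennreal)
    define v where "v s = enn2real (\<Phi> (h n s)) / h n s" for s
    have [measurable]: "v \<in> borel_measurable \<mu>" unfolding v_def by measurable
    have v_nonneg: "0 \<le> v s" for s using h_nonneg by (simp add: v_def)
    have \<Psi>v: "\<Psi> (v s) \<le> \<Phi> (h n s)" for s
      using complementary_slope_le[OF pair, of "h n s"] h_nonneg[of n s] real[of "h n s"] \<Phi>0
      by (cases "h n s = 0") (auto simp: v_def)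
    have hv: "ennreal (h n s * v s) = \<Phi> (h n s)" for s
      using h_nonneg[of n s] real[of "h n s"] \<Phi>0 by (cases "h n s = 0") (auto simp: v_def)
    have test: "(\<lambda>s. ennreal (v s / c)) \<in> orlicz_tests \<mu> \<Psi>"
    proof (rule orlicz_testsI)
      have "(\<integral>\<^sup>+ s. \<Psi> (v s / c) \<partial>\<mu>) \<le> (\<integral>\<^sup>+ s. ennreal (1 / c) * \<Phi> (h n s) \<partial>\<mu>)"
      proof (rule nn_integral_mono)
        fix s
        have "\<Psi> (1 / c * v s) \<le> ennreal (1 / c) * \<Psi> (v s)"
          using c v_nonneg by (intro young_scale[OF Y(2)]) auto
        also have "\<dots> \<le> ennreal (1 / c) * \<Phi> (h n s)" by (intro mult_left_mono \<Psi>v) simp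
        finally show "\<Psi> (v s / c) \<le> ennreal (1 / c) * \<Phi> (h n s)" by simp
      qed
      also have "\<dots> = ennreal (1 / c) * ?c" by (rule nn_integral_cmult) measurable
      also have "\<dots> = 1" using c by (simp add: ennreal_mult[symmetric])
      finally show "(\<integral>\<^sup>+ s. \<Psi> (v s / c) \<partial>\<mu>) \<le> 1" .
    qed (use v_nonneg c in auto)
    have "1 = ennreal (1 / c) * ?c" using c by (simp add: ennreal_mult[symmetric])
    also have "\<dots> = (\<integral>\<^sup>+ s. ennreal (1 / c) * \<Phi> (h n s) \<partial>\<mu>)" by (rule nn_integral_cmult[symmetric]) measurable
    also have "\<dots> = (\<integral>\<^sup>+ s. ennreal (h n s) * ennreal (v s / c) \<partial>\<mu>)"
      using c h_nonneg v_nonneg by (simp add: hv[symmetric] ennreal_mult[symmetric])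
    also have "\<dots> \<le> (\<integral>\<^sup>+ s. ennreal (f s) * ennreal (v s / c) \<partial>\<mu>)"
      by (intro nn_integral_mono mult_right_mono ennreal_leI h_le) simp
    also have "\<dots> \<le> test_norm \<mu> (orlicz_tests \<mu> \<Psi>) (\<lambda>s. ennreal (f s))"
      unfolding test_norm_def by (rule SUP_upper[OF test])
    finally show False using norm by simp
  qed
  have "(\<integral>\<^sup>+ s. \<Phi> (f s) \<partial>\<mu>) = (\<integral>\<^sup>+ s. liminf (\<lambda>n. \<Phi> (h n s)) \<partial>\<mu>)"
  proof (rule nn_integral_cong_AE)
    show "AE s in \<mu>. \<Phi> (f s) = liminf (\<lambda>n. \<Phi> (h n s))"
      using A(4)
    proof eventually_elim
      fix s assume s: "f s = 0 \<or> s \<in> (\<Union>n. A n)"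
      have "\<forall>\<^sub>F n in sequentially. \<Phi> (h n s) = \<Phi> (f s)"
      proof (cases "f s = 0")
        case False
        then obtain k where k: "s \<in> A k" using s by auto
        show ?thesis
          using eventually_ge_at_top[of "max k (nat \<lceil>f s\<rceil>)"]
        proof eventually_elim
          case (elim n)
          then have "s \<in> A n" using k A(3) by (auto simp: incseq_def)
          moreover have "f s \<le> real n" using elim by linarith
          ultimately show ?case by (simp add: h_def)
        qed
      qed (simp add: h_def)
      then show "\<Phi> (f s) = liminf (\<lambda>n. \<Phi> (h n s))"
        by (intro lim_imp_Liminf[symmetric] tendsto_eventually) simp_all
    qed
  qed
  also have "\<dots> \<le> liminf (\<lambda>n. \<integral>\<^sup>+ s. \<Phi> (h n s) \<partial>\<mu>)" by (rule nn_integral_liminf) measurable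
  also have "\<dots> \<le> 1" by (rule Liminf_le) (simp_all add: bound)
  finally show ?thesis .
qed

text \<open>
  A multiple of \<open>g\<close> is a test function: dividing by \<open>k \<ge> 1\<close> divides the modular by at least \<open>k\<close>, by convexity.
\<close>

lemma orlicz_hoelder:
  assumes \<Psi>: "young_function \<Psi>" and g [measurable]: "g \<in> borel_measurable \<mu>" and nonneg: "\<And>s. 0 \<le> g s"
    and \<alpha>: "\<alpha> > 0" and fin: "(\<integral>\<^sup>+ s. \<Psi> (\<alpha> * g s) \<partial>\<mu>) < \<infinity>"
  shows "\<exists>c::real. c > 0 \<and> (\<forall>F\<in>borel_measurable \<mu>.
    (\<integral>\<^sup>+ s. F s * ennreal (g s) \<partial>\<mu>) \<le> ennreal c * test_norm \<mu> (orlicz_tests \<mu> \<Psi>) F)"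
proof -
  let ?I = "\<integral>\<^sup>+ s. \<Psi> (\<alpha> * g s) \<partial>\<mu>"
  define k where "k = enn2real ?I + 1"
  have k: "k \<ge> 1" "?I \<le> ennreal k"
  proof -
    have "?I = ennreal (enn2real ?I)" using fin by simp
    also have "\<dots> \<le> ennreal k" by (intro ennreal_leI) (simp add: k_def)
    finally show "?I \<le> ennreal k" .
  qed (simp add: k_def)
  have [measurable]: "(\<lambda>s. \<Psi> (\<alpha> * g s)) \<in> borel_measurable \<mu>"
    using nonneg \<alpha> by (intro young_measurable[OF \<Psi>]) auto
  have test: "(\<lambda>s. ennreal (\<alpha> / k * g s)) \<in> orlicz_tests \<mu> \<Psi>"
  proof (rule orlicz_testsI)
    have "(\<integral>\<^sup>+ s. \<Psi> (\<alpha> / k * g s) \<partial>\<mu>) \<le> (\<integral>\<^sup>+ s. ennreal (1 / k) * \<Psi> (\<alpha> * g s) \<partial>\<mu>)"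
    proof (rule nn_integral_mono)
      fix s
      show "\<Psi> (\<alpha> / k * g s) \<le> ennreal (1 / k) * \<Psi> (\<alpha> * g s)"
        using young_scale[OF \<Psi>, of "1 / k" "\<alpha> * g s"] k \<alpha> nonneg[of s] by simp
    qed
    also have "\<dots> = ennreal (1 / k) * ?I" by (rule nn_integral_cmult) measurable
    also have "\<dots> \<le> ennreal (1 / k) * ennreal k" using k by (intro mult_left_mono) auto
    also have "\<dots> = 1" using k by (simp add: ennreal_mult[symmetric])
    finally show "(\<integral>\<^sup>+ s. \<Psi> (\<alpha> / k * g s) \<partial>\<mu>) \<le> 1" .
  qed (use nonneg \<alpha> k in auto)
  show ?thesis
  proof (intro exI[of _ "k / \<alpha>"] conjI ballI)
    show "k / \<alpha> > 0" using k \<alpha> by simp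
    fix F :: "_ \<Rightarrow> ennreal" assume [measurable]: "F \<in> borel_measurable \<mu>"
    have "(\<integral>\<^sup>+ s. F s * ennreal (g s) \<partial>\<mu>) = (\<integral>\<^sup>+ s. ennreal (k / \<alpha>) * (F s * ennreal (\<alpha> / k * g s)) \<partial>\<mu>)"
    proof (rule nn_integral_cong)
      fix s
      have "ennreal (g s) = ennreal (k / \<alpha>) * ennreal (\<alpha> / k * g s)"
        using k \<alpha> nonneg[of s] by (simp add: ennreal_mult[symmetric])
      then show "F s * ennreal (g s) = ennreal (k / \<alpha>) * (F s * ennreal (\<alpha> / k * g s))"
        by (simp add: mult_ac)
    qed
    also have "\<dots> = ennreal (k / \<alpha>) * (\<integral>\<^sup>+ s. F s * ennreal (\<alpha> / k * g s) \<partial>\<mu>)"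
      by (rule nn_integral_cmult) measurable
    also have "\<dots> \<le> ennreal (k / \<alpha>) * test_norm \<mu> (orlicz_tests \<mu> \<Psi>) F"
      unfolding test_norm_def by (intro mult_left_mono SUP_upper[OF test]) simp
    finally show "(\<integral>\<^sup>+ s. F s * ennreal (g s) \<partial>\<mu>) \<le> ennreal (k / \<alpha>) * test_norm \<mu> (orlicz_tests \<mu> \<Psi>) F" .
  qed
qed

context unimodular_haar begin

lemma orlicz_tests_measurable: "orlicz_tests \<mu> \<Psi> \<subseteq> borel_measurable borel"
  by (auto simp: orlicz_tests_def cong: measurable_cong_sets)

lemma orlicz_tests_invariant:
  assumes \<Psi>: "young_function \<Psi>" and v: "v \<in> orlicz_tests \<mu> \<Psi>"
  shows "(\<lambda>s. v (a + s)) \<in> orlicz_tests \<mu> \<Psi>" "(\<lambda>s. v (- s)) \<in> orlicz_tests \<mu> \<Psi>"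
proof -
  obtain z where z: "v = (\<lambda>s. enorm (z s))" "(\<integral>\<^sup>+ s. \<Psi> (cmod (z s)) \<partial>\<mu>) \<le> 1"
    and [measurable]: "z \<in> borel_measurable borel"
    using v by (auto simp: orlicz_tests_def cong: measurable_cong_sets)
  have [measurable]: "(\<lambda>s. \<Psi> (cmod (z s))) \<in> borel_measurable borel"
    by (intro young_measurable[OF \<Psi>]) auto
  have "(\<integral>\<^sup>+ s. \<Psi> (cmod (z (a + s))) \<partial>\<mu>) = (\<integral>\<^sup>+ s. \<Psi> (cmod (z s)) \<partial>\<mu>)"
    by (rule nn_integral_left_translation) measurable
  then show "(\<lambda>s. v (a + s)) \<in> orlicz_tests \<mu> \<Psi>"
    using z unfolding z(1) by (intro orlicz_testsI) auto
  have "(\<integral>\<^sup>+ s. \<Psi> (cmod (z (- s))) \<partial>\<mu>) = (\<integral>\<^sup>+ s. \<Psi> (cmod (z s)) \<partial>\<mu>)"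
    by (rule nn_integral_uminus) measurable
  then show "(\<lambda>s. v (- s)) \<in> orlicz_tests \<mu> \<Psi>"
    using z unfolding z(1) by (intro orlicz_testsI) auto
qed

text \<open>Minkowski's integral inequality: convolving with \<open>f\<close> averages left translates of \<open>g\<close>.\<close>

lemma test_norm_nnconv:
  assumes V: "V \<subseteq> borel_measurable borel" and inv: "\<And>v a. v \<in> V \<Longrightarrow> (\<lambda>s. v (a + s)) \<in> V"
    and f: "sigma_supported f" and g: "sigma_supported g"
  shows "test_norm \<mu> V (nnconv f g) \<le> (\<integral>\<^sup>+ s. enorm (f s) \<partial>\<mu>) * test_norm \<mu> V (\<lambda>s. enorm (g s))"
  unfolding test_norm_def[of _ _ "nnconv f g"]
proof (rule SUP_least)
  fix v assume v: "v \<in> V"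
  have [measurable]: "f \<in> borel_measurable borel" using f by (simp add: sigma_supported_def)
  have "(\<integral>\<^sup>+ t. nnconv f g t * v t \<partial>\<mu>)
      = (\<integral>\<^sup>+ s. enorm (f s) * (\<integral>\<^sup>+ t. enorm (g t) * v (s + t) \<partial>\<mu>) \<partial>\<mu>)"
    using V v by (intro nn_integral_nnconv f g) auto
  also have "\<dots> \<le> (\<integral>\<^sup>+ s. enorm (f s) * test_norm \<mu> V (\<lambda>s. enorm (g s)) \<partial>\<mu>)"
    unfolding test_norm_def using inv[OF v] by (intro nn_integral_mono mult_left_mono SUP_upper) auto
  also have "\<dots> = (\<integral>\<^sup>+ s. enorm (f s) \<partial>\<mu>) * test_norm \<mu> V (\<lambda>s. enorm (g s))"
    by (rule nn_integral_multc) measurable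
  finally show "(\<integral>\<^sup>+ t. nnconv f g t * v t \<partial>\<mu>) \<le> \<dots>" .
qed

lemma sigma_supported_uminus:
  assumes f: "sigma_supported (f :: 'g \<Rightarrow> complex)" shows "sigma_supported (\<lambda>s. f (- s))"
proof -
  obtain S where [measurable]: "f \<in> borel_measurable borel" and S: "sigma_compact S" "AE x in \<mu>. x \<notin> S \<longrightarrow> f x = 0"
    using f by (auto simp: sigma_supported_def)
  have "AE x in \<mu>. x \<notin> uminus ` S \<longrightarrow> f (- x) = 0"
    using AE_uminus[OF S(2)] by eventually_elim (metis image_eqI minus_minus)
  moreover have "sigma_compact (uminus ` S)"
    by (intro sigma_compact_image S continuous_intros)
  ultimately show ?thesis by (auto simp: sigma_supported_def)
qed

lemma test_norm_nnconv_right: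
  assumes V: "V \<subseteq> borel_measurable borel" and inv: "\<And>v a. v \<in> V \<Longrightarrow> (\<lambda>s. v (a + s)) \<in> V"
    "\<And>v. v \<in> V \<Longrightarrow> (\<lambda>s. v (- s)) \<in> V"
    and f: "sigma_supported f" and g: "sigma_supported g"
  shows "test_norm \<mu> V (nnconv f g) \<le> test_norm \<mu> V (\<lambda>s. enorm (f s)) * (\<integral>\<^sup>+ s. enorm (g s) \<partial>\<mu>)"
proof -
  have [measurable]: "f \<in> borel_measurable borel" "g \<in> borel_measurable borel"
    using f g by (auto simp: sigma_supported_def)
  have "test_norm \<mu> V (nnconv f g) = test_norm \<mu> V (\<lambda>t. nnconv f g (- t))"
    by (rule test_norm_uminus[symmetric, OF V inv(2) nnconv_measurable[OF f g]])
  also have "\<dots> = test_norm \<mu> V (nnconv (\<lambda>s. g (- s)) (\<lambda>s. f (- s)))"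
    by (simp add: nnconv_uminus)
  also have "\<dots> \<le> (\<integral>\<^sup>+ s. enorm (g (- s)) \<partial>\<mu>) * test_norm \<mu> V (\<lambda>s. enorm (f (- s)))"
    by (intro test_norm_nnconv[OF V inv(1)] sigma_supported_uminus f g)
  also have "\<dots> = test_norm \<mu> V (\<lambda>s. enorm (f s)) * (\<integral>\<^sup>+ s. enorm (g s) \<partial>\<mu>)"
    using test_norm_uminus[OF V inv(2), of "\<lambda>s. enorm (f s)"]
      nn_integral_uminus[of "\<lambda>s. enorm (g s)"] by (simp add: mult.commute)
  finally show ?thesis .
qed

end

section \<open>The Orlicz algebra inside the weighted \<open>L\<^sup>1\<close> algebra\<close>

lemma (in unimodular_haar) sigma_supported_times:
  assumes "sigma_supported (f :: 'g \<Rightarrow> complex)" and [measurable]: "b \<in> borel_measurable borel"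
  shows "sigma_supported (\<lambda>s. f s * of_real (b s))"
proof -
  obtain S where [measurable]: "f \<in> borel_measurable borel" and S: "sigma_compact S" "AE x in \<mu>. x \<notin> S \<longrightarrow> f x = 0"
    using assms by (auto simp: sigma_supported_def)
  have "AE x in \<mu>. x \<notin> S \<longrightarrow> f x * of_real (b x) = 0" using S(2) by eventually_elim auto
  then show ?thesis using S(1) by (auto simp: sigma_supported_def)
qed

text \<open>The weight \<open>a\<close> at \<open>t = s + (- s + t)\<close> is distributed to the two factors under the integral.\<close>

lemma (in twisted_haar) test_norm_conv_le:
  assumes V: "V \<subseteq> borel_measurable borel"
    and f: "integrable \<mu> f" and g: "integrable \<mu> g"
    and [measurable]: "a \<in> borel_measurable borel"
      "b \<in> borel_measurable borel" "c \<in> borel_measurable borel" "b' \<in> borel_measurable borel" "c' \<in> borel_measurable borel"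
    and nonneg: "\<And>s. 0 \<le> a s" "\<And>s. 0 \<le> b s" "\<And>s. 0 \<le> c s" "\<And>s. 0 \<le> b' s" "\<And>s. 0 \<le> c' s"
    and le: "\<And>s t. a (s + t) \<le> b s * c t + b' s * c' t"
  shows "test_norm \<mu> V (\<lambda>s. ennreal (cmod (conv f g s) * a s)) \<le>
    test_norm \<mu> V (nnconv (\<lambda>s. f s * of_real (b s)) (\<lambda>s. g s * of_real (c s))) +
    test_norm \<mu> V (nnconv (\<lambda>s. f s * of_real (b' s)) (\<lambda>s. g s * of_real (c' s)))"
proof -
  have [measurable]: "f \<in> borel_measurable borel" "g \<in> borel_measurable borel" using f g by auto
  let ?fb = "\<lambda>s. f s * of_real (b s)" and ?gc = "\<lambda>s. g s * of_real (c s)"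
    and ?fb' = "\<lambda>s. f s * of_real (b' s)" and ?gc' = "\<lambda>s. g s * of_real (c' s)"
  have supp: "sigma_supported ?fb" "sigma_supported ?gc" "sigma_supported ?fb'" "sigma_supported ?gc'"
    by (intro sigma_supported_times integrable_sigma_supported f g; measurable)+
  have "ennreal (cmod (conv f g t) * a t) \<le> nnconv ?fb ?gc t + nnconv ?fb' ?gc' t" for t
  proof -
    have "ennreal (cmod (conv f g t) * a t) = enorm (conv f g t) * ennreal (a t)"
      using nonneg by (simp add: ennreal_mult)
    also have "\<dots> \<le> nnconv f g t * ennreal (a t)"
      by (intro mult_right_mono norm_conv_le_nnconv) auto
    also have "\<dots> = (\<integral>\<^sup>+ s. enorm (f s) * enorm (g (- s + t)) * ennreal (a t) \<partial>\<mu>)"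
      unfolding nnconv_def by (rule nn_integral_multc[symmetric]) measurable
    also have "\<dots> \<le> (\<integral>\<^sup>+ s. enorm (?fb s) * enorm (?gc (- s + t)) +
        enorm (?fb' s) * enorm (?gc' (- s + t)) \<partial>\<mu>)"
    proof (rule nn_integral_mono)
      fix s
      have "a t \<le> b s * c (- s + t) + b' s * c' (- s + t)"
        using le[of s "- s + t"] by (simp add: add.assoc[symmetric])
      then have "cmod (f s) * cmod (g (- s + t)) * a t
          \<le> cmod (f s) * cmod (g (- s + t)) * (b s * c (- s + t) + b' s * c' (- s + t))"
        by (intro mult_left_mono) auto
      also have "\<dots> = cmod (?fb s) * cmod (?gc (- s + t)) + cmod (?fb' s) * cmod (?gc' (- s + t))"
        using nonneg by (simp add: norm_mult algebra_simps)
      finally have "cmod (f s) * cmod (g (- s + t)) * a t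
          \<le> cmod (?fb s) * cmod (?gc (- s + t)) + cmod (?fb' s) * cmod (?gc' (- s + t))" .
      then show "enorm (f s) * enorm (g (- s + t)) * ennreal (a t)
          \<le> enorm (?fb s) * enorm (?gc (- s + t)) + enorm (?fb' s) * enorm (?gc' (- s + t))"
        using nonneg by (simp add: ennreal_mult[symmetric] ennreal_plus[symmetric] del: ennreal_plus norm_mult)
    qed
    also have "\<dots> = nnconv ?fb ?gc t + nnconv ?fb' ?gc' t"
      unfolding nnconv_def by (rule nn_integral_add) measurable
    finally show ?thesis .
  qed
  then have "test_norm \<mu> V (\<lambda>s. ennreal (cmod (conv f g s) * a s)) \<le>
      test_norm \<mu> V (\<lambda>t. nnconv ?fb ?gc t + nnconv ?fb' ?gc' t)"
    by (intro test_norm_mono AE_I2)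
  also have "\<dots> \<le> test_norm \<mu> V (nnconv ?fb ?gc) + test_norm \<mu> V (nnconv ?fb' ?gc')"
    using V nnconv_measurable[OF supp(1,2)] nnconv_measurable[OF supp(3,4)]
    by (intro test_norm_triangle) (auto cong: measurable_cong_sets)
  finally show ?thesis .
qed

lemma bounded_real_range_le:
  assumes "bounded (range (f :: 'a \<Rightarrow> real))" obtains B where "0 < B" "\<And>x. f x \<le> B"
  using assms by (auto simp: bounded_pos) (meson abs_le_D1)

text \<open>
  The hypothesis says that \<open>\<rho> = \<sigma> / \<omega>\<close> is submultiplicative up to \<open>M\<close>. With symmetry, \<open>\<rho>\<close> is then
  bounded below: \<open>1 = \<rho>(s + (- s)) \<le> M \<rho>(s)\<^sup>2\<close>.
\<close>

lemma symmetric_weight_divide: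
  fixes \<mu> :: "'g::{group_add,t2_space} measure"
  assumes sets: "sets \<mu> = sets borel"
    and \<sigma>: "symmetric_weight \<mu> \<sigma>" and \<omega>: "symmetric_weight \<mu> \<omega>" and M: "0 < M"
    and le: "\<And>s t. \<sigma> (s + t) / (\<sigma> s * \<sigma> t) \<le> M * \<omega> (s + t) / (\<omega> s * \<omega> t)"
  shows "symmetric_weight \<mu> (\<lambda>s. \<sigma> s / \<omega> s)"
proof -
  have [simp]: "0 < \<sigma> s" "0 < \<omega> s" "\<sigma> (- s) = \<sigma> s" "\<omega> (- s) = \<omega> s" "\<sigma> 0 = 1" "\<omega> 0 = 1"
    "\<sigma> s \<noteq> 0" "\<omega> s \<noteq> 0" for s
    using \<sigma> \<omega> by (auto simp: symmetric_weight_def weight_def) (metis less_irrefl)+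
  have nonneg [simp]: "0 \<le> \<sigma> s" "0 \<le> \<omega> s" for s by (simp_all add: less_imp_le)
  have [measurable]: "\<sigma> \<in> borel_measurable \<mu>" "\<omega> \<in> borel_measurable \<mu>"
    using \<sigma> \<omega> by (auto simp: symmetric_weight_def weight_def)
  have submult: "\<sigma> (s + t) / \<omega> (s + t) / (\<sigma> s / \<omega> s * (\<sigma> t / \<omega> t)) \<le> M" for s t
  proof -
    have "\<sigma> (s + t) / \<omega> (s + t) / (\<sigma> s / \<omega> s * (\<sigma> t / \<omega> t))
        = (\<sigma> (s + t) / (\<sigma> s * \<sigma> t)) * (\<omega> s * \<omega> t / \<omega> (s + t))" by (simp add: field_simps)
    also have "\<dots> \<le> (M * \<omega> (s + t) / (\<omega> s * \<omega> t)) * (\<omega> s * \<omega> t / \<omega> (s + t))"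
      using le by (intro mult_right_mono) auto
    also have "\<dots> = M" by simp
    finally show ?thesis .
  qed
  have lower: "1 / (\<sigma> s / \<omega> s) \<le> sqrt M" for s
  proof (rule real_le_rsqrt)
    show "(1 / (\<sigma> s / \<omega> s))\<^sup>2 \<le> M"
      using submult[of s "- s"] by (simp add: power2_eq_square)
  qed
  have "set_integrable \<mu> K (\<lambda>s. \<sigma> s / \<omega> s)" if K: "compact K" for K
  proof -
    obtain B where B: "0 < B" "\<And>s. 1 / \<omega> s \<le> B"
      using \<omega> bounded_real_range_le[of "\<lambda>s. 1 / \<omega> s"] by (auto simp: symmetric_weight_def weight_def)
    have "set_integrable \<mu> K \<sigma>" using \<sigma> K by (auto simp: symmetric_weight_def weight_def)
    then have int: "integrable \<mu> (\<lambda>s. B * (indicator K s *\<^sub>R \<sigma> s))" by (simp add: set_integrable_def)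
    have le: "norm (indicator K s *\<^sub>R (\<sigma> s / \<omega> s)) \<le> norm (B * (indicator K s *\<^sub>R \<sigma> s))" for s
      using B(1) mult_right_mono[OF B(2)[of s] nonneg(1)[of s]] by (auto simp: indicator_def)
    have meas: "(\<lambda>s. indicator K s *\<^sub>R (\<sigma> s / \<omega> s)) \<in> borel_measurable \<mu>"
    proof -
      have [measurable]: "K \<in> sets \<mu>" using borel_compact[OF K] sets by simp
      show ?thesis by measurable
    qed
    show ?thesis
      unfolding set_integrable_def by (rule Bochner_Integration.integrable_bound[OF int meas AE_I2]) (rule le)
  qed
  moreover have "bounded (range (\<lambda>s. 1 / (\<sigma> s / \<omega> s)))"
  proof (rule boundedI[of _ "sqrt M"])
    fix x assume "x \<in> range (\<lambda>s. 1 / (\<sigma> s / \<omega> s))"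
    then obtain s where s: "x = 1 / (\<sigma> s / \<omega> s)" by blast
    have "0 \<le> x" unfolding s by (intro divide_nonneg_nonneg) auto
    then show "norm x \<le> sqrt M" using lower[of s] s by simp
  qed
  moreover have "bounded (range (\<lambda>(s, t). \<sigma> (s + t) / \<omega> (s + t) / (\<sigma> s / \<omega> s * (\<sigma> t / \<omega> t))))"
  proof (rule boundedI[of _ M])
    fix x assume "x \<in> range (\<lambda>(s, t). \<sigma> (s + t) / \<omega> (s + t) / (\<sigma> s / \<omega> s * (\<sigma> t / \<omega> t)))"
    then obtain s t where x: "x = \<sigma> (s + t) / \<omega> (s + t) / (\<sigma> s / \<omega> s * (\<sigma> t / \<omega> t))" by auto
    have "0 \<le> x" unfolding x by (intro divide_nonneg_nonneg mult_nonneg_nonneg) auto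
    then show "norm x \<le> M" using submult[of s t] x by simp
  qed
  ultimately show ?thesis
    by (simp add: symmetric_weight_def weight_def)
qed

locale weighted_orlicz = twisted_haar \<mu> \<Omega>
  for \<mu> :: "'g::{topological_group_add,t2_space} measure" and \<Omega> +
  fixes \<Phi> \<Psi> :: "real \<Rightarrow> ennreal" and \<sigma> \<omega> \<rho> :: "'g \<Rightarrow> real" and M :: real
  assumes pair: "complementary_young_pair \<Phi> \<Psi>" and finite_\<Phi>: "\<And>x. 0 \<le> x \<Longrightarrow> \<Phi> x < \<infinity>"
    and \<sigma>: "symmetric_weight \<mu> \<sigma>" and \<omega>: "symmetric_weight \<mu> \<omega>" and subadditive: "weakly_subadditive \<omega>"
    and inverse_\<omega>: "(\<lambda>s. complex_of_real (1 / \<omega> s)) \<in> orlicz_space \<mu> \<Psi>" and M: "0 < M"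
    and compare: "\<And>s t. \<sigma> (s + t) / (\<sigma> s * \<sigma> t) \<le> M * \<omega> (s + t) / (\<omega> s * \<omega> t)"
    and \<rho>_def: "\<rho> = (\<lambda>s. \<sigma> s / \<omega> s)"
begin

abbreviation tests :: "('g \<Rightarrow> ennreal) set" where
  "tests \<equiv> orlicz_tests \<mu> \<Psi>"
abbreviation \<Phi>_norm :: "('g \<Rightarrow> complex) \<Rightarrow> ennreal" where
  "\<Phi>_norm f \<equiv> test_norm \<mu> tests (\<lambda>s. ennreal (cmod (f s) * \<sigma> s))"
abbreviation \<rho>_norm :: "('g \<Rightarrow> complex) \<Rightarrow> ennreal" where
  "\<rho>_norm f \<equiv> test_norm \<mu> {\<lambda>_. 1} (\<lambda>s. ennreal (cmod (f s) * \<rho> s))"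
abbreviation \<Phi>_space :: "('g \<Rightarrow> complex) set" where
  "\<Phi>_space \<equiv> {f \<in> borel_measurable \<mu>. (\<lambda>s. f s * of_real (\<sigma> s)) \<in> orlicz_space \<mu> \<Phi>}"
abbreviation \<rho>_space :: "('g \<Rightarrow> complex) set" where
  "\<rho>_space \<equiv> {f \<in> borel_measurable \<mu>. integrable \<mu> (\<lambda>s. f s * of_real (\<rho> s))}"

lemma young: "young_function \<Phi>" "young_function \<Psi>"
  using pair by (auto simp: complementary_young_pair_def)

lemma \<rho>: "symmetric_weight \<mu> \<rho>"
  unfolding \<rho>_def using \<sigma> \<omega> M compare by (intro symmetric_weight_divide) auto

lemma weight_pos [simp]: "0 < \<sigma> s" "0 < \<omega> s" "0 < \<rho> s"
  and weight_uminus [simp]: "\<sigma> (- s) = \<sigma> s" "\<rho> (- s) = \<rho> s"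
  using \<sigma> \<omega> \<rho> by (auto simp: symmetric_weight_def weight_def)

lemma weight_nonneg [simp]: "0 \<le> \<sigma> s" "0 \<le> \<omega> s" "0 \<le> \<rho> s" "\<sigma> s \<noteq> 0" "\<omega> s \<noteq> 0" "\<rho> s \<noteq> 0"
  by (auto simp: less_imp_le less_imp_neq[symmetric])

lemma weight_measurable [measurable]:
  "\<sigma> \<in> borel_measurable borel" "\<omega> \<in> borel_measurable borel" "\<rho> \<in> borel_measurable borel"
  using \<sigma> \<omega> \<rho> by (auto simp: symmetric_weight_def weight_def cong: measurable_cong_sets)

lemma \<rho>_norm_eq: "\<rho>_norm f = (\<integral>\<^sup>+ s. ennreal (cmod (f s) * \<rho> s) \<partial>\<mu>)"
  by (simp add: test_norm_def)

lemma L1_le_\<rho>_norm: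
  "\<exists>B>0. \<forall>f\<in>borel_measurable borel. (\<integral>\<^sup>+ s. enorm (f s) \<partial>\<mu>) \<le> ennreal B * \<rho>_norm f"
proof -
  obtain B where B: "0 < B" "\<And>s. 1 / \<rho> s \<le> B"
    using \<rho> bounded_real_range_le[of "\<lambda>s. 1 / \<rho> s"] by (auto simp: symmetric_weight_def weight_def)
  have "(\<integral>\<^sup>+ s. enorm (f s) \<partial>\<mu>) \<le> ennreal B * \<rho>_norm f"
    if [measurable]: "f \<in> borel_measurable borel" for f
  proof -
    have "(\<integral>\<^sup>+ s. enorm (f s) \<partial>\<mu>) \<le> (\<integral>\<^sup>+ s. ennreal B * ennreal (cmod (f s) * \<rho> s) \<partial>\<mu>)"
    proof (rule nn_integral_mono)
      fix s
      have "1 \<le> B * \<rho> s" using B(2)[of s] by (simp add: divide_le_eq)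
      then have "cmod (f s) * 1 \<le> cmod (f s) * (B * \<rho> s)" by (rule mult_left_mono) simp
      then show "enorm (f s) \<le> ennreal B * ennreal (cmod (f s) * \<rho> s)"
        using B(1) by (simp add: ennreal_mult[symmetric] mult_ac)
    qed
    also have "\<dots> = ennreal B * \<rho>_norm f" unfolding \<rho>_norm_eq by (rule nn_integral_cmult) measurable
    finally show ?thesis .
  qed
  then show ?thesis using B(1) by blast
qed

text \<open>As \<open>|f| \<rho> = |f| \<sigma> / \<omega>\<close>, this is Hoelder's inequality against \<open>1 / \<omega>\<close>.\<close>

lemma \<rho>_norm_le_\<Phi>_norm:
  "\<exists>c>0. \<forall>f\<in>borel_measurable borel. \<rho>_norm f \<le> ennreal c * \<Phi>_norm f"
proof -
  obtain \<alpha> where \<alpha>: "\<alpha> > 0" "(\<integral>\<^sup>+ s. \<Psi> (\<alpha> * (1 / \<omega> s)) \<partial>\<mu>) < \<infinity>"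
    using inverse_\<omega> by (auto simp: orlicz_space_def norm_divide)
  obtain c where c: "c > 0" and hoelder: "\<And>F. F \<in> borel_measurable borel \<Longrightarrow>
      (\<integral>\<^sup>+ s. F s * ennreal (1 / \<omega> s) \<partial>\<mu>) \<le> ennreal c * test_norm \<mu> tests F"
    using orlicz_hoelder[OF young(2) _ _ \<alpha>] by (auto cong: measurable_cong_sets)
  have "\<rho>_norm f \<le> ennreal c * \<Phi>_norm f" if [measurable]: "f \<in> borel_measurable borel" for f
  proof -
    have "\<rho>_norm f = (\<integral>\<^sup>+ s. ennreal (cmod (f s) * \<sigma> s) * ennreal (1 / \<omega> s) \<partial>\<mu>)"
      unfolding \<rho>_norm_eq by (simp add: \<rho>_def ennreal_mult[symmetric])
    also have "\<dots> \<le> ennreal c * \<Phi>_norm f" by (rule hoelder) measurable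
    finally show ?thesis .
  qed
  then show ?thesis using c by blast
qed

lemma L1_le_\<Phi>_norm:
  "\<exists>B>0. \<forall>f\<in>borel_measurable borel. (\<integral>\<^sup>+ s. enorm (f s) \<partial>\<mu>) \<le> ennreal B * \<Phi>_norm f"
proof -
  obtain B c where B: "B > 0" "\<And>f. f \<in> borel_measurable borel \<Longrightarrow> (\<integral>\<^sup>+ s. enorm (f s) \<partial>\<mu>) \<le> ennreal B * \<rho>_norm f"
    and c: "c > 0" "\<And>f. f \<in> borel_measurable borel \<Longrightarrow> \<rho>_norm f \<le> ennreal c * \<Phi>_norm f"
    using L1_le_\<rho>_norm \<rho>_norm_le_\<Phi>_norm by blast
  have "(\<integral>\<^sup>+ s. enorm (f s) \<partial>\<mu>) \<le> ennreal (B * c) * \<Phi>_norm f" if f: "f \<in> borel_measurable borel" for f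
  proof -
    have "(\<integral>\<^sup>+ s. enorm (f s) \<partial>\<mu>) \<le> ennreal B * (ennreal c * \<Phi>_norm f)"
      using B(2)[OF f] c(2)[OF f] by (meson mult_left_mono order_trans zero_le)
    then show ?thesis using B c by (simp add: ennreal_mult mult.assoc)
  qed
  moreover have "B * c > 0" using B c by simp
  ultimately show ?thesis by blast
qed

lemma \<rho>_norm_conv:
  assumes f: "integrable \<mu> f" and g: "integrable \<mu> g"
  shows "\<rho>_norm (conv f g) \<le> ennreal M * \<rho>_norm f * \<rho>_norm g"
proof -
  have [measurable]: "f \<in> borel_measurable borel" "g \<in> borel_measurable borel" using f g by auto
  have "\<rho>_norm (conv f g) \<le> test_norm \<mu> {\<lambda>_. 1} (nnconv (\<lambda>s. f s * of_real (M * \<rho> s)) (\<lambda>s. g s * of_real (\<rho> s))) +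
      test_norm \<mu> {\<lambda>_. 1} (nnconv (\<lambda>s. f s * of_real 0) (\<lambda>s. g s * of_real 0))"
  proof (rule test_norm_conv_le[OF _ f g])
    fix s t
    have "\<rho> (s + t) \<le> M * (\<rho> s * \<rho> t)"
      using compare[of s t] by (simp add: \<rho>_def divide_le_eq le_divide_eq field_simps)
    then show "\<rho> (s + t) \<le> M * \<rho> s * \<rho> t + 0 * 0" by simp
  qed (use M in auto)
  also have "test_norm \<mu> {\<lambda>_. 1} (nnconv (\<lambda>s. f s * of_real 0) (\<lambda>s. g s * of_real 0)) = 0"
    by (simp add: test_norm_def nnconv_def)
  also have "test_norm \<mu> {\<lambda>_. 1} (nnconv (\<lambda>s. f s * of_real (M * \<rho> s)) (\<lambda>s. g s * of_real (\<rho> s)))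
    \<le> (\<integral>\<^sup>+ s. enorm (f s * of_real (M * \<rho> s)) \<partial>\<mu>) * test_norm \<mu> {\<lambda>_. 1} (\<lambda>s. enorm (g s * of_real (\<rho> s)))"
    by (intro test_norm_nnconv sigma_supported_times integrable_sigma_supported f g) auto
  also have "(\<integral>\<^sup>+ s. enorm (f s * of_real (M * \<rho> s)) \<partial>\<mu>) = (\<integral>\<^sup>+ s. ennreal M * ennreal (cmod (f s) * \<rho> s) \<partial>\<mu>)"
    using M by (simp add: norm_mult ennreal_mult[symmetric] mult_ac)
  also have "\<dots> = ennreal M * \<rho>_norm f" unfolding \<rho>_norm_eq by (rule nn_integral_cmult) measurable
  finally show ?thesis by (simp add: norm_mult)
qed

text \<open>
  The differential inequality. Weak subadditivity of \<open>\<omega>\<close> turns the bound for \<open>\<sigma>\<close> into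
  \<open>\<sigma>(s + t) \<le> M C (\<sigma>(s) \<rho>(t) + \<rho>(s) \<sigma>(t))\<close>.
\<close>

lemma \<Phi>_norm_conv:
  "\<exists>D>0. \<forall>f g. integrable \<mu> f \<longrightarrow> integrable \<mu> g \<longrightarrow>
    \<Phi>_norm (conv f g) \<le> ennreal D * (\<Phi>_norm f * \<rho>_norm g + \<rho>_norm f * \<Phi>_norm g)"
proof -
  obtain C where C: "0 < C" "\<And>s t. \<omega> (s + t) \<le> C * (\<omega> s + \<omega> t)"
    using subadditive by (auto simp: weakly_subadditive_def)
  let ?D = "M * C"
  have "\<Phi>_norm (conv f g) \<le> ennreal ?D * (\<Phi>_norm f * \<rho>_norm g + \<rho>_norm f * \<Phi>_norm g)"
    if f: "integrable \<mu> f" and g: "integrable \<mu> g" for f g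
  proof -
    have [measurable]: "f \<in> borel_measurable borel" "g \<in> borel_measurable borel" using f g by auto
    have V: "tests \<subseteq> borel_measurable borel" by (rule orlicz_tests_measurable)
    have scale: "test_norm \<mu> U (\<lambda>s. enorm (f s * of_real (?D * a s))) = ennreal ?D * test_norm \<mu> U (\<lambda>s. ennreal (cmod (f s) * a s))"
      if "U \<subseteq> borel_measurable \<mu>" and [measurable]: "a \<in> borel_measurable borel" and "\<And>s. 0 \<le> a s" for U and a :: "'g \<Rightarrow> real"
    proof -
      have "(\<lambda>s. enorm (f s * of_real (?D * a s))) = (\<lambda>s. ennreal ?D * ennreal (cmod (f s) * a s))"
        using M C(1) that(3) by (simp add: norm_mult ennreal_mult[symmetric] mult_ac)
      then show ?thesis using that(1) by (simp add: test_norm_cmult)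
    qed
    have "\<Phi>_norm (conv f g) \<le> test_norm \<mu> tests (nnconv (\<lambda>s. f s * of_real (?D * \<sigma> s)) (\<lambda>s. g s * of_real (\<rho> s))) +
        test_norm \<mu> tests (nnconv (\<lambda>s. f s * of_real (?D * \<rho> s)) (\<lambda>s. g s * of_real (\<sigma> s)))"
    proof (rule test_norm_conv_le[OF V f g])
      fix s t
      have "\<sigma> (s + t) = \<sigma> (s + t) / (\<sigma> s * \<sigma> t) * (\<sigma> s * \<sigma> t)" by simp
      also have "\<dots> \<le> M * \<omega> (s + t) / (\<omega> s * \<omega> t) * (\<sigma> s * \<sigma> t)"
        using compare by (intro mult_right_mono) auto
      also have "\<dots> = M * (\<sigma> s * \<sigma> t) / (\<omega> s * \<omega> t) * \<omega> (s + t)" by simp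
      also have "\<dots> \<le> M * (\<sigma> s * \<sigma> t) / (\<omega> s * \<omega> t) * (C * (\<omega> s + \<omega> t))"
        using M by (intro mult_left_mono C(2)) auto
      also have "\<dots> = ?D * \<sigma> s * \<rho> t + ?D * \<rho> s * \<sigma> t"
        by (simp add: \<rho>_def field_simps)
      finally show "\<sigma> (s + t) \<le> ?D * \<sigma> s * \<rho> t + ?D * \<rho> s * \<sigma> t" .
    qed (use M C(1) in auto)
    also have "\<dots> \<le> ennreal ?D * \<Phi>_norm f * \<rho>_norm g + ennreal ?D * \<rho>_norm f * \<Phi>_norm g"
    proof (rule add_mono)
      have "test_norm \<mu> tests (nnconv (\<lambda>s. f s * of_real (?D * \<sigma> s)) (\<lambda>s. g s * of_real (\<rho> s)))
        \<le> test_norm \<mu> tests (\<lambda>s. enorm (f s * of_real (?D * \<sigma> s))) * (\<integral>\<^sup>+ s. enorm (g s * of_real (\<rho> s)) \<partial>\<mu>)"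
        by (intro test_norm_nnconv_right V orlicz_tests_invariant young(2) sigma_supported_times
            integrable_sigma_supported f g) auto
      also have "\<dots> = ennreal ?D * \<Phi>_norm f * \<rho>_norm g"
        using V by (subst scale) (auto simp: \<rho>_norm_eq norm_mult cong: measurable_cong_sets)
      finally show "test_norm \<mu> tests (nnconv (\<lambda>s. f s * of_real (?D * \<sigma> s)) (\<lambda>s. g s * of_real (\<rho> s)))
        \<le> ennreal ?D * \<Phi>_norm f * \<rho>_norm g" .
      have "test_norm \<mu> tests (nnconv (\<lambda>s. f s * of_real (?D * \<rho> s)) (\<lambda>s. g s * of_real (\<sigma> s)))
        \<le> (\<integral>\<^sup>+ s. enorm (f s * of_real (?D * \<rho> s)) \<partial>\<mu>) * test_norm \<mu> tests (\<lambda>s. enorm (g s * of_real (\<sigma> s)))"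
        by (intro test_norm_nnconv V orlicz_tests_invariant young(2) sigma_supported_times
            integrable_sigma_supported f g) auto
      also have "(\<integral>\<^sup>+ s. enorm (f s * of_real (?D * \<rho> s)) \<partial>\<mu>) = ennreal ?D * \<rho>_norm f"
        using scale[of "{\<lambda>_. 1}" \<rho>] by (simp add: test_norm_def)
      also have "test_norm \<mu> tests (\<lambda>s. enorm (g s * of_real (\<sigma> s))) = \<Phi>_norm g"
        by (simp add: norm_mult)
      finally show "test_norm \<mu> tests (nnconv (\<lambda>s. f s * of_real (?D * \<rho> s)) (\<lambda>s. g s * of_real (\<sigma> s)))
        \<le> ennreal ?D * \<rho>_norm f * \<Phi>_norm g" .
    qed
    also have "\<dots> = ennreal ?D * (\<Phi>_norm f * \<rho>_norm g + \<rho>_norm f * \<Phi>_norm g)"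
      by (simp add: distrib_left mult.assoc)
    finally show ?thesis .
  qed
  moreover have "?D > 0" using M C(1) by simp
  ultimately show ?thesis by blast
qed

text \<open>
  A function of finite norm is integrable, hence lives on a \<sigma>-compact set; scaled to norm below \<open>1\<close>, it has
  modular at most \<open>1\<close>.
\<close>

lemma \<Phi>_space_eq: "\<Phi>_space = {f \<in> borel_measurable borel. \<Phi>_norm f < \<infinity>}"
proof (intro set_eqI iffI)
  fix f assume "f \<in> \<Phi>_space"
  then obtain \<beta> where [measurable]: "f \<in> borel_measurable borel"
    and \<beta>: "\<beta> > 0" "(\<integral>\<^sup>+ s. \<Phi> (\<beta> * (cmod (f s) * \<sigma> s)) \<partial>\<mu>) < \<infinity>"
    by (auto simp: orlicz_space_def norm_mult cong: measurable_cong_sets)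
  have "\<Phi>_norm f < \<infinity>"
    by (rule orlicz_test_norm_finite[OF pair _ _ \<beta>]) auto
  then show "f \<in> {f \<in> borel_measurable borel. \<Phi>_norm f < \<infinity>}" by simp
next
  fix f assume "f \<in> {f \<in> borel_measurable borel. \<Phi>_norm f < \<infinity>}"
  then have f [measurable]: "f \<in> borel_measurable borel" and fin: "\<Phi>_norm f < \<infinity>" by auto
  have "integrable \<mu> f"
  proof (rule integrableI_bounded)
    obtain B where le: "(\<integral>\<^sup>+ s. enorm (f s) \<partial>\<mu>) \<le> ennreal B * \<Phi>_norm f" using L1_le_\<Phi>_norm f by blast
    have "ennreal B * \<Phi>_norm f < \<infinity>" using fin by (simp add: ennreal_mult_less_top)
    then show "(\<integral>\<^sup>+ s. norm (f s) \<partial>\<mu>) < \<infinity>" using le by (rule le_less_trans[rotated])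
  qed simp
  then obtain S where S: "sigma_compact S" "AE x in \<mu>. x \<notin> S \<longrightarrow> f x = 0"
    using integrable_sigma_supported unfolding sigma_supported_def by blast
  then obtain K where K: "\<And>n::nat. compact (K n)" "S = (\<Union>n. K n)" by (auto simp: sigma_compact_def)
  define A where "A n = (\<Union>k\<le>n. K k)" for n
  have A: "compact (A n)" for n unfolding A_def using K by (intro compact_UN) auto
  define \<beta> where "\<beta> = 1 / (enn2real (\<Phi>_norm f) + 1)"
  have \<beta>: "\<beta> > 0" by (simp add: \<beta>_def add_nonneg_pos)
  have "(\<integral>\<^sup>+ s. \<Phi> (\<beta> * (cmod (f s) * \<sigma> s)) \<partial>\<mu>) \<le> 1"
  proof (rule orlicz_modular_le_one[OF pair finite_\<Phi>])
    have "test_norm \<mu> tests (\<lambda>s. ennreal (\<beta> * (cmod (f s) * \<sigma> s))) = ennreal \<beta> * \<Phi>_norm f"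
      using \<beta> orlicz_tests_measurable
      by (subst test_norm_cmult[symmetric]) (auto simp: ennreal_mult[symmetric] cong: measurable_cong_sets)
    also have "\<dots> = ennreal \<beta> * ennreal (enn2real (\<Phi>_norm f))" using fin by simp
    also have "\<dots> = ennreal (\<beta> * enn2real (\<Phi>_norm f))" using \<beta> by (simp add: ennreal_mult)
    also have "\<dots> < 1"
      by (simp add: \<beta>_def divide_less_eq add_nonneg_pos)
    finally show "test_norm \<mu> tests (\<lambda>s. ennreal (\<beta> * (cmod (f s) * \<sigma> s))) < 1" .
    show "A n \<in> sets \<mu>" "emeasure \<mu> (A n) < \<infinity>" for n
      using A borel_compact emeasure_compact by auto
    show "incseq A" unfolding incseq_def A_def by (intro allI impI UN_mono) auto
    show "AE s in \<mu>. \<beta> * (cmod (f s) * \<sigma> s) = 0 \<or> s \<in> (\<Union>n. A n)"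
      using S(2)
    proof eventually_elim
      fix s assume s: "s \<notin> S \<longrightarrow> f s = 0"
      have "S \<subseteq> (\<Union>n. A n)" unfolding K(2) A_def by blast
      then show "\<beta> * (cmod (f s) * \<sigma> s) = 0 \<or> s \<in> (\<Union>n. A n)" using s by auto
    qed
    show "0 \<le> \<beta> * (cmod (f s) * \<sigma> s)" for s using \<beta> by simp
    show "(\<lambda>s. \<beta> * (cmod (f s) * \<sigma> s)) \<in> borel_measurable \<mu>" by measurable
  qed
  then have "(\<integral>\<^sup>+ s. \<Phi> (\<beta> * cmod (f s * of_real (\<sigma> s))) \<partial>\<mu>) < \<infinity>"
    by (simp add: norm_mult) (metis ennreal_one_less_top infinity_ennreal_def le_less_trans)
  then show "f \<in> \<Phi>_space"
    using \<beta> by (auto simp: orlicz_space_def cong: measurable_cong_sets)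
qed

lemma \<rho>_space_eq: "\<rho>_space = {f \<in> borel_measurable borel. \<rho>_norm f < \<infinity>}"
  by (auto simp: integrable_iff_bounded norm_mult \<rho>_norm_eq cong: measurable_cong_sets)

lemma \<Phi>_space_subset: "\<Phi>_space \<subseteq> \<rho>_space"
proof
  fix f assume "f \<in> \<Phi>_space"
  then have meas: "f \<in> borel_measurable borel" and fin: "\<Phi>_norm f < \<infinity>" unfolding \<Phi>_space_eq by auto
  obtain c where "\<rho>_norm f \<le> ennreal c * \<Phi>_norm f" using \<rho>_norm_le_\<Phi>_norm meas by blast
  also have "\<dots> < \<infinity>" using fin by (simp add: ennreal_mult_less_top)
  finally show "f \<in> \<rho>_space" unfolding \<rho>_space_eq using meas by simp
qed

text \<open>Together with the embedding into the weighted \<open>L\<^sup>1\<close>, the differential inequality bounds the multiplication.\<close>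

sublocale O: weighted_space \<mu> \<Omega> tests \<sigma> \<Phi>_space "\<lambda>f. orlicz_norm \<mu> \<Psi> (\<lambda>s. f s * of_real (\<sigma> s))"
proof
  show "\<exists>k<\<infinity>. \<forall>f\<in>borel_measurable borel. (\<integral>\<^sup>+ s. enorm (f s) \<partial>\<mu>) \<le> k * \<Phi>_norm f"
    using L1_le_\<Phi>_norm ennreal_less_top by (metis infinity_ennreal_def)
  obtain D c where D: "D > 0" "\<And>f g. integrable \<mu> f \<Longrightarrow> integrable \<mu> g \<Longrightarrow>
      \<Phi>_norm (conv f g) \<le> ennreal D * (\<Phi>_norm f * \<rho>_norm g + \<rho>_norm f * \<Phi>_norm g)"
    and c: "c > 0" "\<And>f. f \<in> borel_measurable borel \<Longrightarrow> \<rho>_norm f \<le> ennreal c * \<Phi>_norm f"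
    using \<Phi>_norm_conv \<rho>_norm_le_\<Phi>_norm by blast
  have "\<Phi>_norm (conv f g) \<le> ennreal (2 * D * c) * \<Phi>_norm f * \<Phi>_norm g" if f: "integrable \<mu> f" "integrable \<mu> g" for f g
  proof -
    have [measurable]: "f \<in> borel_measurable borel" "g \<in> borel_measurable borel" using f by auto
    have "\<Phi>_norm (conv f g) \<le> ennreal D * (\<Phi>_norm f * (ennreal c * \<Phi>_norm g) + ennreal c * \<Phi>_norm f * \<Phi>_norm g)"
      using f by (intro order_trans[OF D(2)] mult_left_mono add_mono mult_right_mono c(2)) auto
    also have "\<dots> = ennreal D * ennreal c * 2 * (\<Phi>_norm f * \<Phi>_norm g)"
      by (simp add: mult_ac mult_2 distrib_left)
    also have "\<dots> = ennreal (2 * D * c) * \<Phi>_norm f * \<Phi>_norm g"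
      using D(1) c by (simp add: ennreal_mult mult_ac)
    finally show ?thesis .
  qed
  then show "\<exists>k<\<infinity>. \<forall>f\<in>\<Phi>_space. \<forall>g\<in>\<Phi>_space. integrable \<mu> f \<longrightarrow> integrable \<mu> g \<longrightarrow>
      \<Phi>_norm (conv f g) \<le> k * \<Phi>_norm f * \<Phi>_norm g"
    by (intro exI[of _ "ennreal (2 * D * c)"]) simp
qed (use \<Phi>_space_eq orlicz_tests_measurable orlicz_tests_invariant(2)[OF young(2)] in
    \<open>auto simp: orlicz_norm_eq_test_norm\<close>)

sublocale L: weighted_space \<mu> \<Omega> "{\<lambda>_. 1}" \<rho> \<rho>_space "\<lambda>f. \<integral>s. cmod (f s * of_real (\<rho> s)) \<partial>\<mu>"
proof
  show "\<exists>k<\<infinity>. \<forall>f\<in>borel_measurable borel. (\<integral>\<^sup>+ s. enorm (f s) \<partial>\<mu>) \<le> k * \<rho>_norm f"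
    using L1_le_\<rho>_norm ennreal_less_top by (metis infinity_ennreal_def)
  show "\<exists>k<\<infinity>. \<forall>f\<in>\<rho>_space. \<forall>g\<in>\<rho>_space. integrable \<mu> f \<longrightarrow> integrable \<mu> g \<longrightarrow>
      \<rho>_norm (conv f g) \<le> k * \<rho>_norm f * \<rho>_norm g"
    using \<rho>_norm_conv by (intro exI[of _ "ennreal M"]) simp
  show "(\<integral>s. cmod (f s * of_real (\<rho> s)) \<partial>\<mu>) = enn2real (\<rho>_norm f)" if "f \<in> \<rho>_space" for f
    using that unfolding \<rho>_norm_eq by (subst integral_eq_nn_integral) (auto simp: norm_mult)
qed (use \<rho>_space_eq in auto)

lemma subalgebra: "subalgebra O.A L.A"
  unfolding subalgebra_def O.carrier_A L.carrier_A O.zero_A L.zero_A ball_simps(9)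
proof (intro conjI ballI allI)
  show "O.cls ` \<Phi>_space \<subseteq> L.cls ` \<rho>_space" using \<Phi>_space_subset by (rule image_mono)
  fix f z assume f: "f \<in> \<Phi>_space"
  note f' = subsetD[OF \<Phi>_space_subset f]
  show "ascale O.A z (O.cls f) = ascale L.A z (O.cls f)"
    by (simp only: O.scale_A[OF f] L.scale_A[OF f'])
  fix g assume g: "g \<in> \<Phi>_space"
  note g' = subsetD[OF \<Phi>_space_subset g]
  show "aadd O.A (O.cls f) (O.cls g) = aadd L.A (O.cls f) (O.cls g)"
    by (simp only: O.add_A[OF f g] L.add_A[OF f' g'])
  show "amult O.A (O.cls f) (O.cls g) = amult L.A (O.cls f) (O.cls g)"
    by (simp only: O.mult_A[OF f g] L.mult_A[OF f' g'])
qed (rule refl)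

lemma differential: "differential_subalgebra O.A L.A"
proof -
  obtain D where D: "D > 0" and le: "\<And>f g. integrable \<mu> f \<Longrightarrow> integrable \<mu> g \<Longrightarrow>
      \<Phi>_norm (conv f g) \<le> ennreal D * (\<Phi>_norm f * \<rho>_norm g + \<rho>_norm f * \<Phi>_norm g)"
    using \<Phi>_norm_conv by blast
  have "anorm O.A (amult O.A a b) \<le> D * (anorm O.A a * anorm L.A b + anorm L.A a * anorm O.A b)"
    if ab: "a \<in> acarrier O.A" "b \<in> acarrier O.A" for a b
  proof -
    obtain f g where f: "f \<in> \<Phi>_space" "a = O.cls f" and g: "g \<in> \<Phi>_space" "b = O.cls g"
      using ab unfolding O.carrier_A by (elim imageE) (rule that)
    have norms: "\<Phi>_norm h = ennreal (anorm O.A (O.cls h))" "\<rho>_norm h = ennreal (anorm L.A (O.cls h))"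
      "0 \<le> anorm O.A (O.cls h)" "0 \<le> anorm L.A (O.cls h)" if h: "h \<in> \<Phi>_space" for h
    proof -
      note h' = subsetD[OF \<Phi>_space_subset h]
      show "\<Phi>_norm h = ennreal (anorm O.A (O.cls h))" "\<rho>_norm h = ennreal (anorm L.A (O.cls h))"
        "0 \<le> anorm O.A (O.cls h)" "0 \<le> anorm L.A (O.cls h)"
        unfolding O.norm_A[OF h] L.norm_A[OF h']
        by (rule O.nrm_N[OF h] L.nrm_N[OF h'] O.N_nonneg[OF h] L.N_nonneg[OF h'])+
    qed
    note n = norms(1,2)[OF f(1)] norms(1,2)[OF g(1)]
    note pos = norms(3,4)[OF f(1)] norms(3,4)[OF g(1)]
    have "ennreal (anorm O.A (amult O.A a b)) = \<Phi>_norm (conv f g)"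
      unfolding f g O.mult_A[OF f(1) g(1)] by (rule norms(1)[OF O.X_conv[OF f(1) g(1)], symmetric])
    also have "\<dots> \<le> ennreal D * (\<Phi>_norm f * \<rho>_norm g + \<rho>_norm f * \<Phi>_norm g)"
      by (intro le O.X_integrable f g)
    also have "\<dots> = ennreal (D * (anorm O.A a * anorm L.A b + anorm L.A a * anorm O.A b))"
      unfolding n f(2) g(2) using pos D
      by (simp add: ennreal_mult[symmetric] ennreal_plus[symmetric] del: ennreal_plus)
    finally show ?thesis
      using pos D unfolding f(2) g(2) by (subst (asm) ennreal_le_iff) auto
  qed
  then show ?thesis
    unfolding differential_subalgebra_def
    using D by (intro conjI O.banach_algebra_A L.banach_algebra_A subalgebra exI[of _ D]) auto
qed

lemma differential_star: "differential_star_subalgebra O.A L.A"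
proof -
  have "\<forall>a\<in>acarrier O.A. astar O.A a = astar L.A a"
    unfolding O.carrier_A ball_simps(9)
  proof
    fix f assume f: "f \<in> \<Phi>_space"
    show "astar O.A (O.cls f) = astar L.A (O.cls f)"
      by (simp only: O.star_A[OF f] L.star_A[OF subsetD[OF \<Phi>_space_subset f]])
  qed
  then show ?thesis
    unfolding differential_star_subalgebra_def
    by (intro conjI differential O.banach_star_algebra_A L.banach_star_algebra_A)
qed

end

theorem theorem4p5:
  fixes \<mu> :: "'g::{topological_group_add,t2_space} measure"
    and \<Phi> \<Psi> :: "real \<Rightarrow> ennreal"
    and \<Omega> :: "'g \<times> 'g \<Rightarrow> complex"
    and \<sigma> \<omega> \<rho> :: "'g \<Rightarrow> real"
    and M :: real
  assumes "locally_compact_space (euclidean :: 'g topology)"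
    and "left_haar_measure \<mu>"
    and "unimodular \<mu>"
    and "complementary_young_pair \<Phi> \<Psi>"
    and "\<forall>x\<ge>0. \<Phi> x < \<infinity>"
    and "continuous_on {0..} \<Phi>"
    and "\<forall>x>0. 0 < \<Phi> x"
    and "\<Omega> \<in> Z2bs \<mu>"
    and "symmetric_weight \<mu> \<sigma>"
    and "associated_weight \<mu> \<Omega> \<sigma>"
    and "symmetric_weight \<mu> \<omega>"
    and "weakly_subadditive \<omega>"
    and "(\<lambda>s. complex_of_real (1 / \<omega> s)) \<in> orlicz_space \<mu> \<Psi>"
    and "0 < M"
    and "\<forall>s t. \<sigma> (s + t) / (\<sigma> s * \<sigma> t) \<le> M * \<omega> (s + t) / (\<omega> s * \<omega> t)"
    and "\<rho> = (\<lambda>s. \<sigma> s / \<omega> s)"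
  shows "symmetric_weight \<mu> \<rho> \<and>
    differential_star_subalgebra (orlicz_algebra \<mu> \<Omega> \<Phi> \<Psi> \<sigma>) (L1_algebra \<mu> \<Omega> \<rho>) \<and>
    (symmetric_algebra (L1_algebra \<mu> \<Omega> \<rho>) \<longrightarrow> symmetric_algebra (orlicz_algebra \<mu> \<Omega> \<Phi> \<Psi> \<sigma>))"
proof -
  interpret weighted_orlicz \<mu> \<Omega> \<Phi> \<Psi> \<sigma> \<omega> \<rho> M
    using assms by unfold_locales (auto simp: Z2bs_def Z2bw_def Z2b_def)
  have algebras: "orlicz_algebra \<mu> \<Omega> \<Phi> \<Psi> \<sigma> = O.A" "L1_algebra \<mu> \<Omega> \<rho> = L.A"
    by (simp_all add: orlicz_algebra_def L1_algebra_def)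
  show ?thesis
    unfolding algebras
    by (intro conjI impI \<rho> differential_star)
      (rule symmetric_algebra_differential_subalgebra[OF differential_star])
qed

end
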